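(* Let $p$ be an odd prime, $\eta$ trivial or $\left(\frac\cdot p\right)$, $\ell\ge1$, and let $\widetilde\pi=\operatorname{c-Ind}_{\widetilde K}^{\widetilde G}\widetilde\rho$, where $K\in\{K^0,K^1\}$ and $\widetilde\rho$ are as specified in each case. (i) (Unramified, $\ell$ even.) Put $m=\ell/2$. Let $(\rho,W)$ be an irreducible strongly cuspidal representation of $K=K^0$ arising from an unramified datum of level $\ell$, so that $c(\rho)=\ell$, $d(\rho)=0$. Let $w\in W^U_{\eta_\ell}$ and let $\widetilde\rho$ be the genuine lift of $\rho$ with respect to $s^0$. Then $f_w\in\widetilde\pi_\eta^{K_{2\ell}}$. (ii) (Unramified, $\ell$ odd.) Put $m=(\ell-1)/2$. Let $(\rho,W)$ be an irreducible strongly cuspidal representation of $K^0$ arising from an unramified datum of level $\ell$, so that $c(\rho)=\ell$, $d(\rho)=0$; let $\rho^\alpha(k)=\rho(\alpha k\alpha^{-1})$, a representation of $K=K^1$, and let $\widetilde\rho$ be the genuine lift of $\rho^\alpha$ with respect to $s^1$. Then $\rho^\alpha$ again has conductor $\ell$ and defect $0$, and for $w\in W^U_{\eta_\ell}$ one has $f_w\in\widetilde\pi_\eta^{K_{2\ell}}$. (iii) (Ramified, $\ell$ even.) Put $m=\ell/2$. Let $(\sigma,W)$ be an Iwahori constituent arising from a ramified datum of level $\ell$, and put $\rho=\operatorname{Ind}_I^{K^1}\sigma$. Then $\rho$ is irreducible and strongly cuspidal with $c(\rho)=\ell+1$, $d(\rho)=1$. For $w\in W^U_{\eta_\ell}$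 define $\phi_w\in\rho$ by $\phi_w(k)=\sigma(k)w$ for $k\in I$ and $\phi_w(k)=0$ for $k\notin I$. Then $\phi_w$ is fixed by $N_\ell$ and $\overline N_{\ell+1}$, and $\rho(h(u))\phi_w=\eta_\ell(u)\phi_w$ for $u\in\mathbb Z_p^\times$. With $\widetilde\rho$ the genuine lift of $\rho$ with respect to $s^1$ ($K=K^1$), $f_{\phi_w}\in\widetilde\pi_\eta^{K_{2\ell+1}}$. (iv) (Ramified, $\ell$ odd.) Put $m=(\ell-1)/2$. Let $(\sigma,W)$ be an Iwahori constituent arising from a ramified datum of level $\ell$, and put $\rho=\operatorname{Ind}_I^{K^0}\sigma$. For $w\in W^U_{\eta_\ell}$ define $\phi_w\in\rho$ by the same formula as in (iii) (for $k\in K^0$), and let $\rho^\alpha(k)=\rho(\alpha k\alpha^{-1})$ on $K=K^1$. Then $\rho^\alpha$ is irreducible and strongly cuspidal with $c(\rho^\alpha)=\ell+1$, $d(\rho^\alpha)=1$. With $\widetilde\rho$ the genuine lift of $\rho^\alpha$ with respect to $s^1$, $f_{\phi_w}\in\widetilde\pi_\eta^{K_{2\ell+1}}$. Moreover, in (i)–(ii) every $w\in W^U_{\eta_\ell}$ is fixed by $\overline N_\ell$ and $\operatorname{Hom}_{\overline N_{\ell-1}}(1,\rho)=0$; in (iii) $\operatorname{Hom}_{\overline N_\ell}(1,\rho)=0$. Finally $c_\eta(\widetilde\pi)=2\ell$ in (i)–(ii) and $c_\eta(\widetilde\pi)=2\ell+1$ in (iii)–(iv), so that, for $0\ne w\in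 W^U_{\eta_\ell}$, the vectors $f_w$ in cases (i)–(ii) and $f_{\phi_w}$ in cases (iii)–(iv) are newvectors (nonzero vectors of $\widetilde\pi_\eta^{K_r}$ at the minimal level $r=c_\eta(\widetilde\pi)$).
   Context: Cover. $G=\mathrm{SL}_2(\mathbb Q_p)$, $(\cdot,\cdot)_p$ the quadratic Hilbert symbol. For $A=\begin{pmatrix}a&b\\ c&d\end{pmatrix}$ put $\tau(A)=c$ if $c\ne0$, $\tau(A)=d$ if $c=0$; for $g\in G$, $s_p(g)=(c,d)_p$ if $cd\neq0$ and $\mathrm{ord}_p(c)$ odd, $s_p(g)=1$ otherwise; $c(g,h)=(\tau(gh)\tau(g),\tau(gh)\tau(h))_p\,s_p(g)s_p(h)s_p(gh)$. $\widetilde G=G\times\{\pm1\}$ with $(g,\epsilon_1)(h,\epsilon_2)=(gh,\epsilon_1\epsilon_2c(g,h))$; a tilde or bar over a subgroup denotes its full inverse image. $x(s)=\begin{pmatrix}1&s\\ 0&1\end{pmatrix}$, $y(s)=\begin{pmatrix}1&0\\ s&1\end{pmatrix}$, $h(t)=\mathrm{diag}(t,t^{-1})$, $w(t)=\begin{pmatrix}0&t\\ -t^{-1}&0\end{pmatrix}$, $\alpha=\mathrm{diag}(p,1)$, $K^0=\mathrm{SL}_2(\mathbb Z_p)$, $K^1=\alpha^{-1}K^0\alpha$, $K_r=K_0(p^r)\subset K^0$ (lower-left entry in $p^r\mathbb Z_p$). Splittings. $s^\delta:K^\delta\to\{\pm1\}$ ($\delta=0,1$) is the function such that $k\mapsto(k,s^\delta(k))$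 is a homomorphism, with $s^0=1$ on $x(\mathbb Z_p),y(\mathbb Z_p),h(\mathbb Z_p^\times),w(1)$, and $s^1=1$ on $x(p^{-1}\mathbb Z_p),y(p\mathbb Z_p),w(p^{-1})$, $s^1(h(u))=\left(\frac up\right)$ for $u\in\mathbb Z_p^\times$. The genuine lift of a representation $\rho$ of $K^\delta$ is $\widetilde\rho((k,\epsilon))=\epsilon s^\delta(k)\rho(k)$. Types. $N_r=x(p^r\mathbb Z_p)$, $\overline N_r=y(p^r\mathbb Z_p)$, $J^\delta_\ell=\{\begin{pmatrix}a&b\\ c&d\end{pmatrix}\in K^\delta:a,d\in1+p^\ell\mathbb Z_p,b\in p^{\ell-\delta}\mathbb Z_p,c\in p^{\ell+\delta}\mathbb Z_p\}$. For a representation $\sigma$ of $K^\delta$, its conductor $c(\sigma)$ is the least $r$ with $\sigma$ trivial on $J_r^\delta$; $\sigma$ is strongly cuspidal if $\operatorname{Hom}_{N_{c(\sigma)-2\delta-1}}(\sigma,1)=0$ (with $N_r$ read as $N_r\cap K^\delta$); a strongly cuspidal $\sigma$ has defect $d(\sigma)=1$ if $\operatorname{Hom}_{N_{c(\sigma)-\delta-1}}(\sigma,1)\ne0$, else $d(\sigma)=0$. Data. $K_{\mathrm{GL}}=\mathrm{GL}_2(\mathbb Z_p)$; $I_{\mathrm{GL}}=\{\begin{pmatrix}a&b\\ c&d\end{pmatrix}\in K_{\mathrm{GL}}:c\in p\mathbb Z_p\}$; $Z$ the center of $\mathrm{GL}_2(\mathbb Q_p)$; $Z'$ the group generated by $\begin{pmatrix}0&1\\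 p&0\end{pmatrix}$; $I=I_{\mathrm{GL}}\cap G$. An unramified (resp. ramified) very cuspidal datum of level $\ell\ge1$ is an irreducible smooth representation $\tau$ of $ZK_{\mathrm{GL}}$ (resp. $Z'I_{\mathrm{GL}}$) trivial on $1+p^\ell M_2(\mathbb Z_p)$ (resp. on $\{\begin{pmatrix}a&b\\ c&d\end{pmatrix}\in I_{\mathrm{GL}}:a,d\in1+p^\ell\mathbb Z_p,b\in p^\ell\mathbb Z_p,c\in p^{\ell+1}\mathbb Z_p\}$) with $\operatorname{Hom}_{N_{\ell-1}}(1,\tau)=0$. A representation of $K^0$ "arising from" an unramified datum is an irreducible constituent of $\tau|_{K^0}$; an Iwahori constituent of a ramified datum is an irreducible constituent of $\tau|_I$ (it is known $\tau|_I$ splits into two). Weights. $\eta_\ell=\eta$ for unramified with $\ell$ even; $\eta_\ell=\eta\cdot\left(\frac\cdot p\right)$ for unramified with $\ell$ odd and in the ramified case. $W^U_\chi=\{w\in W:h(u)w=\chi(u)w\ \forall u\in\mathbb Z_p^\times\}$ (action by $\rho$ in (i),(ii), by $\sigma$ in (iii),(iv)). Central compatibility is assumed: $-I$ acts on $W$ by $\eta_\ell(-1)$. Vectors. Given $m$, $K$, $\widetilde\rho$ and a vector $v$ of $\widetilde\rho$, $f_v:\widetilde G\to$ (space of $\widetilde\rho$) is $f_v((g,\epsilon))=c(k,h(p^m))\,\epsilon\,\widetilde\rho((k,1))v$ if $g=kh(p^m)$, $k\in K$, and $0$ if $g\notin Kh(p^m)$; it lies in $\operatorname{c-Ind}_{\widetilde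 K}^{\widetilde G}\widetilde\rho$ (functions with $f(\tilde k\tilde g)=\widetilde\rho(\tilde k)f(\tilde g)$, right translation action). $\eta$ defines the genuine character $\eta((\begin{pmatrix}a&b\\ c&d\end{pmatrix},\epsilon))=\epsilon\eta(d)$ of $\overline{K_r}$, $\widetilde\pi_\eta^{K_r}=\{f:\widetilde\pi(\tilde k)f=\eta(\tilde k)f\ \forall\tilde k\in\overline{K_r}\}$, and $c_\eta(\widetilde\pi)$ is the least admissible $r$ ($r\ge c(\eta)$, the conductor exponent of $\eta$) with $\widetilde\pi_\eta^{K_r}\ne0$. *)

theory Defs
  imports
    "HOL-Analysis.Analysis"
    "HOL-Algebra.Generated_Groups"
    "HOL-Number_Theory.Residues"
    "HOL-Computational_Algebra.Fraction_Field"
    "HOL-Library.Function_Algebras"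
begin

section \<open>The field of p-adic numbers\<close>

text \<open>The prime is carried by a type: \<open>p = CARD('p)\<close>. The ring \<open>Z_p\<close> is the inverse limit
  of the rings \<open>Z/p^n\<close> (with canonical representatives), and \<open>Q_p\<close> is its fraction field.\<close>

class prime_type =
  assumes prime_type: "prime CARD('a)"

lemma prime_int_CARD: "prime (int CARD('p::prime_type))"
  using prime_type by auto

typedef ('p::prime_type) padic_int =
  "{f :: nat \<Rightarrow> int. \<forall>n. f n = f (Suc n) mod int CARD('p) ^ n}"
  by (rule exI[of _ "\<lambda>_. 0"]) simp

setup_lifting type_definition_padic_int

lemma padic_seq_mod_self:
  assumes "\<forall>n. f n = f (Suc n) mod int CARD('p::prime_type) ^ n"
  shows "f n mod int CARD('p) ^ n = f n"
  using assms by (metis mod_mod_trivial)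

lemma mod_power_Suc_mod: "(a mod (q::int) ^ Suc n) mod q ^ n = a mod q ^ n"
  by (simp add: mod_mod_cancel)

instantiation padic_int :: (prime_type) comm_ring_1
begin

lift_definition zero_padic_int :: "'a padic_int" is "\<lambda>_. 0" by simp

lift_definition one_padic_int :: "'a padic_int" is "\<lambda>n. 1 mod int CARD('a) ^ n"
  unfolding mod_power_Suc_mod by simp

lift_definition plus_padic_int :: "'a padic_int \<Rightarrow> 'a padic_int \<Rightarrow> 'a padic_int"
  is "\<lambda>f g n. (f n + g n) mod int CARD('a) ^ n"
  unfolding mod_power_Suc_mod by (metis mod_add_eq)

lift_definition minus_padic_int :: "'a padic_int \<Rightarrow> 'a padic_int \<Rightarrow> 'a padic_int"
  is "\<lambda>f g n. (f n - g n) mod int CARD('a) ^ n"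
  unfolding mod_power_Suc_mod by (metis mod_diff_eq)

lift_definition uminus_padic_int :: "'a padic_int \<Rightarrow> 'a padic_int"
  is "\<lambda>f n. (- f n) mod int CARD('a) ^ n"
  unfolding mod_power_Suc_mod by (metis mod_minus_eq)

lift_definition times_padic_int :: "'a padic_int \<Rightarrow> 'a padic_int \<Rightarrow> 'a padic_int"
  is "\<lambda>f g n. (f n * g n) mod int CARD('a) ^ n"
  unfolding mod_power_Suc_mod by (metis mod_mult_eq)

lemmas padic_int_rep_eqs = zero_padic_int.rep_eq one_padic_int.rep_eq plus_padic_int.rep_eq
  minus_padic_int.rep_eq uminus_padic_int.rep_eq times_padic_int.rep_eq

lemma Rep_padic_int_mod: "Rep_padic_int a n mod int CARD('a) ^ n = Rep_padic_int (a :: 'a padic_int) n"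
  by (rule padic_seq_mod_self) (use Rep_padic_int[of a] in blast)

lemma padic_int_eqI:
  assumes "\<And>n. Rep_padic_int a n = Rep_padic_int (b :: 'a padic_int) n"
  shows "a = b"
  using assms by (simp add: Rep_padic_int_inject[symmetric] fun_eq_iff)

instance
proof
  fix a b c :: "'a padic_int"
  show "a + b + c = a + (b + c)"
    by (rule padic_int_eqI) (simp add: padic_int_rep_eqs mod_simps ac_simps)
  show "a + b = b + a"
    by (rule padic_int_eqI) (simp add: padic_int_rep_eqs ac_simps)
  show "0 + a = a"
    by (rule padic_int_eqI) (simp add: padic_int_rep_eqs Rep_padic_int_mod)
  show "- a + a = 0"
    by (rule padic_int_eqI) (simp add: padic_int_rep_eqs mod_simps)
  show "a - b = a + - b"
    by (rule padic_int_eqI) (simp add: padic_int_rep_eqs mod_simps)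
  show "a * b * c = a * (b * c)"
    by (rule padic_int_eqI) (simp add: padic_int_rep_eqs mod_simps ac_simps)
  show "a * b = b * a"
    by (rule padic_int_eqI) (simp add: padic_int_rep_eqs ac_simps)
  show "1 * a = a"
    by (rule padic_int_eqI) (simp add: padic_int_rep_eqs mod_simps Rep_padic_int_mod)
  show "(a + b) * c = a * c + b * c"
    by (rule padic_int_eqI) (simp add: padic_int_rep_eqs mod_simps algebra_simps)
  show "(0::'a padic_int) \<noteq> 1"
  proof
    assume "(0::'a padic_int) = 1"
    then have "Rep_padic_int (0::'a padic_int) 1 = Rep_padic_int (1::'a padic_int) 1" by simp
    then show False
      using prime_gt_1_int[OF prime_int_CARD[where 'p='a]] by (simp add: padic_int_rep_eqs)
  qed
qed

end

lemma padic_seq_mod: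
  assumes f: "\<forall>n. f n = f (Suc n) mod int CARD('p::prime_type) ^ n"
  shows "f (n + k) mod int CARD('p) ^ n = f n"
proof (induction k)
  case 0
  show ?case using padic_seq_mod_self[OF f] by simp
next
  case (Suc k)
  have "f (Suc (n + k)) mod int CARD('p) ^ n
      = f (Suc (n + k)) mod int CARD('p) ^ (n + k) mod int CARD('p) ^ n"
    by (rule mod_mod_cancel[symmetric]) (simp add: le_imp_power_dvd)
  also have "\<dots> = f (n + k) mod int CARD('p) ^ n"
    by (simp only: spec[OF f, of "n + k", symmetric])
  finally show ?case using Suc by (simp only: add_Suc_right)
qed

lemma Rep_padic_int_add_mod:
  "Rep_padic_int a (n + k) mod int CARD('p) ^ n = Rep_padic_int (a :: 'p::prime_type padic_int) n"
  by (rule padic_seq_mod) (use Rep_padic_int[of a] in blast)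

instance padic_int :: (prime_type) idom
proof
  fix a b :: "'a padic_int"
  let ?p = "int CARD('a)"
  assume "a \<noteq> 0" "b \<noteq> 0"
  then obtain m n where mn: "Rep_padic_int a m \<noteq> 0" "Rep_padic_int b n \<noteq> 0"
    by (metis padic_int_eqI zero_padic_int.rep_eq)
  have a: "\<not> ?p ^ m dvd Rep_padic_int a (m + n)"
    using mn Rep_padic_int_add_mod[of a m n] by (auto simp: dvd_eq_mod_eq_0)
  have b: "\<not> ?p ^ n dvd Rep_padic_int b (m + n)"
    using mn Rep_padic_int_add_mod[of b n m] by (auto simp: add.commute dvd_eq_mod_eq_0)
  show "a * b \<noteq> 0"
  proof
    assume "a * b = 0"
    then have "Rep_padic_int (a * b) (m + n) = 0" by (simp add: zero_padic_int.rep_eq)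
    then have "?p ^ (m + n) dvd Rep_padic_int a (m + n) * Rep_padic_int b (m + n)"
      by (simp add: times_padic_int.rep_eq dvd_eq_mod_eq_0)
    then obtain i j where "i + j = m + n"
        "?p ^ i dvd Rep_padic_int a (m + n)" "?p ^ j dvd Rep_padic_int b (m + n)"
      using prime_elem_power_dvd_prod prime_imp_prime_elem[OF prime_int_CARD] by blast
    moreover from this(1) have "m \<le> i \<or> n \<le> j" by linarith
    ultimately show False using a b by (auto dest: power_le_dvd)
  qed
qed

type_synonym 'p padic = "'p padic_int fract"

abbreviation unif :: "'p::prime_type padic"  \<comment> \<open>\<open>p\<close> as an element of \<open>Q_p\<close>\<close>
  where "unif \<equiv> of_nat CARD('p)"

definition Zp :: "'p::prime_type padic set"
  where "Zp = range (\<lambda>a. Fract a 1)"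

definition Zp_units :: "'p::prime_type padic set"
  where "Zp_units = {u \<in> Zp. u \<noteq> 0 \<and> inverse u \<in> Zp}"

definition pZp :: "int \<Rightarrow> 'p::prime_type padic set"  \<comment> \<open>\<open>p^r Z_p\<close>\<close>
  where "pZp r = (\<lambda>z. unif powi r * z) ` Zp"

definition ord_p :: "'p::prime_type padic \<Rightarrow> int"
  where "ord_p x = (THE k. \<exists>u\<in>Zp_units. x = unif powi k * u)"

definition hilbert :: "'p::prime_type padic \<Rightarrow> 'p padic \<Rightarrow> int"
  where "hilbert a b =
    (if \<exists>x y z. (x, y, z) \<noteq> (0, 0, 0) \<and> a * x\<^sup>2 + b * y\<^sup>2 = z\<^sup>2 then 1 else - 1)"

definition residue_p :: "'p::prime_type padic \<Rightarrow> int"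
  where "residue_p u = (THE a. 0 \<le> a \<and> a < int CARD('p) \<and> u - of_int a \<in> pZp 1)"

definition legendre_p :: "'p::prime_type padic \<Rightarrow> int"
  where "legendre_p u = Legendre (residue_p u) (int CARD('p))"


section \<open>Complex vector spaces\<close>

class complex_vector = ab_group_add +
  fixes scaleC :: "complex \<Rightarrow> 'a \<Rightarrow> 'a"  (infixr \<open>*\<^sub>C\<close> 75)
  assumes scaleC_add_right: "a *\<^sub>C (x + y) = a *\<^sub>C x + a *\<^sub>C y"
    and scaleC_add_left: "(a + b) *\<^sub>C x = a *\<^sub>C x + b *\<^sub>C x"
    and scaleC_scaleC: "a *\<^sub>C b *\<^sub>C x = (a * b) *\<^sub>C x"
    and scaleC_one: "1 *\<^sub>C x = x"

global_interpretation complex_vector: vector_space "scaleC :: complex \<Rightarrow> 'a \<Rightarrow> 'a::complex_vector"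
  by unfold_locales (rule scaleC_add_right scaleC_add_left scaleC_scaleC scaleC_one)+

instantiation complex :: complex_vector
begin
definition "scaleC_complex = ((*) :: complex \<Rightarrow> complex \<Rightarrow> complex)"
instance by standard (simp_all add: scaleC_complex_def algebra_simps)
end

instantiation "fun" :: (type, complex_vector) complex_vector
begin
definition "scaleC_fun c f = (\<lambda>x. c *\<^sub>C f x)"
instance
  by standard (simp_all add: scaleC_fun_def fun_eq_iff scaleC_add_right scaleC_add_left
      scaleC_scaleC scaleC_one)
end


section \<open>Representations\<close>

text \<open>A representation of a group \<open>G\<close> is a linear subspace \<open>V\<close> of an ambient complex vector space
  together with \<open>\<rho> :: 'g \<Rightarrow> 'v \<Rightarrow> 'v\<close>, of which only the values \<open>\<rho> g v\<close> with \<open>g \<in> carrier G\<close> and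
  \<open>v \<in> V\<close> are relevant.\<close>

definition clinear_on ::
    "'v::complex_vector set \<Rightarrow> 'w::complex_vector set \<Rightarrow> ('v \<Rightarrow> 'w) \<Rightarrow> bool"
  where "clinear_on V W T \<longleftrightarrow>
    (\<forall>v\<in>V. T v \<in> W) \<and> (\<forall>u\<in>V. \<forall>v\<in>V. T (u + v) = T u + T v) \<and>
    (\<forall>c. \<forall>v\<in>V. T (c *\<^sub>C v) = c *\<^sub>C T v)"

definition representation ::
    "('g, 'b) monoid_scheme \<Rightarrow> 'v::complex_vector set \<Rightarrow> ('g \<Rightarrow> 'v \<Rightarrow> 'v) \<Rightarrow> bool"
  where "representation G V \<rho> \<longleftrightarrow>
    complex_vector.subspace V \<and> (\<forall>g\<in>carrier G. clinear_on V V (\<rho> g)) \<and>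
    (\<forall>v\<in>V. \<rho> \<one>\<^bsub>G\<^esub> v = v) \<and>
    (\<forall>g\<in>carrier G. \<forall>h\<in>carrier G. \<forall>v\<in>V. \<rho> (g \<otimes>\<^bsub>G\<^esub> h) v = \<rho> g (\<rho> h v))"

definition stable_subspace ::
    "('g, 'b) monoid_scheme \<Rightarrow> ('g \<Rightarrow> 'v::complex_vector \<Rightarrow> 'v) \<Rightarrow> 'v set \<Rightarrow> bool"
  where "stable_subspace G \<rho> U \<longleftrightarrow>
    complex_vector.subspace U \<and> (\<forall>g\<in>carrier G. \<forall>v\<in>U. \<rho> g v \<in> U)"

definition irreducible_rep ::
    "('g, 'b) monoid_scheme \<Rightarrow> 'v::complex_vector set \<Rightarrow> ('g \<Rightarrow> 'v \<Rightarrow> 'v) \<Rightarrow> bool"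
  where "irreducible_rep G V \<rho> \<longleftrightarrow>
    representation G V \<rho> \<and> V \<noteq> {0} \<and>
    (\<forall>U\<subseteq>V. stable_subspace G \<rho> U \<longrightarrow> U = {0} \<or> U = V)"

definition Hom_rep ::
    "'g set \<Rightarrow> 'v::complex_vector set \<Rightarrow> ('g \<Rightarrow> 'v \<Rightarrow> 'v) \<Rightarrow>
     'w::complex_vector set \<Rightarrow> ('g \<Rightarrow> 'w \<Rightarrow> 'w) \<Rightarrow> ('v \<Rightarrow> 'w) set"
  where "Hom_rep H V \<rho> W \<sigma> =
    {T. clinear_on V W T \<and> (\<forall>h\<in>H. \<forall>v\<in>V. T (\<rho> h v) = \<sigma> h (T v))}"

text \<open>\<open>Hom_H(\<rho>,1) = 0\<close> and \<open>Hom_H(1,\<rho>) = 0\<close>, with \<open>1\<close> the trivial representation on \<open>\<complex>\<close>.\<close>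

definition Hom_to_triv_zero ::
    "'g set \<Rightarrow> 'v::complex_vector set \<Rightarrow> ('g \<Rightarrow> 'v \<Rightarrow> 'v) \<Rightarrow> bool"
  where "Hom_to_triv_zero H V \<rho> \<longleftrightarrow>
    (\<forall>T \<in> Hom_rep H V \<rho> (UNIV::complex set) (\<lambda>_ z. z). \<forall>v\<in>V. T v = 0)"

definition Hom_from_triv_zero ::
    "'g set \<Rightarrow> 'v::complex_vector set \<Rightarrow> ('g \<Rightarrow> 'v \<Rightarrow> 'v) \<Rightarrow> bool"
  where "Hom_from_triv_zero H V \<rho> \<longleftrightarrow>
    (\<forall>T \<in> Hom_rep H (UNIV::complex set) (\<lambda>_ z. z) V \<rho>. \<forall>z. T z = 0)"

definition acts_trivially :: "'g set \<Rightarrow> 'v set \<Rightarrow> ('g \<Rightarrow> 'v \<Rightarrow> 'v) \<Rightarrow> bool"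
  where "acts_trivially H V \<rho> \<longleftrightarrow> (\<forall>h\<in>H. \<forall>v\<in>V. \<rho> h v = v)"

text \<open>\<open>(W,\<sigma>)\<close> is irreducible and isomorphic to a subquotient of \<open>(V,\<rho>)\<close>: the image of a stable
  subspace \<open>U\<close> under a surjective intertwiner.\<close>

definition irreducible_constituent ::
    "('g, 'b) monoid_scheme \<Rightarrow> 'v::complex_vector set \<Rightarrow> ('g \<Rightarrow> 'v \<Rightarrow> 'v) \<Rightarrow>
     'w::complex_vector set \<Rightarrow> ('g \<Rightarrow> 'w \<Rightarrow> 'w) \<Rightarrow> bool"
  where "irreducible_constituent G V \<rho> W \<sigma> \<longleftrightarrow>
    irreducible_rep G W \<sigma> \<and>
    (\<exists>U\<subseteq>V. stable_subspace G \<rho> U \<and> (\<exists>T \<in> Hom_rep (carrier G) U \<rho> W \<sigma>. T ` U = W))"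

text \<open>Induction from a subgroup \<open>H\<close> of \<open>G\<close>; functions are extended by \<open>0\<close> outside \<open>carrier G\<close>,
  and \<open>G\<close> acts by right translation. When \<open>H\<close> has finite index no further condition is needed;
  in compact induction from an open subgroup \<open>H\<close> the support has to be compact modulo \<open>H\<close>,
  i.e. contained in finitely many cosets \<open>H s\<close>; smoothness under right translation is then a
  consequence of the smoothness of \<open>\<sigma>\<close>.\<close>

definition Ind ::
    "('g, 'b) monoid_scheme \<Rightarrow> 'g set \<Rightarrow> 'v::complex_vector set \<Rightarrow> ('g \<Rightarrow> 'v \<Rightarrow> 'v) \<Rightarrow> ('g \<Rightarrow> 'v) set"
  where "Ind G H V \<sigma> =
    {f. (\<forall>x\<in>carrier G. f x \<in> V) \<and> (\<forall>x. x \<notin> carrier G \<longrightarrow> f x = 0) \<and>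
        (\<forall>h\<in>H. \<forall>x\<in>carrier G. f (h \<otimes>\<^bsub>G\<^esub> x) = \<sigma> h (f x))}"

definition c_Ind ::
    "('g, 'b) monoid_scheme \<Rightarrow> 'g set \<Rightarrow> 'v::complex_vector set \<Rightarrow> ('g \<Rightarrow> 'v \<Rightarrow> 'v) \<Rightarrow> ('g \<Rightarrow> 'v) set"
  where "c_Ind G H V \<sigma> =
    {f \<in> Ind G H V \<sigma>. \<exists>S. finite S \<and> S \<subseteq> carrier G \<and> {x. f x \<noteq> 0} \<subseteq> H <#>\<^bsub>G\<^esub> S}"

definition right_transl ::
    "('g, 'b) monoid_scheme \<Rightarrow> 'g \<Rightarrow> ('g \<Rightarrow> 'v::complex_vector) \<Rightarrow> 'g \<Rightarrow> 'v"
  where "right_transl G g f = (\<lambda>x. if x \<in> carrier G then f (x \<otimes>\<^bsub>G\<^esub> g) else 0)"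


section \<open>Matrix groups\<close>

type_synonym 'p mat2 = "'p padic ^ 2 ^ 2"

definition mat2 :: "'a::zero \<Rightarrow> 'a \<Rightarrow> 'a \<Rightarrow> 'a \<Rightarrow> 'a ^ 2 ^ 2"
  where "mat2 a b c d = vector [vector [a, b], vector [c, d]]"

definition GL2 :: "('p::prime_type) mat2 monoid"
  where "GL2 = \<lparr>carrier = {g. det g \<noteq> 0}, mult = (**), one = mat 1\<rparr>"

abbreviation GLsub :: "('p::prime_type) mat2 set \<Rightarrow> 'p mat2 monoid"
  where "GLsub H \<equiv> GL2\<lparr>carrier := H\<rparr>"

definition SL2 :: "('p::prime_type) mat2 set"
  where "SL2 = {g. det g = 1}"

definition xm :: "'p::prime_type padic \<Rightarrow> 'p mat2" where "xm s = mat2 1 s 0 1"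
definition ym :: "'p::prime_type padic \<Rightarrow> 'p mat2" where "ym s = mat2 1 0 s 1"
definition hm :: "'p::prime_type padic \<Rightarrow> 'p mat2" where "hm t = mat2 t 0 0 (inverse t)"
definition wm :: "'p::prime_type padic \<Rightarrow> 'p mat2" where "wm t = mat2 0 t (- inverse t) 0"
definition alpha :: "('p::prime_type) mat2" where "alpha = mat2 unif 0 0 1"

definition K_GL :: "('p::prime_type) mat2 set"
  where "K_GL = {g. (\<forall>i j. g $ i $ j \<in> Zp) \<and> det g \<in> Zp_units}"

definition I_GL :: "('p::prime_type) mat2 set"
  where "I_GL = {g \<in> K_GL. g $ 2 $ 1 \<in> pZp 1}"

definition Z_GL :: "('p::prime_type) mat2 set"
  where "Z_GL = {z \<in> carrier GL2. \<forall>g\<in>carrier GL2. z ** g = g ** z}"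

definition Z'_GL :: "('p::prime_type) mat2 set"
  where "Z'_GL = generate GL2 {mat2 0 1 unif 0}"

definition Iw :: "('p::prime_type) mat2 set"
  where "Iw = I_GL \<inter> SL2"

definition K0 :: "('p::prime_type) mat2 set"
  where "K0 = {g \<in> SL2. \<forall>i j. g $ i $ j \<in> Zp}"

definition K1 :: "('p::prime_type) mat2 set"
  where "K1 = (\<lambda>k. matrix_inv alpha ** k ** alpha) ` K0"

definition Kd :: "nat \<Rightarrow> ('p::prime_type) mat2 set"  \<comment> \<open>\<open>K^\<delta>\<close>, used for \<open>\<delta> = 0, 1\<close>\<close>
  where "Kd \<delta> = (if \<delta> = 0 then K0 else K1)"

definition Kr :: "nat \<Rightarrow> ('p::prime_type) mat2 set"
  where "Kr r = {k \<in> K0. k $ 2 $ 1 \<in> pZp (int r)}"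

definition N_grp :: "int \<Rightarrow> ('p::prime_type) mat2 set"
  where "N_grp r = xm ` pZp r"

definition Nbar_grp :: "int \<Rightarrow> ('p::prime_type) mat2 set"
  where "Nbar_grp r = ym ` pZp r"

definition J_grp :: "nat \<Rightarrow> nat \<Rightarrow> ('p::prime_type) mat2 set"
  where "J_grp \<delta> l = {g \<in> Kd \<delta>.
    g $ 1 $ 1 - 1 \<in> pZp (int l) \<and> g $ 2 $ 2 - 1 \<in> pZp (int l) \<and>
    g $ 1 $ 2 \<in> pZp (int l - int \<delta>) \<and> g $ 2 $ 1 \<in> pZp (int l + int \<delta>)}"

definition principal_congruence :: "nat \<Rightarrow> ('p::prime_type) mat2 set"  \<comment> \<open>\<open>1 + p^l M_2(Z_p)\<close>\<close>
  where "principal_congruence l = {g. \<forall>i j. (g - mat 1) $ i $ j \<in> pZp (int l)}"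

definition iwahori_congruence :: "nat \<Rightarrow> ('p::prime_type) mat2 set"
  where "iwahori_congruence l = {g \<in> I_GL.
    g $ 1 $ 1 - 1 \<in> pZp (int l) \<and> g $ 2 $ 2 - 1 \<in> pZp (int l) \<and>
    g $ 1 $ 2 \<in> pZp (int l) \<and> g $ 2 $ 1 \<in> pZp (int l + 1)}"


section \<open>The two-fold cover of \<open>SL_2(Q_p)\<close>\<close>

definition tau_entry :: "('p::prime_type) mat2 \<Rightarrow> 'p padic"
  where "tau_entry g = (if g $ 2 $ 1 \<noteq> 0 then g $ 2 $ 1 else g $ 2 $ 2)"

definition s_p :: "('p::prime_type) mat2 \<Rightarrow> int"
  where "s_p g = (if g $ 2 $ 1 * g $ 2 $ 2 \<noteq> 0 \<and> odd (ord_p (g $ 2 $ 1))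
                  then hilbert (g $ 2 $ 1) (g $ 2 $ 2) else 1)"

definition cocycle :: "('p::prime_type) mat2 \<Rightarrow> 'p mat2 \<Rightarrow> int"
  where "cocycle g h =
    hilbert (tau_entry (g ** h) * tau_entry g) (tau_entry (g ** h) * tau_entry h)
      * s_p g * s_p h * s_p (g ** h)"

definition cover :: "(('p::prime_type) mat2 \<times> int) monoid"
  where "cover = \<lparr>carrier = SL2 \<times> {1, - 1},
    mult = (\<lambda>(g, \<epsilon>1) (h, \<epsilon>2). (g ** h, \<epsilon>1 * \<epsilon>2 * cocycle g h)), one = (mat 1, 1)\<rparr>"

definition full_preimage :: "('p::prime_type) mat2 set \<Rightarrow> ('p mat2 \<times> int) set"
  where "full_preimage H = H \<times> {1, - 1}"

text \<open>\<open>s\<close> is the splitting \<open>s^\<delta>\<close>; only its restriction to \<open>K^\<delta>\<close> is relevant, and this restriction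
  is determined by the condition.\<close>

definition is_splitting :: "nat \<Rightarrow> (('p::prime_type) mat2 \<Rightarrow> int) \<Rightarrow> bool"
  where "is_splitting \<delta> s \<longleftrightarrow>
    (\<lambda>k. (k, s k)) \<in> hom (GLsub (Kd \<delta>)) cover \<and>
    (if \<delta> = 0
     then (\<forall>z\<in>Zp. s (xm z) = 1 \<and> s (ym z) = 1) \<and> (\<forall>u\<in>Zp_units. s (hm u) = 1) \<and> s (wm 1) = 1
     else (\<forall>z\<in>pZp (- 1). s (xm z) = 1) \<and> (\<forall>z\<in>pZp 1. s (ym z) = 1) \<and>
          s (wm (inverse unif)) = 1 \<and> (\<forall>u\<in>Zp_units. s (hm u) = legendre_p u))"

definition genuine_lift ::
    "(('p::prime_type) mat2 \<Rightarrow> int) \<Rightarrow> ('p mat2 \<Rightarrow> 'v::complex_vector \<Rightarrow> 'v) \<Rightarrow> 'p mat2 \<times> int \<Rightarrow> 'v \<Rightarrow> 'v"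
  where "genuine_lift s \<rho> = (\<lambda>(k, \<epsilon>) v. of_int (\<epsilon> * s k) *\<^sub>C \<rho> k v)"


section \<open>Conductor, strong cuspidality, defect, and very cuspidal data\<close>

definition rep_conductor ::
    "nat \<Rightarrow> 'v::complex_vector set \<Rightarrow> (('p::prime_type) mat2 \<Rightarrow> 'v \<Rightarrow> 'v) \<Rightarrow> nat"
  where "rep_conductor \<delta> V \<sigma> = (LEAST r. acts_trivially (J_grp \<delta> r) V \<sigma>)"

definition strongly_cuspidal ::
    "nat \<Rightarrow> 'v::complex_vector set \<Rightarrow> (('p::prime_type) mat2 \<Rightarrow> 'v \<Rightarrow> 'v) \<Rightarrow> bool"
  where "strongly_cuspidal \<delta> V \<sigma> \<longleftrightarrow>
    representation (GLsub (Kd \<delta>)) V \<sigma> \<and> (\<exists>r. acts_trivially (J_grp \<delta> r) V \<sigma>) \<and>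
    Hom_to_triv_zero (N_grp (int (rep_conductor \<delta> V \<sigma>) - 2 * int \<delta> - 1) \<inter> Kd \<delta>) V \<sigma>"

definition defect ::
    "nat \<Rightarrow> 'v::complex_vector set \<Rightarrow> (('p::prime_type) mat2 \<Rightarrow> 'v \<Rightarrow> 'v) \<Rightarrow> nat"
  where "defect \<delta> V \<sigma> =
    (if \<not> Hom_to_triv_zero (N_grp (int (rep_conductor \<delta> V \<sigma>) - int \<delta> - 1) \<inter> Kd \<delta>) V \<sigma>
     then 1 else 0)"

text \<open>The groups \<open>1 + p^r M_2(Z_p)\<close>, \<open>r \<ge> 1\<close>, form a basis of neighbourhoods of \<open>1\<close> in \<open>GL_2(Q_p)\<close>.\<close>

definition smooth_rep ::
    "('p::prime_type) mat2 set \<Rightarrow> 'v set \<Rightarrow> ('p mat2 \<Rightarrow> 'v \<Rightarrow> 'v) \<Rightarrow> bool"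
  where "smooth_rep H V \<rho> \<longleftrightarrow>
    (\<forall>v\<in>V. \<exists>r\<ge>1. \<forall>k\<in>principal_congruence r \<inter> H. \<rho> k v = v)"

definition unramified_datum ::
    "nat \<Rightarrow> 'v::complex_vector set \<Rightarrow> (('p::prime_type) mat2 \<Rightarrow> 'v \<Rightarrow> 'v) \<Rightarrow> bool"
  where "unramified_datum l V \<tau> \<longleftrightarrow> l \<ge> 1 \<and>
    irreducible_rep (GLsub (Z_GL <#>\<^bsub>GL2\<^esub> K_GL)) V \<tau> \<and> smooth_rep (Z_GL <#>\<^bsub>GL2\<^esub> K_GL) V \<tau> \<and>
    acts_trivially (principal_congruence l) V \<tau> \<and>
    Hom_from_triv_zero (N_grp (int l - 1)) V \<tau>"

definition ramified_datum ::
    "nat \<Rightarrow> 'v::complex_vector set \<Rightarrow> (('p::prime_type) mat2 \<Rightarrow> 'v \<Rightarrow> 'v) \<Rightarrow> bool"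
  where "ramified_datum l V \<tau> \<longleftrightarrow> l \<ge> 1 \<and>
    irreducible_rep (GLsub (Z'_GL <#>\<^bsub>GL2\<^esub> I_GL)) V \<tau> \<and> smooth_rep (Z'_GL <#>\<^bsub>GL2\<^esub> I_GL) V \<tau> \<and>
    acts_trivially (iwahori_congruence l) V \<tau> \<and>
    Hom_from_triv_zero (N_grp (int l - 1)) V \<tau>"


section \<open>Weights, test vectors and newvectors\<close>

definition weight_space ::
    "'v::complex_vector set \<Rightarrow> (('p::prime_type) mat2 \<Rightarrow> 'v \<Rightarrow> 'v) \<Rightarrow> ('p padic \<Rightarrow> complex) \<Rightarrow> 'v set"
  where "weight_space W \<rho> \<mu> = {w \<in> W. \<forall>u\<in>Zp_units. \<rho> (hm u) w = \<mu> u *\<^sub>C w}"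

definition centrally_compatible ::
    "'v::complex_vector set \<Rightarrow> (('p::prime_type) mat2 \<Rightarrow> 'v \<Rightarrow> 'v) \<Rightarrow> ('p padic \<Rightarrow> complex) \<Rightarrow> bool"
  where "centrally_compatible W \<rho> \<mu> \<longleftrightarrow> (\<forall>w\<in>W. \<rho> (- mat 1) w = \<mu> (- 1) *\<^sub>C w)"

definition twist_legendre :: "('p::prime_type padic \<Rightarrow> complex) \<Rightarrow> 'p padic \<Rightarrow> complex"
  where "twist_legendre \<eta> = (\<lambda>u. \<eta> u * of_int (legendre_p u))"

definition conj_alpha :: "(('p::prime_type) mat2 \<Rightarrow> 'v \<Rightarrow> 'v) \<Rightarrow> 'p mat2 \<Rightarrow> 'v \<Rightarrow> 'v"  \<comment> \<open>\<open>\<rho>^\<alpha>\<close>\<close>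
  where "conj_alpha \<rho> = (\<lambda>k. \<rho> (alpha ** k ** matrix_inv alpha))"

definition phi_vec ::
    "(('p::prime_type) mat2 \<Rightarrow> 'v::complex_vector \<Rightarrow> 'v) \<Rightarrow> 'v \<Rightarrow> 'p mat2 \<Rightarrow> 'v"
  where "phi_vec \<sigma> w = (\<lambda>k. if k \<in> Iw then \<sigma> k w else 0)"

definition f_vec ::
    "nat \<Rightarrow> ('p::prime_type) mat2 set \<Rightarrow> ('p mat2 \<times> int \<Rightarrow> 'v::complex_vector \<Rightarrow> 'v) \<Rightarrow> 'v \<Rightarrow>
     'p mat2 \<times> int \<Rightarrow> 'v"
  where "f_vec m K \<rho>t v = (\<lambda>(g, \<epsilon>).
    let h = hm (unif ^ m); k = g ** matrix_inv h in
    if k \<in> K \<and> \<epsilon> \<in> {1, - 1} then of_int (cocycle k h * \<epsilon>) *\<^sub>C \<rho>t (k, 1) v else 0)"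

definition char_conductor :: "('p::prime_type padic \<Rightarrow> complex) \<Rightarrow> nat"
  where "char_conductor \<eta> = (LEAST r. \<forall>u\<in>Zp_units. u - 1 \<in> pZp (int r) \<longrightarrow> \<eta> u = 1)"

definition eta_cover :: "('p::prime_type padic \<Rightarrow> complex) \<Rightarrow> 'p mat2 \<times> int \<Rightarrow> complex"
  where "eta_cover \<eta> = (\<lambda>(k, \<epsilon>). of_int \<epsilon> * \<eta> (k $ 2 $ 2))"

text \<open>For a space \<open>\<pi>\<close> of functions on the cover (acted on by right translation),
  \<open>eta_space \<pi> \<eta> r\<close> is the space of \<open>(K_r,\<eta>)\<close>-equivariant vectors.\<close>

definition eta_space ::
    "(('p::prime_type) mat2 \<times> int \<Rightarrow> 'v::complex_vector) set \<Rightarrow> ('p padic \<Rightarrow> complex) \<Rightarrow> nat \<Rightarrow>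
     ('p mat2 \<times> int \<Rightarrow> 'v) set"
  where "eta_space \<pi> \<eta> r =
    {f \<in> \<pi>. \<forall>k\<in>full_preimage (Kr r). right_transl cover k f = eta_cover \<eta> k *\<^sub>C f}"

definition eta_admissible ::
    "(('p::prime_type) mat2 \<times> int \<Rightarrow> 'v::complex_vector) set \<Rightarrow> ('p padic \<Rightarrow> complex) \<Rightarrow> nat \<Rightarrow> bool"
  where "eta_admissible \<pi> \<eta> r \<longleftrightarrow> r \<ge> char_conductor \<eta> \<and> (\<exists>f\<in>eta_space \<pi> \<eta> r. f \<noteq> 0)"

definition eta_conductor ::
    "(('p::prime_type) mat2 \<times> int \<Rightarrow> 'v::complex_vector) set \<Rightarrow> ('p padic \<Rightarrow> complex) \<Rightarrow> nat"
  where "eta_conductor \<pi> \<eta> = (LEAST r. eta_admissible \<pi> \<eta> r)"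

text \<open>The conductor equals \<open>n\<close>, including that admissible levels exist.\<close>

definition has_eta_conductor ::
    "(('p::prime_type) mat2 \<times> int \<Rightarrow> 'v::complex_vector) set \<Rightarrow> ('p padic \<Rightarrow> complex) \<Rightarrow> nat \<Rightarrow> bool"
  where "has_eta_conductor \<pi> \<eta> n \<longleftrightarrow> (\<exists>r. eta_admissible \<pi> \<eta> r) \<and> eta_conductor \<pi> \<eta> = n"

definition is_newvector ::
    "(('p::prime_type) mat2 \<times> int \<Rightarrow> 'v::complex_vector) set \<Rightarrow> ('p padic \<Rightarrow> complex) \<Rightarrow>
     ('p mat2 \<times> int \<Rightarrow> 'v) \<Rightarrow> bool"
  where "is_newvector \<pi> \<eta> f \<longleftrightarrow> f \<noteq> 0 \<and> f \<in> eta_space \<pi> \<eta> (eta_conductor \<pi> \<eta>)"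

end

theory Submission
  imports Defs "HOL-Number_Theory.Euler_Criterion"
begin

text \<open>Writing \<open>k'' = h k h\<inverse>\<close> for \<open>h = h(p^m)\<close> and \<open>k \<in> K_r\<close>, equivariance of \<open>f_v\<close> amounts to
  \<open>s(k'') \<rho>(k'') v = \<eta>(d) v\<close>; here only instances of the cocycle identity containing a torus element are
  needed, and \<open>k''\<close> lies in the Iwahori subgroup, where \<open>s\<^sup>0 = 1\<close> and \<open>s\<^sup>1(k) = (d/p)\<close>.

  For the lower bound on the conductor, every element of \<open>G\<close> is in \<open>K h(p^n) y(z)\<close> for some \<open>n\<close> and \<open>z\<close>.
  The value of an equivariant function at \<open>h(p^n) y(z)\<close> is fixed by large unipotent subgroups of \<open>K\<close>,
  and very cuspidality rules out such vectors. The level is attained because a nonzero weight vector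
  is obtained by projecting an eigenvector of \<open>x(1)\<close>.

  In the ramified cases, averaging over a unipotent subgroup projects the induced representation
  onto the functions supported on \<open>I\<close>, which gives irreducibility and the statements about fixed
  vectors.\<close>

section \<open>Arithmetic of the p-adic numbers\<close>

text \<open>The m of each case is a balance. Conjugation by h(p^m) leaves upper entries in p^(2m)
  and lower entries in p^(r-2m), and both must reach the congruence level at which the vector is
  fixed. For l even 2m = l does this directly; for l odd 2m = l - 1 misses by one on the upper side,
  which conjugation by \<alpha> repairs by moving one power of p up from below. What is left is a
  character of d, and the sign (d/p) of s^1 explains the twist in \<eta>_l. One level lower, the
  value at h(p^n) is fixed by the elements of N_(2n) and Nbar_(r-2n) in K. As n varies one exponent
  rises while the other falls, and r is just small enough that no n escapes both thresholds. In the
  ramified case with l odd one n does, and there the two groups must be used together. Very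
  cuspidality concerns fixed vectors of the datum, strong cuspidality concerns invariant
  functionals, and a constituent is only a subquotient, with no bound on dimensions. Finite sums
  over p^e modulo p^(e+k) connect the three.\<close>

lemma p_gt_1: "1 < int CARD('p::prime_type)"
  using prime_gt_1_int[OF prime_int_CARD] .

lemma p_pos [simp]: "0 < CARD('p::prime_type)"
  using p_gt_1[where 'p='p] by linarith

section \<open>Residues, units and square roots in Z_p\<close>

lemma Rep_of_nat: "Rep_padic_int (of_nat m :: 'p::prime_type padic_int) n = int m mod int CARD('p) ^ n"
  by (induction m) (auto simp: zero_padic_int.rep_eq plus_padic_int.rep_eq one_padic_int.rep_eq mod_simps)

lemma Rep_of_int: "Rep_padic_int (of_int m :: 'p::prime_type padic_int) n = m mod int CARD('p) ^ n"
proof (cases m)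
  case (nonneg k)
  then show ?thesis by (simp add: Rep_of_nat)
next
  case (neg k)
  show ?thesis unfolding neg of_int_minus of_int_of_nat_eq
    by (simp add: uminus_padic_int.rep_eq Rep_of_nat mod_simps del: of_nat_Suc)
qed

lemma Rep_power: "Rep_padic_int (a ^ k :: 'p::prime_type padic_int) n = Rep_padic_int a n ^ k mod int CARD('p) ^ n"
  by (induction k) (auto simp: one_padic_int.rep_eq times_padic_int.rep_eq mod_simps)

lemma Rep_0 [simp]: "Rep_padic_int (a :: 'p::prime_type padic_int) 0 = 0"
  using Rep_padic_int_mod[of a 0] by simp

text \<open>Completeness of Z_p in the form used below: integers that are merely congruent modulo
  growing powers of p define an element, without being canonical residues.\<close>

lemma padic_limit:
  assumes "\<And>n. x (Suc n) mod int CARD('p::prime_type) ^ n = x n mod int CARD('p) ^ n"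
  obtains a :: "'p::prime_type padic_int" where "\<And>n. Rep_padic_int a n = x n mod int CARD('p) ^ n"
proof
  show "Rep_padic_int (Abs_padic_int (\<lambda>n. x n mod int CARD('p) ^ n) :: 'p padic_int) n = x n mod int CARD('p) ^ n" for n
    using assms by (subst Abs_padic_int_inverse) (auto simp: mod_power_Suc_mod simp del: power_Suc)
qed

lemma padic_int_expand:
  "\<exists>b. a = of_int (Rep_padic_int a n) + of_nat CARD('p) ^ n * (b :: 'p::prime_type padic_int)"
proof -
  let ?p = "int CARD('p)"
  \<comment> \<open>The k-th residue of the quotient (a - a_n) / p^n, read off from the residue of a
    at level n + k.\<close>
  define x where "x k = (Rep_padic_int a (n + k) - Rep_padic_int a n) div ?p ^ n" for k
  have x: "Rep_padic_int a (n + k) = Rep_padic_int a n + ?p ^ n * x k" for k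
  proof -
    have "?p ^ n dvd Rep_padic_int a (n + k) - Rep_padic_int a n"
      using Rep_padic_int_add_mod[of a n k] Rep_padic_int_mod[of a n]
      by (metis mod_eq_dvd_iff)
    then show ?thesis by (simp add: x_def)
  qed
  have "x (Suc k) mod ?p ^ k = x k mod ?p ^ k" for k
  proof -
    have "?p ^ (n + k) dvd Rep_padic_int a (n + Suc k) - Rep_padic_int a (n + k)"
      using Rep_padic_int_add_mod[of a "n + k" 1] Rep_padic_int_mod[of a "n + k"]
      by (metis mod_eq_dvd_iff add_Suc_right Suc_eq_plus1)
    then have "?p ^ n * ?p ^ k dvd ?p ^ n * (x (Suc k) - x k)"
      unfolding x by (simp add: power_add right_diff_distrib)
    then have "?p ^ k dvd x (Suc k) - x k"
      using p_gt_1[where 'p='p] by (subst (asm) dvd_mult_cancel_left) auto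
    then show ?thesis by (simp add: mod_eq_dvd_iff)
  qed
  then obtain b :: "'p padic_int" where b: "\<And>k. Rep_padic_int b k = x k mod ?p ^ k"
    using padic_limit by blast
  have "a = of_int (Rep_padic_int a n) + of_nat CARD('p) ^ n * b"
  proof (rule padic_int_eqI)
    fix k
    have 1: "Rep_padic_int (of_nat CARD('p) ^ n :: 'p padic_int) k = ?p ^ n mod ?p ^ k"
      by (simp add: Rep_power Rep_of_nat power_mod)
    have "Rep_padic_int (of_int (Rep_padic_int a n) + of_nat CARD('p) ^ n * b) k
      = (Rep_padic_int a n + ?p ^ n * x k) mod ?p ^ k"
      unfolding plus_padic_int.rep_eq times_padic_int.rep_eq Rep_of_int 1 b by (metis mod_add_eq mod_mult_eq)
    also have "\<dots> = Rep_padic_int a k"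
      using Rep_padic_int_add_mod[of a k n] by (simp add: x[symmetric] add.commute)
    finally show "Rep_padic_int a k = Rep_padic_int (of_int (Rep_padic_int a n) + of_nat CARD('p) ^ n * b) k" ..
  qed
  then show ?thesis ..
qed

lemma Rep_coprime:
  assumes "Rep_padic_int (a :: 'p::prime_type padic_int) 1 \<noteq> 0" "n > 0"
  shows "coprime (Rep_padic_int a n) (int CARD('p) ^ k)"
proof -
  have "Rep_padic_int a n mod int CARD('p) = Rep_padic_int a 1"
    using Rep_padic_int_add_mod[of a 1 "n - 1"] assms(2) by simp
  then have "\<not> int CARD('p) dvd Rep_padic_int a n" using assms(1) by auto
  then show ?thesis
    using prime_imp_coprime[OF prime_int_CARD[where 'p='p]] coprime_commute
    by (metis coprime_power_right_iff)
qed

text \<open>Inverses modulo p^n exist for every n and are unique there, hence compatible, hence they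
  have a limit.\<close>

lemma padic_int_unit:
  assumes "Rep_padic_int (a :: 'p::prime_type padic_int) 1 \<noteq> 0"
  shows "\<exists>b. a * b = 1"
proof -
  let ?p = "int CARD('p)"
  have "\<exists>x. [Rep_padic_int a n * x = 1] (mod ?p ^ n)" for n
  proof (cases "n = 0")
    case False
    then show ?thesis using cong_solve_coprime_int[OF Rep_coprime[OF assms, of n n]] by simp
  qed (simp add: cong_def)
  then obtain x where x: "\<And>n. [Rep_padic_int a n * x n = 1] (mod ?p ^ n)" by metis
  have "x (Suc n) mod ?p ^ n = x n mod ?p ^ n" for n
  proof (cases "n = 0")
    case False
    have "[Rep_padic_int a (Suc n) * x (Suc n) = 1] (mod ?p ^ n)"
      using x[of "Suc n"] by (rule cong_dvd_modulus) (simp add: le_imp_power_dvd)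
    moreover have "[Rep_padic_int a (Suc n) = Rep_padic_int a n] (mod ?p ^ n)"
      using Rep_padic_int_add_mod[of a n 1] Rep_padic_int_mod[of a n] by (simp add: cong_def)
    ultimately have "[Rep_padic_int a n * x (Suc n) = Rep_padic_int a n * x n] (mod ?p ^ n)"
      using x[of n] by (meson cong_scalar_right cong_sym cong_trans)
    then show ?thesis
      using Rep_coprime[OF assms, of n n] False by (simp add: cong_def cong_mult_lcancel)
        (metis Rep_coprime[OF assms] bot_nat_0.not_eq_extremum cong_def cong_mult_lcancel)
  qed simp
  then obtain b :: "'p padic_int" where b: "\<And>k. Rep_padic_int b k = x k mod ?p ^ k"
    using padic_limit by blast
  have "a * b = 1"
    by (rule padic_int_eqI) (use x in \<open>simp add: times_padic_int.rep_eq one_padic_int.rep_eq b mod_simps cong_def\<close>)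
  then show ?thesis ..
qed

text \<open>Hensel's lemma for y^2 - u: a root modulo p is improved by one power of p at a time, the
  derivative 2x being invertible because p is odd.\<close>

lemma padic_int_sqrt:
  fixes u :: "'p::prime_type padic_int"
  assumes odd: "odd CARD('p)" and u: "Rep_padic_int u 1 \<noteq> 0"
    and r: "[r ^ 2 = Rep_padic_int u 1] (mod int CARD('p))"
  shows "\<exists>a. a ^ 2 = u"
proof -
  let ?p = "int CARD('p)"
  let ?P = "\<lambda>n x. [x ^ 2 = Rep_padic_int u (Suc n)] (mod ?p ^ Suc n) \<and> coprime x ?p"
  have 0: "?P 0 r"
  proof -
    have "\<not> ?p dvd r"
    proof
      assume "?p dvd r"
      then have "[r ^ 2 = 0] (mod ?p)" by (simp add: cong_0_iff power2_eq_square)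
      then have "?p dvd Rep_padic_int u 1" using r by (metis cong_0_iff cong_sym cong_trans)
      then have "Rep_padic_int u 1 mod ?p = 0" by simp
      then show False using u Rep_padic_int_mod[of u 1] by simp
    qed
    then have "coprime r ?p" using prime_imp_coprime[OF prime_int_CARD] coprime_commute by blast
    then show ?thesis using r by simp
  qed
  \<comment> \<open>Newton step: if u = x^2 + p^(n+1) c, the correction p^(n+1) t has to satisfy 2xt
    = c modulo p.\<close>
  have S: "\<exists>y. ?P (Suc n) y \<and> [y = x] (mod ?p ^ Suc n)" if x: "?P n x" for n x
  proof -
    have "[x ^ 2 = Rep_padic_int u (Suc (Suc n))] (mod ?p ^ Suc n)"
      using x Rep_padic_int_add_mod[of u "Suc n" 1] Rep_padic_int_mod[of u "Suc n"] by (simp add: cong_def)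
    then obtain c where c: "Rep_padic_int u (Suc (Suc n)) = x ^ 2 + ?p ^ Suc n * c"
      by (metis cong_iff_lin)
    have "coprime (2 * x) ?p" using x odd by simp
    then obtain t0 where "[2 * x * t0 = 1] (mod ?p)" using cong_solve_coprime_int by blast
    then have "[2 * x * t0 * c = 1 * c] (mod ?p)" by (rule cong_scalar_right)
    then obtain t where t: "?p dvd 2 * x * t - c"
      by (metis cong_iff_dvd_diff mult.assoc mult_1)
    let ?y = "x + ?p ^ Suc n * t"
    have "?p ^ Suc (Suc n) dvd ?y ^ 2 - Rep_padic_int u (Suc (Suc n))"
    proof -
      have "?y ^ 2 - Rep_padic_int u (Suc (Suc n)) = ?p ^ Suc n * (2 * x * t - c) + ?p ^ Suc (Suc n) * (?p ^ n * t ^ 2)"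
        unfolding c by (simp add: power2_eq_square algebra_simps)
      moreover have "?p ^ Suc (Suc n) dvd ?p ^ Suc n * (2 * x * t - c)"
        using mult_dvd_mono[OF dvd_refl t, of "?p ^ Suc n"] by (simp add: ac_simps)
      ultimately show ?thesis by (metis dvd_add dvd_triv_left)
    qed
    moreover have "coprime ?y ?p"
    proof -
      have "[?y = x] (mod ?p)" by (simp add: cong_def mult.assoc)
      then show ?thesis using x by (meson cong_imp_coprime cong_sym)
    qed
    moreover have "[?y = x] (mod ?p ^ Suc n)" by (simp add: cong_def del: power_Suc)
    ultimately show ?thesis by (auto simp: cong_iff_dvd_diff simp del: power_Suc)
  qed
  obtain x where x: "\<And>n. ?P n (x n)" "\<And>n. [x (Suc n) = x n] (mod ?p ^ Suc n)"
    using dependent_nat_choice[of ?P "\<lambda>n x y. [y = x] (mod ?p ^ Suc n)"] 0 S by blast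
  \<comment> \<open>\<open>x n\<close> is a root modulo p^(n+1), so the index is shifted by one to
    match residues modulo p^n.\<close>
  define z where "z n = x (n - 1)" for n
  have "z (Suc n) mod ?p ^ n = z n mod ?p ^ n" for n
    using x(2)[of "n - 1"] by (cases n) (auto simp: z_def cong_def)
  then obtain a :: "'p padic_int" where a: "\<And>k. Rep_padic_int a k = z k mod ?p ^ k"
    using padic_limit by blast
  have "a ^ 2 = u"
  proof (rule padic_int_eqI)
    fix n show "Rep_padic_int (a ^ 2) n = Rep_padic_int u n"
    proof (cases n)
      case (Suc k)
      then show ?thesis using x(1)[of k] Rep_padic_int_mod[of u n]
        by (simp add: Rep_power a cong_def power_mod z_def del: power_Suc)
    qed simp
  qed
  then show ?thesis ..
qed

text \<open>The exponent is one less than the first level at which the residue of a is nonzero; one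
  more division by p would make that residue vanish.\<close>

lemma padic_int_decomp:
  assumes "(a :: 'p::prime_type padic_int) \<noteq> 0"
  shows "\<exists>n b. a = of_nat CARD('p) ^ n * b \<and> Rep_padic_int b 1 \<noteq> 0"
proof -
  let ?Q = "\<lambda>n. Rep_padic_int a n \<noteq> 0"
  define n where "n = (LEAST n. ?Q n)"
  have "\<exists>n. ?Q n" using assms by (metis padic_int_eqI zero_padic_int.rep_eq)
  then have n: "?Q n" unfolding n_def by (rule LeastI_ex)
  then obtain m where m: "n = Suc m" by (cases n) auto
  have m0: "Rep_padic_int a m = 0" using not_less_Least[of m ?Q] m n_def by auto
  then obtain b where b: "a = of_nat CARD('p) ^ m * b" using padic_int_expand[of a m] by auto
  have "Rep_padic_int b 1 \<noteq> 0"
  proof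
    assume "Rep_padic_int b 1 = 0"
    then obtain c where "b = of_nat CARD('p) * c" using padic_int_expand[of b 1] by auto
    then have "a = of_nat CARD('p) ^ n * c" using b m by (simp add: ac_simps)
    then have "Rep_padic_int a n = 0"
      by (simp add: times_padic_int.rep_eq Rep_power Rep_of_nat mod_simps power_mod)
    then show False using n by simp
  qed
  then show ?thesis using b by blast
qed

section \<open>Z_p inside its fraction field and the fractional ideals p^r Z_p\<close>

lemma of_nat_padic_int: "(of_nat n :: 'p::prime_type padic) = Fract (of_nat n) 1"
  by (simp add: of_nat_fract)

lemma of_int_padic_int: "(of_int n :: 'p::prime_type padic) = Fract (of_int n) 1"
proof (cases n)
  case (nonneg k)
  then show ?thesis by (simp add: of_nat_fract)
next
  case (neg k)
  show ?thesis unfolding neg of_int_minus of_int_of_nat_eq by (simp add: of_nat_fract del: of_nat_Suc)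
qed

lemma Fract1_power: "Fract a 1 ^ n = Fract (a ^ n) (1::'p::prime_type padic_int)"
  by (induction n) (auto simp: One_fract_def)

lemma Zp_add [intro]: "x \<in> Zp \<Longrightarrow> y \<in> Zp \<Longrightarrow> x + y \<in> Zp"
  by (auto simp: Zp_def)
lemma Zp_mult [intro]: "x \<in> Zp \<Longrightarrow> y \<in> Zp \<Longrightarrow> x * y \<in> Zp"
  by (auto simp: Zp_def)
lemma Zp_uminus [intro]: "x \<in> Zp \<Longrightarrow> - x \<in> Zp"
  by (auto simp: Zp_def)
lemma Zp_diff [intro]: "x \<in> Zp \<Longrightarrow> y \<in> Zp \<Longrightarrow> x - y \<in> Zp"
  by (auto simp: Zp_def)
lemma Zp_0 [simp, intro]: "0 \<in> Zp" and Zp_1 [simp, intro]: "1 \<in> Zp"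
  by (auto simp: Zp_def Zero_fract_def One_fract_def)
lemma Zp_of_nat [simp, intro]: "of_nat n \<in> Zp"
  by (auto simp: Zp_def of_nat_padic_int)
lemma Zp_of_int [simp, intro]: "of_int n \<in> Zp"
  by (auto simp: Zp_def of_int_padic_int)
lemma Zp_power [intro]: "x \<in> Zp \<Longrightarrow> x ^ n \<in> Zp"
  by (induction n) auto

lemma of_nat_p_padic_int: "(of_nat CARD('p) :: 'p::prime_type padic_int) \<noteq> 0"
proof
  assume "(of_nat CARD('p) :: 'p padic_int) = 0"
  then have "int CARD('p) mod int CARD('p) ^ 2 = 0"
    unfolding Rep_of_nat[of "CARD('p)" 2, where 'p='p, symmetric] by (simp only: zero_padic_int.rep_eq)
  then have "int CARD('p) ^ 2 dvd int CARD('p)" by (simp add: dvd_eq_mod_eq_0)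
  then have "int CARD('p) ^ 2 \<le> int CARD('p)" using p_gt_1[where 'p='p] by (intro zdvd_imp_le) auto
  then show False using p_gt_1[where 'p='p] by (simp add: power2_eq_square)
qed

lemma unif_nz [simp]: "(unif :: 'p::prime_type padic) \<noteq> 0"
  using of_nat_p_padic_int[where 'p='p] by (simp add: of_nat_padic_int Zero_fract_def eq_fract)

lemma pZp_iff: "x \<in> pZp r \<longleftrightarrow> unif powi (- r) * x \<in> Zp"
proof
  assume "x \<in> pZp r"
  then obtain z where "z \<in> Zp" "x = unif powi r * z" by (auto simp: pZp_def)
  then show "unif powi (- r) * x \<in> Zp" by (simp add: power_int_minus mult.assoc[symmetric])
next
  assume "unif powi (- r) * x \<in> Zp"
  moreover have "x = unif powi r * (unif powi (- r) * x)" by (simp add: power_int_minus mult.assoc[symmetric])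
  ultimately show "x \<in> pZp r" unfolding pZp_def by blast
qed

lemma pZp_0 [simp]: "pZp 0 = Zp" by (auto simp: pZp_iff)

lemma pZp_zero [simp, intro]: "0 \<in> pZp r" by (simp add: pZp_iff)
lemma pZp_add: "x \<in> pZp r \<Longrightarrow> y \<in> pZp r \<Longrightarrow> x + y \<in> pZp r"
  by (auto simp: pZp_iff distrib_left)
lemma pZp_uminus: "x \<in> pZp r \<Longrightarrow> - x \<in> pZp r"
  by (auto simp: pZp_iff dest: Zp_uminus)
lemma pZp_uminus_iff [simp]: "- x \<in> pZp r \<longleftrightarrow> x \<in> pZp r"
  using pZp_uminus[of x r] pZp_uminus[of "-x" r] by auto
lemma pZp_diff: "x \<in> pZp r \<Longrightarrow> y \<in> pZp r \<Longrightarrow> x - y \<in> pZp r"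
  by (auto simp: pZp_iff right_diff_distrib)
lemma pZp_mult: "x \<in> pZp r \<Longrightarrow> y \<in> pZp s \<Longrightarrow> x * y \<in> pZp (r + s)"
proof -
  assume "x \<in> pZp r" "y \<in> pZp s"
  then have "(unif powi (- r) * x) * (unif powi (- s) * y) \<in> Zp" by (auto simp: pZp_iff)
  moreover have "unif powi (- (r + s)) = unif powi (- r) * (unif powi (- s) :: 'a padic)"
    by (simp add: power_int_add[symmetric])
  ultimately show ?thesis by (simp add: pZp_iff ac_simps)
qed
lemma pZp_mult_Zp: "x \<in> pZp r \<Longrightarrow> y \<in> Zp \<Longrightarrow> x * y \<in> pZp r"
  using pZp_mult[of x r y 0] by simp
lemma pZp_Zp_mult: "x \<in> Zp \<Longrightarrow> y \<in> pZp r \<Longrightarrow> x * y \<in> pZp r"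
  using pZp_mult[of x 0 y r] by simp
lemma powi_Zp: "r \<ge> 0 \<Longrightarrow> unif powi r \<in> Zp"
  by (metis Zp_of_nat Zp_power nonneg_int_cases power_int_of_nat)
lemma powi_pZp [simp]: "unif powi r \<in> pZp r"
  by (simp add: pZp_iff power_int_add[symmetric])
lemma unif_pZp [simp]: "unif \<in> pZp 1" using powi_pZp[of 1] by simp
lemma unif_power_pZp: "unif ^ n \<in> pZp (int n)" using powi_pZp[of "int n"] by simp
lemma pZp_mono:
  assumes "x \<in> pZp s" "r \<le> s" shows "x \<in> pZp r"
proof -
  have "unif powi (s - r) * (unif powi (- s) * x) \<in> Zp"
    using assms powi_Zp[of "s - r"] by (auto simp: pZp_iff)
  then show ?thesis by (simp add: pZp_iff power_int_add[symmetric] mult.assoc[symmetric])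
qed
lemma pZp_Zp: "x \<in> pZp s \<Longrightarrow> 0 \<le> s \<Longrightarrow> x \<in> Zp"
  using pZp_mono[of x s 0] by simp
lemma powi_mult_pZp_iff: "unif powi r * x \<in> pZp s \<longleftrightarrow> x \<in> pZp (s - r)"
  by (simp add: pZp_iff power_int_add[symmetric] mult.assoc[symmetric])

text \<open>The bridge by which integer congruences enter: divisibility in the field becomes the
  vanishing of a residue.\<close>

lemma Fract1_pZp: "Fract a 1 \<in> pZp (int n) \<longleftrightarrow> Rep_padic_int (a :: 'p::prime_type padic_int) n = 0"
proof
  assume "Fract a 1 \<in> pZp (int n)"
  then obtain b where "Fract a 1 = unif ^ n * Fract b 1" by (auto simp: pZp_def Zp_def)
  then have "a = of_nat CARD('p) ^ n * b" by (simp add: of_nat_padic_int Fract1_power eq_fract)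
  then show "Rep_padic_int a n = 0" by (simp add: times_padic_int.rep_eq Rep_power Rep_of_nat power_mod)
next
  assume "Rep_padic_int a n = 0"
  then obtain b where b: "a = of_nat CARD('p) ^ n * b" using padic_int_expand[of a n] by auto
  then have "Fract a 1 = unif powi (int n) * Fract b 1" by (simp add: of_nat_padic_int Fract1_power)
  then show "Fract a 1 \<in> pZp (int n)" by (auto simp: pZp_def Zp_def)
qed

lemma of_int_pZp: "(of_int a :: 'p::prime_type padic) \<in> pZp (int n) \<longleftrightarrow> int CARD('p) ^ n dvd a"
  by (simp add: of_int_padic_int Fract1_pZp Rep_of_int dvd_eq_mod_eq_0)

lemma Zp_residue:
  assumes "(x :: 'p::prime_type padic) \<in> Zp"
  shows "\<exists>a::int. 0 \<le> a \<and> a < int CARD('p) ^ n \<and> x - of_int a \<in> pZp (int n)"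
proof -
  obtain z where z: "x = Fract z 1" using assms by (auto simp: Zp_def)
  let ?a = "Rep_padic_int z n"
  have "x - of_int ?a = Fract (z - of_int ?a) 1" by (simp add: z of_int_padic_int)
  moreover have "Rep_padic_int (z - of_int ?a) n = 0"
    by (simp add: minus_padic_int.rep_eq Rep_of_int mod_diff_right_eq)
  ultimately have "x - of_int ?a \<in> pZp (int n)" by (simp add: Fract1_pZp)
  moreover have "0 \<le> ?a" "?a < int CARD('p) ^ n"
    using Rep_padic_int_mod[of z n] p_gt_1[where 'p='p]
    by (metis pos_mod_sign zero_less_power zero_less_one less_trans, metis pos_mod_bound zero_less_power zero_less_one less_trans)
  ultimately show ?thesis by blast
qed

text \<open>Z_p is a local ring with maximal ideal p Z_p; the inverse comes from lifting an inverse
  modulo p.\<close>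

lemma Zp_units_iff: "u \<in> Zp_units \<longleftrightarrow> u \<in> Zp \<and> (u :: 'p::prime_type padic) \<notin> pZp 1"
proof
  assume u: "u \<in> Zp_units"
  have "u \<notin> pZp 1"
  proof
    assume "u \<in> pZp 1"
    then have "u * inverse u \<in> pZp 1" using u by (intro pZp_mult_Zp) (auto simp: Zp_units_def)
    then have "(of_int 1 :: 'p padic) \<in> pZp (int 1)" using u by (simp add: Zp_units_def)
    then have "int CARD('p) ^ 1 dvd 1" unfolding of_int_pZp .
    then show False using p_gt_1[where 'p='p] by simp
  qed
  then show "u \<in> Zp \<and> u \<notin> pZp 1" using u by (simp add: Zp_units_def)
next
  assume u: "u \<in> Zp \<and> u \<notin> pZp 1"
  then obtain z where z: "u = Fract z 1" by (auto simp: Zp_def)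
  then have "Rep_padic_int z 1 \<noteq> 0" using u Fract1_pZp[of z 1] by simp
  then obtain b where "z * b = 1" using padic_int_unit by blast
  then have "u * Fract b 1 = 1" by (simp add: z One_fract_def)
  moreover from this have "inverse u = Fract b 1" by (simp add: inverse_unique)
  ultimately show "u \<in> Zp_units" using u by (auto simp: Zp_units_def Zp_def)
qed

lemma Zp_units_Zp: "u \<in> Zp_units \<Longrightarrow> u \<in> Zp" by (simp add: Zp_units_def)
lemma Zp_units_nz: "u \<in> Zp_units \<Longrightarrow> u \<noteq> 0" by (simp add: Zp_units_def)
lemma Zp_units_mult: "u \<in> Zp_units \<Longrightarrow> v \<in> Zp_units \<Longrightarrow> u * v \<in> Zp_units"
  by (auto simp: Zp_units_def)
lemma Zp_units_inverse: "u \<in> Zp_units \<Longrightarrow> inverse u \<in> Zp_units"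
  by (auto simp: Zp_units_def)
lemma Zp_units_uminus: "u \<in> Zp_units \<Longrightarrow> - u \<in> Zp_units"
  by (auto simp: Zp_units_def)
lemma Zp_units_1 [simp]: "1 \<in> Zp_units" by (auto simp: Zp_units_def)
lemma Zp_units_m1 [simp]: "- 1 \<in> Zp_units" by (auto simp: Zp_units_def)
lemma Zp_units_power: "u \<in> Zp_units \<Longrightarrow> u ^ n \<in> Zp_units"
  by (induction n) (auto intro: Zp_units_mult)

lemma Zp_units_add:
  assumes "u \<in> Zp_units" "x \<in> pZp 1" shows "u + x \<in> Zp_units"
proof -
  have "u + x \<in> Zp" using assms pZp_Zp[of x 1] by (auto simp: Zp_units_iff)
  moreover have "u + x \<notin> pZp 1"
    using assms pZp_diff[of "u + x" 1 x] by (auto simp: Zp_units_iff)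
  ultimately show ?thesis by (simp add: Zp_units_iff)
qed

lemma unit_mult_pZp_iff: "u \<in> Zp_units \<Longrightarrow> u * x \<in> pZp r \<longleftrightarrow> x \<in> pZp r"
  using pZp_Zp_mult[of u x r] pZp_Zp_mult[of "inverse u" "u * x" r]
  by (auto simp: Zp_units_def mult.assoc[symmetric])

lemma padic_decomp:
  assumes "(x :: 'p::prime_type padic) \<noteq> 0"
  obtains k u where "u \<in> Zp_units" "x = unif powi k * u"
proof -
  have unit: "Fract b 1 \<in> Zp_units" if "Rep_padic_int b 1 \<noteq> 0" for b :: "'p padic_int"
    using that Fract1_pZp[of b 1] by (auto simp: Zp_units_iff Zp_def)
  obtain a b where ab: "x = Fract a b" "b \<noteq> 0" by (cases x) auto
  then have "a \<noteq> 0" using assms by (auto simp: Zero_fract_def eq_fract)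
  then obtain m c where c: "a = of_nat CARD('p) ^ m * c" "Rep_padic_int c 1 \<noteq> 0"
    using padic_int_decomp by blast
  obtain n d where d: "b = of_nat CARD('p) ^ n * d" "Rep_padic_int d 1 \<noteq> 0"
    using padic_int_decomp[OF ab(2)] by blast
  have "x = Fract a 1 / Fract b 1" using ab by (simp add: divide_fract)
  also have "\<dots> = (unif ^ m * Fract c 1) / (unif ^ n * Fract d 1)"
    by (simp add: c d of_nat_padic_int Fract1_power)
  also have "\<dots> = unif powi (int m - int n) * (Fract c 1 * inverse (Fract d 1))"
    by (simp add: power_int_diff divide_inverse)
  finally show ?thesis
    using that[OF Zp_units_mult[OF unit[OF c(2)] Zp_units_inverse[OF unit[OF d(2)]]]] by blast
qed

lemma powi_unit_pZp_iff:
  assumes "u \<in> Zp_units" shows "unif powi k * u \<in> pZp r \<longleftrightarrow> r \<le> k"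
proof
  assume "unif powi k * u \<in> pZp r"
  then have "u \<in> pZp (r - k)" by (simp add: powi_mult_pZp_iff)
  then show "r \<le> k" using assms pZp_mono[of u "r - k" 1] by (cases "r \<le> k") (auto simp: Zp_units_iff)
next
  assume "r \<le> k"
  then show "unif powi k * u \<in> pZp r"
    using assms pZp_mono[of u 0 "r - k"] by (simp add: powi_mult_pZp_iff Zp_units_Zp)
qed

lemma powi_unit_unique:
  assumes "u \<in> Zp_units" "v \<in> Zp_units" "unif powi k * u = unif powi j * v" shows "k = j"
  using powi_unit_pZp_iff[OF assms(1), of k k] powi_unit_pZp_iff[OF assms(1), of k j]
    powi_unit_pZp_iff[OF assms(2), of j k] powi_unit_pZp_iff[OF assms(2), of j j] assms(3)
  by auto

lemma ord_p_eq: "u \<in> Zp_units \<Longrightarrow> ord_p (unif powi k * u) = k"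
  unfolding ord_p_def by (rule the_equality) (use powi_unit_unique in blast)+

text \<open>An x outside p^r Z_p has valuation at most r - 1; the claims are the resulting bounds
  for 1/x and x^2.\<close>

lemma nonintegral_inverse:
  assumes "(x::'p::prime_type padic) \<notin> pZp r" shows "inverse x \<in> pZp (1 - r)" "x \<noteq> 0"
    "x\<^sup>2 \<notin> pZp (2 * r - 1)"
proof -
  show x: "x \<noteq> 0" using assms by auto
  then obtain k u where ku: "u \<in> Zp_units" "x = unif powi k * u" by (rule padic_decomp)
  then have "k < r" using assms powi_unit_pZp_iff by (meson not_le)
  moreover have "inverse x = unif powi (- k) * inverse u" by (simp add: ku power_int_minus)
  ultimately show "inverse x \<in> pZp (1 - r)"
    using powi_unit_pZp_iff[OF Zp_units_inverse[OF ku(1)], of "-k" "1 - r"] by simp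
  have "x\<^sup>2 = unif powi (2 * k) * u\<^sup>2"
    by (simp add: ku power_mult_distrib power_int_mult mult.commute[of 2 k])
  then show "x\<^sup>2 \<notin> pZp (2 * r - 1)"
    using \<open>k < r\<close> powi_unit_pZp_iff[OF Zp_units_power[OF ku(1)], of "2*k" 2 "2*r - 1"] by simp
qed

lemma padic_sqrt:
  fixes u :: "'p::prime_type padic"
  assumes odd: "odd CARD('p)" and u: "u \<in> Zp_units" and x: "x \<in> Zp" "u - x\<^sup>2 \<in> pZp 1"
  obtains y where "y\<^sup>2 = u"
proof -
  obtain a where a: "u = Fract a 1" using u by (auto simp: Zp_units_def Zp_def)
  obtain b where b: "x = Fract b 1" using x by (auto simp: Zp_def)
  have "u - x\<^sup>2 = Fract (a - b\<^sup>2) 1" by (simp add: a b Fract1_power)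
  then have "Rep_padic_int (a - b\<^sup>2) 1 = 0" using x(2) Fract1_pZp[of "a - b\<^sup>2" 1] by simp
  then have "(Rep_padic_int a 1 - Rep_padic_int b 1 ^ 2) mod int CARD('p) = 0"
    by (simp add: minus_padic_int.rep_eq Rep_power mod_diff_right_eq)
  then have "[Rep_padic_int b 1 ^ 2 = Rep_padic_int a 1] (mod int CARD('p))"
    by (metis cong_iff_dvd_diff cong_sym mod_0_imp_dvd)
  moreover have "Rep_padic_int a 1 \<noteq> 0" using u Fract1_pZp[of a 1] by (simp add: a Zp_units_iff)
  ultimately obtain c where "c\<^sup>2 = a" using padic_int_sqrt[OF odd] by blast
  then have "(Fract c 1)\<^sup>2 = u" by (simp add: Fract1_power a)
  then show ?thesis by (rule that)
qed

section \<open>Quadratic residues and the Hilbert symbol\<close>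

lemma residue_p_props:
  assumes "(u :: 'p::prime_type padic) \<in> Zp"
  shows "u - of_int (residue_p u) \<in> pZp 1"
proof -
  have "\<exists>!a. 0 \<le> a \<and> a < int CARD('p) \<and> u - of_int a \<in> pZp 1"
  proof -
    obtain a where a: "0 \<le> a" "a < int CARD('p)" "u - of_int a \<in> pZp 1"
      using Zp_residue[OF assms, of 1] by auto
    moreover have "b = a" if "0 \<le> b" "b < int CARD('p)" "u - of_int b \<in> pZp 1" for b
    proof -
      have "of_int (b - a) \<in> (pZp 1 :: 'p padic set)" using pZp_diff[OF a(3) that(3)] by simp
      then have "int CARD('p) dvd b - a" using of_int_pZp[of "b - a" 1, where 'p='p] by simp
      then show ?thesis using a that
        by (metis mod_eq_dvd_iff mod_pos_pos_trivial)
    qed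
    ultimately show ?thesis by blast
  qed
  from theI'[OF this] show ?thesis unfolding residue_p_def by blast
qed

lemma int_dvd_abs_less:
  assumes "p dvd (n::int)" "\<bar>n\<bar> < p" shows "n = 0"
proof (rule ccontr)
  assume "n \<noteq> 0"
  from dvd_imp_le_int[OF this assms(1)] show False using assms(2) by linarith
qed

lemma Legendre_cong: "[a = b] (mod p) \<Longrightarrow> Legendre a p = Legendre b p"
  unfolding Legendre_def QuadRes_def by (smt (verit) cong_sym cong_trans)

lemma legendre_p_eq:
  assumes "(u :: 'p::prime_type padic) - of_int a \<in> pZp 1"
  shows "legendre_p u = Legendre a (int CARD('p))"
proof -
  have "u = (u - of_int a) + of_int a" by simp
  then have "u \<in> Zp" using pZp_Zp[OF assms] by (metis Zp_add Zp_of_int zero_le_one)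
  from pZp_diff[OF assms residue_p_props[OF this]]
  have "of_int (residue_p u - a) \<in> (pZp 1 :: 'p padic set)" by simp
  then have "int CARD('p) dvd residue_p u - a" using of_int_pZp[of "residue_p u - a" 1, where 'p='p] by simp
  then show ?thesis unfolding legendre_p_def by (intro Legendre_cong) (simp add: cong_iff_dvd_diff)
qed

lemma legendre_p_cong:
  assumes "(u :: 'p::prime_type padic) - v \<in> pZp 1" "v \<in> Zp"
  shows "legendre_p u = legendre_p v"
proof -
  have "u - of_int (residue_p v) \<in> pZp 1"
    using pZp_add[OF assms(1) residue_p_props[OF assms(2)]] by simp
  from legendre_p_eq[OF this] show ?thesis by (simp only: legendre_p_def[of v])
qed

lemma unit_not_dvd:
  assumes "u \<in> Zp_units" "(u :: 'p::prime_type padic) - of_int a \<in> pZp 1"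
  shows "\<not> int CARD('p) dvd a"
proof
  assume "int CARD('p) dvd a"
  then have "(of_int a :: 'p padic) \<in> pZp 1" using of_int_pZp[of a 1, where 'p='p] by simp
  from pZp_add[OF assms(2) this] show False using assms(1) by (simp add: Zp_units_iff)
qed

lemma legendre_p_cases:
  assumes "(u :: 'p::prime_type padic) \<in> Zp_units"
  shows "legendre_p u = 1 \<or> legendre_p u = -1"
  using unit_not_dvd[OF assms residue_p_props[OF Zp_units_Zp[OF assms]]]
  by (auto simp: legendre_p_def Legendre_def cong_0_iff)

lemma legendre_p_sq [simp]: "u \<in> Zp_units \<Longrightarrow> legendre_p u * legendre_p u = 1"
  using legendre_p_cases[of u] by auto

text \<open>Euler's criterion gives the equality modulo p only. Both sides are signs, so they differ
  by less than p and therefore agree.\<close>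

lemma legendre_p_mult:
  assumes odd: "odd CARD('p)" and "(u :: 'p::prime_type padic) \<in> Zp_units" "v \<in> Zp_units"
  shows "legendre_p (u * v) = legendre_p u * legendre_p v"
proof -
  let ?p = "int CARD('p)"
  have p2: "2 < ?p" using odd p_gt_1[where 'p='p] by (cases "CARD('p) = 2") auto
  obtain a where a: "u - of_int a \<in> pZp 1" using residue_p_props Zp_units_Zp assms by blast
  obtain b where b: "v - of_int b \<in> pZp 1" using residue_p_props Zp_units_Zp assms by blast
  have "u * v - of_int (a * b) = u * (v - of_int b) + (u - of_int a) * of_int b"
    by (simp add: algebra_simps)
  then have ab: "u * v - of_int (a * b) \<in> pZp 1"
    using pZp_add[OF pZp_Zp_mult[OF Zp_units_Zp[OF assms(2)] b] pZp_mult_Zp[OF a Zp_of_int]] by simp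
  have e: "[Legendre x ?p = x ^ ((CARD('p) - 1) div 2)] (mod ?p)" for x
    using euler_criterion[of "CARD('p)" x] prime_type[where 'a='p] p2 by simp
  have "[Legendre a ?p * Legendre b ?p = (a * b) ^ ((CARD('p) - 1) div 2)] (mod ?p)"
    unfolding power_mult_distrib by (rule cong_mult[OF e e])
  then have c: "[Legendre (a * b) ?p = Legendre a ?p * Legendre b ?p] (mod ?p)"
    using e[of "a * b"] by (meson cong_sym cong_trans)
  have l: "legendre_p (u * v) = Legendre (a * b) ?p" "legendre_p u = Legendre a ?p"
    "legendre_p v = Legendre b ?p"
    using legendre_p_eq a b ab by blast+
  have "?p dvd legendre_p (u * v) - legendre_p u * legendre_p v"
    using c by (simp add: l cong_iff_dvd_diff)
  moreover have "\<bar>legendre_p (u * v) - legendre_p u * legendre_p v\<bar> < ?p"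
    using legendre_p_cases[OF assms(2)] legendre_p_cases[OF assms(3)] legendre_p_cases[OF Zp_units_mult[OF assms(2,3)]] p2
    by auto
  ultimately show ?thesis using int_dvd_abs_less by fastforce
qed

lemma legendre_p_1 [simp]: "legendre_p (1 :: 'p::prime_type padic) = 1"
proof -
  have "legendre_p (1 :: 'p padic) = Legendre 1 (int CARD('p))"
    using legendre_p_eq[of "1 :: 'p padic" 1] by simp
  also have "\<dots> = 1" using p_gt_1[where 'p='p]
    by (auto simp: Legendre_def QuadRes_def cong_def intro: exI[of _ 1])
  finally show ?thesis .
qed

lemma legendre_p_square:
  assumes "odd CARD('p)" and "(u :: 'p::prime_type padic) \<in> Zp_units" shows "legendre_p (u\<^sup>2) = 1"
  using legendre_p_mult[OF assms assms(2)] legendre_p_sq[OF assms(2)] by (simp add: power2_eq_square)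

lemma legendre_p_sqrt:
  assumes "odd CARD('p)" and u: "(u :: 'p::prime_type padic) \<in> Zp_units" and "legendre_p u = 1"
  shows "\<exists>y. y\<^sup>2 = u"
proof -
  let ?a = "residue_p u"
  have "QuadRes (int CARD('p)) ?a"
    using assms(3) by (auto simp: legendre_p_def Legendre_def split: if_splits)
  then obtain y where "[y\<^sup>2 = ?a] (mod int CARD('p))" by (auto simp: QuadRes_def)
  then have "int CARD('p) dvd ?a - y\<^sup>2" by (simp add: cong_iff_dvd_diff dvd_diff_commute)
  then have "of_int (?a - y\<^sup>2) \<in> (pZp 1 :: 'p padic set)"
    using of_int_pZp[of "?a - y\<^sup>2" 1, where 'p='p] by simp
  from pZp_add[OF residue_p_props[OF Zp_units_Zp[OF u]] this]
  have "u - (of_int y)\<^sup>2 \<in> pZp 1" by simp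
  with padic_sqrt[OF assms(1) u Zp_of_int] show ?thesis by metis
qed

lemma square_even_ord:
  assumes "(z::'p::prime_type padic)\<^sup>2 = unif powi k * u" "u \<in> Zp_units" shows "even k"
proof -
  have "z \<noteq> 0" using assms(1) Zp_units_nz[OF assms(2)] by (auto simp: power_int_eq_0_iff)
  then obtain j v where v: "v \<in> Zp_units" "z = unif powi j * v" by (rule padic_decomp)
  then have "unif powi k * u = unif powi (2 * j) * v\<^sup>2"
    using assms(1) by (simp add: power_mult_distrib power_int_mult mult.commute[of 2 j])
  from powi_unit_unique[OF assms(2) Zp_units_power[OF v(1)] this] show ?thesis by simp
qed

lemma legendre_p_square_class:
  assumes odd: "odd CARD('p)" and u: "(u :: 'p::prime_type padic) \<in> Zp_units"
    and z: "z\<^sup>2 - u \<in> pZp 1"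
  shows "legendre_p u = 1"
proof -
  have "z \<in> Zp"
  proof (rule ccontr)
    assume "z \<notin> Zp"
    then have "z\<^sup>2 \<notin> pZp (-1)" using nonintegral_inverse(3)[of z 0] by simp
    moreover have "(z\<^sup>2 - u) + u \<in> Zp" using Zp_add[OF pZp_Zp[OF z] Zp_units_Zp[OF u]] by simp
    ultimately show False using pZp_mono[of "z\<^sup>2" 0 "-1"] by simp
  qed
  moreover have "z \<notin> pZp 1"
  proof
    assume "z \<in> pZp 1"
    then have "z\<^sup>2 \<in> pZp 1" using \<open>z \<in> Zp\<close>
      by (simp add: power2_eq_square pZp_mult_Zp)
    from pZp_diff[OF this z] show False using u by (simp add: Zp_units_iff)
  qed
  ultimately have "z \<in> Zp_units" by (simp add: Zp_units_iff)
  then show ?thesis using legendre_p_square[OF odd, of z] legendre_p_cong[OF z Zp_units_Zp[OF u]] by simp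
qed

section \<open>The quadratic Hilbert symbol over Q_p for odd p\<close>

lemma hilbert_pm: "hilbert a b = 1 \<or> hilbert a b = -1" by (simp add: hilbert_def)
lemma hilbert_sq [simp]: "hilbert a b * hilbert a b = 1" using hilbert_pm[of a b] by auto

lemma hilbert_eqI: "(x, y, z) \<noteq> (0, 0, 0) \<Longrightarrow> a * x\<^sup>2 + b * y\<^sup>2 = z\<^sup>2 \<Longrightarrow> hilbert a b = 1"
  unfolding hilbert_def by auto

lemma hilbert_eqE:
  assumes "hilbert a b = 1"
  obtains x y z where "(x, y, z) \<noteq> (0, 0, 0)" "a * x\<^sup>2 + b * y\<^sup>2 = z\<^sup>2"
  using assms unfolding hilbert_def by (auto split: if_splits)

lemma hilbert_eq_cong: "(hilbert a b = 1 \<longleftrightarrow> hilbert c d = 1) \<Longrightarrow> hilbert a b = hilbert c d"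
  using hilbert_pm[of a b] hilbert_pm[of c d] by auto

lemma hilbert_sym: "hilbert a b = hilbert b a"
proof -
  have "hilbert b a = 1" if h: "hilbert a b = 1" for a b :: "'p::prime_type padic"
  proof -
    obtain x y z where "(x, y, z) \<noteq> (0, 0, 0)" "a * x\<^sup>2 + b * y\<^sup>2 = z\<^sup>2" using h
      by (rule hilbert_eqE)
    then show ?thesis by (intro hilbert_eqI[of y x z]) (auto simp: add.commute)
  qed
  then show ?thesis by (intro hilbert_eq_cong) blast
qed

lemma hilbert_square_left:
  assumes "c \<noteq> 0" shows "hilbert (a * c\<^sup>2) b = hilbert a b"
proof (rule hilbert_eq_cong, rule iffI)
  assume "hilbert (a * c\<^sup>2) b = 1"
  then obtain x y z
    where "(x, y, z) \<noteq> (0, 0, 0)" "(a * c\<^sup>2) * x\<^sup>2 + b * y\<^sup>2 = z\<^sup>2"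
    by (rule hilbert_eqE)
  then show "hilbert a b = 1" using assms
    by (intro hilbert_eqI[of "c * x" y z]) (auto simp: power_mult_distrib ac_simps)
next
  assume "hilbert a b = 1"
  then obtain x y z where "(x, y, z) \<noteq> (0, 0, 0)" "a * x\<^sup>2 + b * y\<^sup>2 = z\<^sup>2"
    by (rule hilbert_eqE)
  then show "hilbert (a * c\<^sup>2) b = 1" using assms
    by (intro hilbert_eqI[of "x / c" y z]) (auto simp: power_divide)
qed

lemma hilbert_square_right: "c \<noteq> 0 \<Longrightarrow> hilbert a (b * c\<^sup>2) = hilbert a b"
  using hilbert_square_left hilbert_sym by metis

lemma hilbert_1 [simp]: "hilbert 1 b = 1" "hilbert b 1 = 1"
  by (rule hilbert_eqI[of 1 0 1], simp_all) (rule hilbert_eqI[of 0 1 1], simp_all)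

text \<open>A solution (x, y, z) for (a, b) becomes the solution (z, y, ax) for (a, -ab), and doing
  this twice returns to b times the square a^2. This is the rule (a, -a) = 1, in a form that does
  not presuppose bimultiplicativity.\<close>

lemma hilbert_neg_mult:
  assumes "a \<noteq> 0" shows "hilbert a (- (a * b)) = hilbert a b"
proof -
  have *: "hilbert a (- (a * b)) = 1" if h: "hilbert a b = 1" for b
  proof -
    obtain x y z where "(x, y, z) \<noteq> (0, 0, 0)" and e: "a * x\<^sup>2 + b * y\<^sup>2 = z\<^sup>2"
      using h by (rule hilbert_eqE)
    moreover have "a * z\<^sup>2 + - (a * b) * y\<^sup>2 = (a * x)\<^sup>2"
      unfolding e[symmetric] by (simp add: algebra_simps power2_eq_square)
    ultimately show ?thesis using assms by (intro hilbert_eqI[of z y "a * x"]) auto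
  qed
  have e: "- (a * - (a * b)) = b * a\<^sup>2" by (simp add: power2_eq_square)
  show ?thesis
    using *[of b] *[of "- (a * b)", unfolded e hilbert_square_right[OF assms]]
    by (intro hilbert_eq_cong) blast
qed

text \<open>The range up to (p - 1)/2 contains only one of x and -x, so squaring is injective on
  it.\<close>

lemma inj_square_mod:
  assumes p: "prime p" "odd (p::int)" and a: "\<not> p dvd a"
  shows "inj_on (\<lambda>x. (c + a * x\<^sup>2) mod p) {0..(p - 1) div 2}"
proof (rule inj_onI)
  fix x y assume x: "x \<in> {0..(p - 1) div 2}" and y: "y \<in> {0..(p - 1) div 2}"
    and e: "(c + a * x\<^sup>2) mod p = (c + a * y\<^sup>2) mod p"
  have "p dvd a * ((x - y) * (x + y))"
    using e by (simp add: mod_eq_dvd_iff power2_eq_square algebra_simps)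
  then have "p dvd x - y \<or> p dvd x + y" using p a by (simp add: prime_dvd_mult_iff)
  then show "x = y"
  proof
    assume "p dvd x - y"
    moreover have "\<bar>x - y\<bar> < p" using x y prime_gt_1_int[OF p(1)] by auto
    ultimately show ?thesis using int_dvd_abs_less[of p "x - y"] by simp
  next
    assume "p dvd x + y"
    moreover have "x + y < p" using x y prime_gt_1_int[OF p(1)] by auto
    ultimately have "x + y = 0" using x y int_dvd_abs_less[of p "x + y"] by auto
    then show ?thesis using x y by auto
  qed
qed

text \<open>Pigeonhole: the values a x^2 and the values 1 - b y^2 form two sets of (p + 1)/2
  residues, which must meet among the p residues.\<close>

lemma sum_two_squares_mod:
  assumes p: "prime p" "odd (p::int)" and a: "\<not> p dvd a" and b: "\<not> p dvd b"
  shows "\<exists>x y. [a * x\<^sup>2 + b * y\<^sup>2 = 1] (mod p)"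
proof -
  let ?S = "{0..(p - 1) div 2}"
  let ?f = "\<lambda>x. (0 + a * x\<^sup>2) mod p" and ?g = "\<lambda>x. (1 + (- b) * x\<^sup>2) mod p"
  have p1: "p > 1" using prime_gt_1_int[OF p(1)] .
  have "?f ` ?S \<inter> ?g ` ?S \<noteq> {}"
  proof
    assume d: "?f ` ?S \<inter> ?g ` ?S = {}"
    have "card (?f ` ?S \<union> ?g ` ?S) = card (?f ` ?S) + card (?g ` ?S)"
      using d by (intro card_Un_disjoint) auto
    also have "\<dots> = 2 * card ?S"
      using inj_square_mod[OF p a, of 0] inj_square_mod[OF p, of "-b" 1] b by (simp add: card_image)
    also have "int \<dots> = p + 1" using p p1 by (auto elim!: oddE)
    finally have "int (card (?f ` ?S \<union> ?g ` ?S)) = p + 1" .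
    moreover have "card (?f ` ?S \<union> ?g ` ?S) \<le> card {0..<p}"
      using p1 by (intro card_mono) auto
    ultimately show False using p1 by simp
  qed
  then obtain x y where "?f x = ?g y" by auto
  then have "[a * x\<^sup>2 = 1 - b * y\<^sup>2] (mod p)" by (simp add: cong_def)
  then have "[a * x\<^sup>2 + b * y\<^sup>2 = (1 - b * y\<^sup>2) + b * y\<^sup>2] (mod p)"
    by (rule cong_add) simp
  then show ?thesis by auto
qed

text \<open>With y kept fixed, u X^2 = 1 - v y^2 has a right side congruent to u x^2 with x a unit,
  so Hensel's lemma supplies X.\<close>

lemma hilbert_units_aux:
  fixes u v :: "'p::prime_type padic"
  assumes odd: "odd CARD('p)" and u: "u \<in> Zp_units" and v: "v \<in> Zp"
    and xy: "u * x\<^sup>2 + v * y\<^sup>2 - 1 \<in> pZp 1" "x \<in> Zp_units" "y \<in> Zp"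
  shows "hilbert u v = 1"
proof -
  define t where "t = (1 - v * y\<^sup>2) * inverse u"
  have "x\<^sup>2 - t = (u * x\<^sup>2 + v * y\<^sup>2 - 1) * inverse u"
    using Zp_units_nz[OF u] by (simp add: t_def field_simps)
  then have e: "x\<^sup>2 - t \<in> pZp 1" using pZp_mult_Zp[OF xy(1) Zp_units_Zp[OF Zp_units_inverse[OF u]]]
    by simp
  have "t \<in> Zp_units" using Zp_units_add[OF Zp_units_power[OF xy(2)], of "- (x\<^sup>2 - t)" 2] e
    by (simp add: pZp_uminus del: minus_diff_eq) 
  then obtain X where "X\<^sup>2 = t"
    using padic_sqrt[OF odd, of t x] e pZp_uminus[OF e] Zp_units_Zp[OF xy(2)] by auto
  then have "u * X\<^sup>2 + v * y\<^sup>2 = 1\<^sup>2"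
    using Zp_units_nz[OF u] by (simp add: t_def mult.left_commute[of u "1 - v * y\<^sup>2"])
  then show ?thesis by (intro hilbert_eqI[of X y 1]) auto
qed

lemma hilbert_units:
  fixes u v :: "'p::prime_type padic"
  assumes odd: "odd CARD('p)" and u: "u \<in> Zp_units" and v: "v \<in> Zp_units"
  shows "hilbert u v = 1"
proof -
  let ?p = "int CARD('p)"
  let ?a = "residue_p u" and ?b = "residue_p v"
  note ua = residue_p_props[OF Zp_units_Zp[OF u]] and vb = residue_p_props[OF Zp_units_Zp[OF v]]
  obtain x y where xy: "[?a * x\<^sup>2 + ?b * y\<^sup>2 = 1] (mod ?p)"
    using sum_two_squares_mod[of ?p ?a ?b] prime_int_CARD[where 'p='p] odd unit_not_dvd[OF u ua] unit_not_dvd[OF v vb] by auto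
  have "of_int (?a * x\<^sup>2 + ?b * y\<^sup>2 - 1) \<in> (pZp 1 :: 'p padic set)"
    using xy of_int_pZp[of "?a * x\<^sup>2 + ?b * y\<^sup>2 - 1" 1, where 'p='p]
      by (simp add: cong_iff_dvd_diff)
  moreover have "(u - of_int ?a) * of_int (x\<^sup>2) \<in> pZp 1"
    "(v - of_int ?b) * of_int (y\<^sup>2) \<in> pZp 1"
    using pZp_mult_Zp[OF ua Zp_of_int] pZp_mult_Zp[OF vb Zp_of_int] by blast+
  ultimately have "of_int (?a * x\<^sup>2 + ?b * y\<^sup>2 - 1) + (u - of_int ?a) * of_int (x\<^sup>2) + (v - of_int ?b) * of_int (y\<^sup>2) \<in> pZp 1"
    by (intro pZp_add)
  then have e: "u * (of_int x)\<^sup>2 + v * (of_int y)\<^sup>2 - 1 \<in> pZp 1" by (simp add: algebra_simps)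
  have unit: "of_int z \<in> (Zp_units :: 'p padic set)" if "\<not> ?p dvd z" for z
    using that of_int_pZp[of z 1, where 'p='p] by (simp add: Zp_units_iff)
  show ?thesis
  proof (cases "?p dvd x")
    case False
    then show ?thesis using hilbert_units_aux[OF odd u Zp_units_Zp[OF v] e unit] by simp
  next
    case True
    \<comment> \<open>If x vanishes modulo p then y does not, and the roles of u and v are
      exchanged.\<close>
    have "\<not> ?p dvd y"
    proof
      assume "?p dvd y"
      then have "?p dvd ?a * x\<^sup>2 + ?b * y\<^sup>2" using True by (simp add: power2_eq_square)
      then have "?p dvd 1" using xy by (metis cong_dvd_iff)
      then show False using p_gt_1[where 'p='p] by simp
    qed
    moreover have "v * (of_int y)\<^sup>2 + u * (of_int x)\<^sup>2 - 1 \<in> pZp 1" using e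
      by (simp add: add.commute)
    ultimately show ?thesis using hilbert_units_aux[OF odd v Zp_units_Zp[OF u]] unit hilbert_sym Zp_of_int
      by metis
  qed
qed

text \<open>In a solution x is nonzero and y/x is integral, since otherwise a square would have odd
  valuation. Then (z/x)^2 = u modulo p, so u is a square class.\<close>

lemma hilbert_unit_unif:
  fixes u v :: "'p::prime_type padic"
  assumes odd: "odd CARD('p)" and u: "u \<in> Zp_units" and v: "v \<in> Zp_units"
  shows "hilbert u (unif * v) = legendre_p u"
proof -
  have "hilbert u (unif * v) = 1 \<longleftrightarrow> legendre_p u = 1"
  proof
    assume "legendre_p u = 1"
    then obtain y where "y\<^sup>2 = u" using legendre_p_sqrt[OF odd u] by blast
    then show "hilbert u (unif * v) = 1" by (intro hilbert_eqI[of 1 0 y]) auto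
  next
    assume "hilbert u (unif * v) = 1"
    then obtain x y z where nz: "(x, y, z) \<noteq> (0, 0, 0)"
      and e: "u * x\<^sup>2 + unif * v * y\<^sup>2 = z\<^sup>2" by (rule hilbert_eqE)
    have x: "x \<noteq> 0"
    proof
      assume x: "x = 0"
      have "y \<noteq> 0" using nz e x by auto
      then obtain k w where w: "w \<in> Zp_units" "y = unif powi k * w" by (rule padic_decomp)
      have "z\<^sup>2 = unif powi (2 * k + 1) * (v * w\<^sup>2)"
        using e x
          by (simp add: w power_int_add power_mult_distrib power_int_mult mult.commute[of 2 k] ac_simps)
      then show False using square_even_ord Zp_units_mult[OF v Zp_units_power[OF w(1)]] by fastforce
    qed
    define y' where "y' = y / x"
    define z' where "z' = z / x"
    have e': "u + unif * v * y'\<^sup>2 = z'\<^sup>2"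
      using e x by (simp add: y'_def z'_def power_divide field_simps)
    have "y' \<in> Zp"
    proof (rule ccontr)
      assume ny: "y' \<notin> Zp"
      then have "y' \<noteq> 0" by auto
      then obtain k w where w: "w \<in> Zp_units" "y' = unif powi k * w" by (rule padic_decomp)
      have k: "k < 0" using ny powi_unit_pZp_iff[OF w(1), of k 0] by (simp add: w)
      have "unif powi (2 * k + 1) * unif powi (- (2 * k + 1)) = (1 :: 'p padic)"
        by (simp add: power_int_add[symmetric])
      then have "z'\<^sup>2 = unif powi (2 * k + 1) * (v * w\<^sup>2 + unif powi (- (2 * k + 1)) * u)"
        unfolding e'[symmetric] w distrib_left mult.assoc[symmetric]
        by (simp add: power_int_add power_mult_distrib power_int_mult mult.commute[of 2 k] ac_simps)
      moreover have "v * w\<^sup>2 + unif powi (- (2 * k + 1)) * u \<in> Zp_units"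
        using k by (intro Zp_units_add Zp_units_mult Zp_units_power v w) (simp add: powi_unit_pZp_iff[OF u])
      ultimately show False using square_even_ord by fastforce
    qed
    then have "unif * (v * y'\<^sup>2) \<in> pZp 1" using Zp_units_Zp[OF v] by (intro pZp_mult_Zp) auto
    then have "z'\<^sup>2 - u \<in> pZp 1" by (simp add: e'[symmetric] mult.assoc)
    then show "legendre_p u = 1" by (rule legendre_p_square_class[OF odd u])
  qed
  then show ?thesis using legendre_p_cases[OF u] hilbert_pm[of u "unif * v"] by auto
qed

text \<open>\<open>hilbert_neg_mult\<close> replaces the second argument by the unit -uv up to a
  square, which leads back to the unit-uniformizer case.\<close>

lemma hilbert_unif_unif:
  fixes u v :: "'p::prime_type padic"
  assumes odd: "odd CARD('p)" and u: "u \<in> Zp_units" and v: "v \<in> Zp_units"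
  shows "hilbert (unif * u) (unif * v) = legendre_p (- 1 :: 'p padic) * legendre_p u * legendre_p v"
proof -
  have "hilbert (unif * u) (unif * v) = hilbert (unif * u) (- (unif * u * (unif * v)))"
    using Zp_units_nz[OF u] by (subst hilbert_neg_mult) auto
  also have "- (unif * u * (unif * v)) = (- 1 * (u * v)) * unif\<^sup>2"
    by (simp add: power2_eq_square ac_simps)
  also have "hilbert (unif * u) \<dots> = hilbert (unif * u) (- 1 * (u * v))"
    by (rule hilbert_square_right) simp
  also have "\<dots> = legendre_p (- 1 * (u * v))"
    by (subst hilbert_sym, rule hilbert_unit_unif[OF odd _ u]) (intro Zp_units_mult Zp_units_m1 u v)
  finally show ?thesis by (simp only: legendre_p_mult[OF odd] Zp_units_mult Zp_units_m1 u v mult.assoc)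
qed

text \<open>Up to squares only the exponents 0 and 1 occur, which leaves four cases for the
  symbol.\<close>

lemma powi_parity:
  "\<exists>c. c \<noteq> 0 \<and> unif powi k * u = (if odd k then unif * u else (u::'p::prime_type padic)) * c\<^sup>2"
proof (intro exI conjI)
  show "unif powi (k div 2) \<noteq> (0::'p padic)" by (simp add: power_int_eq_0_iff)
  have "unif powi k = (unif powi (k mod 2 + k div 2 * 2) :: 'p padic)" by simp
  also have "\<dots> = unif powi (k mod 2) * (unif powi (k div 2))\<^sup>2"
    by (subst power_int_add) (simp_all add: power_int_mult)
  finally show "unif powi k * u = (if odd k then unif * u else u) * (unif powi (k div 2))\<^sup>2"
    by (cases "odd k") (auto simp: odd_iff_mod_2_eq_one even_iff_mod_2_eq_zero)
qed

text \<open>This is the tame symbol. Bimultiplicativity now follows from multiplicativity of the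
  Legendre symbol and additivity of exponents.\<close>

lemma hilbert_formula:
  fixes u v :: "'p::prime_type padic"
  assumes odd: "odd CARD('p)" and u: "u \<in> Zp_units" and v: "v \<in> Zp_units"
  shows "hilbert (unif powi i * u) (unif powi j * v) =
    (if odd i \<and> odd j then legendre_p (- 1 :: 'p padic) else 1) * (if odd j then legendre_p u else 1) * (if odd i then legendre_p v else 1)"
proof -
  obtain c where c: "c \<noteq> 0" "unif powi i * u = (if odd i then unif * u else u) * c\<^sup>2"
    using powi_parity by blast
  obtain d where d: "d \<noteq> 0" "unif powi j * v = (if odd j then unif * v else v) * d\<^sup>2"
    using powi_parity by blast
  show ?thesis
    unfolding c d hilbert_square_left[OF c(1)] hilbert_square_right[OF d(1)]
    using hilbert_units[OF odd u v] hilbert_unit_unif[OF odd u v] hilbert_unif_unif[OF odd u v]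
      hilbert_unit_unif[OF odd v u] hilbert_sym[of "unif * u" v] by auto
qed

lemma hilbert_mult_left:
  fixes a b c :: "'p::prime_type padic"
  assumes odd: "odd CARD('p)" and "a \<noteq> 0" "b \<noteq> 0" "c \<noteq> 0"
  shows "hilbert (a * b) c = hilbert a c * hilbert b c"
proof -
  obtain i u where u: "u \<in> Zp_units" "a = unif powi i * u" using assms(2) by (rule padic_decomp)
  obtain j v where v: "v \<in> Zp_units" "b = unif powi j * v" using assms(3) by (rule padic_decomp)
  obtain k w where w: "w \<in> Zp_units" "c = unif powi k * w" using assms(4) by (rule padic_decomp)
  have ab: "a * b = unif powi (i + j) * (u * v)" by (simp add: u v power_int_add ac_simps)
  show ?thesis unfolding ab unfolding u v w
    using legendre_p_cases[OF u(1)] legendre_p_cases[OF v(1)] legendre_p_cases[OF w(1)] legendre_p_cases[OF Zp_units_m1, where 'p='p]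
    by (auto simp: hilbert_formula[OF odd] Zp_units_mult u v w legendre_p_mult[OF odd])
qed

lemma hilbert_mult_right:
  fixes a b c :: "'p::prime_type padic"
  assumes "odd CARD('p)" and "a \<noteq> 0" "b \<noteq> 0" "c \<noteq> 0"
  shows "hilbert c (a * b) = hilbert c a * hilbert c b"
  using hilbert_mult_left[OF assms] hilbert_sym by metis

section \<open>Matrices\<close>

lemma mat2_nth [simp]:
  "mat2 a b c d $ 1 $ 1 = a" "mat2 a b c d $ 1 $ 2 = b" "mat2 a b c d $ 2 $ 1 = c" "mat2 a b c d $ 2 $ 2 = d"
  by (simp_all add: mat2_def)

lemma mat2_eqI: "A $ 1 $ 1 = B $ 1 $ 1 \<Longrightarrow> A $ 1 $ 2 = B $ 1 $ 2 \<Longrightarrow> A $ 2 $ 1 = B $ 2 $ 1 \<Longrightarrow> A $ 2 $ 2 = B $ 2 $ 2 \<Longrightarrow> A = (B :: 'a ^ 2 ^ 2)"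
  by (simp add: vec_eq_iff forall_2)

lemma mat2_eta: "mat2 (A $ 1 $ 1) (A $ 1 $ 2) (A $ 2 $ 1) (A $ 2 $ 2) = A"
  by (rule mat2_eqI) simp_all

lemma mat2_cases: obtains a b c d where "A = mat2 a b c d"
  by (metis mat2_eta)

lemma mat2_inject [simp]: "mat2 a b c d = mat2 a' b' c' d' \<longleftrightarrow> a = a' \<and> b = b' \<and> c = c' \<and> d = d'"
  by (metis mat2_nth)

lemma mat2_mult [simp]:
  "mat2 a b c d ** mat2 e f g h = mat2 (a * e + b * g) (a * f + b * h) (c * e + d * g) (c * f + d * (h :: 'a::semiring_1))"
  by (rule mat2_eqI) (simp_all add: matrix_matrix_mult_def sum_2)

lemma mat_1_mat2: "mat 1 = mat2 1 0 0 (1::'a::semiring_1)"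
  by (rule mat2_eqI) (simp_all add: mat_def)

lemma uminus_mat2: "- mat2 a b c d = mat2 (- a) (- b) (- c) (- d :: 'a::ring_1)"
  by (rule mat2_eqI) simp_all

lemma det_mat2 [simp]: "det (mat2 a b c d) = a * d - b * (c :: 'a::comm_ring_1)"
  by (simp add: det_2)

text \<open>The inverse on determinant 1, polynomial in the entries, in contrast to
  \<open>matrix_inv\<close>, which is defined by choice.\<close>

definition adj2 :: "'a::comm_ring_1 ^ 2 ^ 2 \<Rightarrow> 'a ^ 2 ^ 2"
  where "adj2 A = mat2 (A $ 2 $ 2) (- A $ 1 $ 2) (- A $ 2 $ 1) (A $ 1 $ 1)"

lemma adj2_mat2 [simp]: "adj2 (mat2 a b c d) = mat2 d (- b) (- c) a"
  by (simp add: adj2_def)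

lemma adj2_mult:
  assumes "det A = 1" shows "adj2 A ** A = mat 1" "A ** adj2 A = mat 1"
  using assms by (cases A rule: mat2_cases; simp add: mat_1_mat2 algebra_simps)+

lemma matrix_inv_eqI:
  fixes A :: "'a::semiring_1 ^ 2 ^ 2"
  assumes "A ** B = mat 1" "B ** A = mat 1" shows "matrix_inv A = B"
proof -
  have "A ** matrix_inv A = mat 1 \<and> matrix_inv A ** A = mat 1"
    unfolding matrix_inv_def by (rule someI[of _ B]) (use assms in simp)
  then show ?thesis using assms by (metis matrix_mul_assoc matrix_mul_lid matrix_mul_rid)
qed

lemma matrix_inv_alpha: "matrix_inv alpha = mat2 (inverse unif) 0 0 1"
  by (rule matrix_inv_eqI) (simp_all add: alpha_def mat_1_mat2)

lemma matrix_inv_hm [simp]: "t \<noteq> 0 \<Longrightarrow> matrix_inv (hm t) = hm (inverse t)"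
  by (rule matrix_inv_eqI) (simp_all add: hm_def mat_1_mat2)

lemma SL2_mat2 [simp]: "mat2 a b c d \<in> SL2 \<longleftrightarrow> a * d - b * c = 1"
  by (simp add: SL2_def)

lemma SL2_mult: "g \<in> SL2 \<Longrightarrow> h \<in> SL2 \<Longrightarrow> g ** h \<in> SL2"
  by (simp add: SL2_def det_mul)

lemma SL2_xm [simp]: "xm s \<in> SL2" and SL2_ym [simp]: "ym s \<in> SL2"
  and SL2_hm [simp]: "t \<noteq> 0 \<Longrightarrow> hm t \<in> SL2"
    and SL2_wm [simp]: "t \<noteq> 0 \<Longrightarrow> wm t \<in> SL2"
  and SL2_1 [simp]: "mat 1 \<in> SL2"
  by (simp_all add: xm_def ym_def hm_def wm_def mat_1_mat2)

lemma xm_add: "xm (s + t) = xm s ** xm t" and ym_add: "ym (s + t) = ym s ** ym t"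
  by (simp_all add: xm_def ym_def add.commute)

lemma K0_mat2: "mat2 a b c d \<in> K0 \<longleftrightarrow> a * d - b * c = 1 \<and> a \<in> Zp \<and> b \<in> Zp \<and> c \<in> Zp \<and> d \<in> Zp"
  by (auto simp: K0_def forall_2)

lemma conj_alpha_mat2:
  "alpha ** mat2 a b c d ** matrix_inv alpha = mat2 a (unif * b) (inverse unif * c) d"
  unfolding matrix_inv_alpha by (simp add: alpha_def field_simps)

lemma inverse_unif_pZp: "inverse unif * x \<in> pZp r \<longleftrightarrow> x \<in> pZp (r + 1)"
  using powi_mult_pZp_iff[of "-1" x r] by (simp add: power_int_minus)

lemma unif_pZp_iff: "unif * x \<in> pZp r \<longleftrightarrow> x \<in> pZp (r - 1)"
  using powi_mult_pZp_iff[of "1" x r] by simp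

lemma K1_iff: "g \<in> K1 \<longleftrightarrow> alpha ** g ** matrix_inv alpha \<in> K0"
proof
  assume "g \<in> K1"
  then obtain k where "k \<in> K0" "g = matrix_inv alpha ** k ** alpha" by (auto simp: K1_def)
  moreover obtain a b c d where "k = mat2 a b c d" by (rule mat2_cases)
  ultimately show "alpha ** g ** matrix_inv alpha \<in> K0" unfolding matrix_inv_alpha
    by (simp add: alpha_def field_simps)
next
  assume *: "alpha ** g ** matrix_inv alpha \<in> K0"
  obtain a b c d where g: "g = mat2 a b c d" by (rule mat2_cases)
  have "g = matrix_inv alpha ** (alpha ** g ** matrix_inv alpha) ** alpha"
    unfolding matrix_inv_alpha by (simp add: g alpha_def)
  then show "g \<in> K1" unfolding K1_def using * by blast
qed

text \<open>One description by entries for both maximal compact subgroups, so that later arguments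
  can carry \<delta> as a parameter.\<close>

lemma Kd_mat2:
  assumes "\<delta> \<le> 1"
  shows "mat2 a b c d \<in> Kd \<delta> \<longleftrightarrow>
    a * d - b * c = 1 \<and> a \<in> Zp \<and> b \<in> pZp (- int \<delta>) \<and> c \<in> pZp (int \<delta>) \<and> d \<in> Zp"
proof (cases "\<delta> = 0")
  case False
  then have "\<delta> = 1" using assms by simp
  moreover have e: "unif * b * (inverse unif * c) = b * c" by (simp add: field_simps)
  ultimately show ?thesis
    using unif_pZp_iff[of b 0] inverse_unif_pZp[of c 0]
      by (auto simp: Kd_def K1_iff conj_alpha_mat2 K0_mat2 e)
qed (auto simp: Kd_def K0_mat2)

lemma K0_Kd: "K0 = Kd 0" and K1_Kd: "K1 = Kd 1" by (auto simp: Kd_def)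

lemma Iw_mat2: "mat2 a b c d \<in> Iw \<longleftrightarrow> a * d - b * c = 1 \<and> a \<in> Zp \<and> b \<in> Zp \<and> c \<in> pZp 1 \<and> d \<in> Zp"
  by (auto simp: Iw_def I_GL_def K_GL_def forall_2 intro: pZp_Zp)

lemma Kr_mat2: "mat2 a b c d \<in> Kr r \<longleftrightarrow> a * d - b * c = 1 \<and> a \<in> Zp \<and> b \<in> Zp \<and> c \<in> pZp (int r) \<and> d \<in> Zp"
  by (auto simp: Kr_def K0_mat2 intro: pZp_Zp)

lemma J_grp_mat2:
  assumes "\<delta> \<le> 1"
  shows "mat2 a b c d \<in> J_grp \<delta> l \<longleftrightarrow> a * d - b * c = 1 \<and> a - 1 \<in> pZp (int l) \<and> d - 1 \<in> pZp (int l) \<and>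
    b \<in> pZp (int l - int \<delta>) \<and> c \<in> pZp (int l + int \<delta>)"
proof -
  have "x \<in> Zp" if "x - 1 \<in> pZp (int l)" for x :: "'a padic"
    using Zp_add[OF pZp_Zp[OF that] Zp_1] by simp
  then show ?thesis by (auto simp: J_grp_def Kd_mat2[OF assms] elim: pZp_mono)
qed

lemma Iw_diag_units:
  assumes "mat2 a b c d \<in> Iw" shows "a \<in> Zp_units" "d \<in> Zp_units" "a * d - 1 \<in> pZp 1"
proof -
  have bc: "b * c \<in> pZp 1" using assms by (auto simp: Iw_mat2 intro: pZp_Zp_mult)
  have ad: "a * d = 1 + b * c" using assms by (auto simp: Iw_mat2 algebra_simps)
  then have "a * d \<in> Zp_units" using Zp_units_add[OF Zp_units_1 bc] by simp
  then show "a \<in> Zp_units" "d \<in> Zp_units"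
    using assms pZp_mult_Zp[of a 1 d] pZp_Zp_mult[of a d 1] by (auto simp: Iw_mat2 Zp_units_iff)
  show "a * d - 1 \<in> pZp 1" using ad bc by simp
qed

section \<open>Closure of the compact groups and the Iwasawa decomposition\<close>

definition matgroup :: "('p::prime_type) mat2 set \<Rightarrow> bool" where
  "matgroup K \<longleftrightarrow> K \<subseteq> SL2 \<and> mat 1 \<in> K \<and> (\<forall>g\<in>K. \<forall>h\<in>K. g ** h \<in> K) \<and> (\<forall>g\<in>K. adj2 g \<in> K)"

lemma matgroupD:
  assumes "matgroup K"
  shows "g \<in> K \<Longrightarrow> g \<in> SL2" "mat 1 \<in> K"
    "g \<in> K \<Longrightarrow> h \<in> K \<Longrightarrow> g ** h \<in> K"
    "g \<in> K \<Longrightarrow> adj2 g \<in> K"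
  using assms by (auto simp: matgroup_def)

lemma matgroup_adj2:
  assumes "matgroup K" "g \<in> K" shows "adj2 g ** g = mat 1" "g ** adj2 g = mat 1"
  using assms adj2_mult[of g] by (auto simp: matgroup_def SL2_def)

lemma matgroup_Kd:
  assumes "\<delta> \<le> 1" shows "matgroup (Kd \<delta>)"
  unfolding matgroup_def
proof (intro conjI ballI subsetI)
  note k = Kd_mat2[OF assms]
  fix g h :: "'a mat2" assume g: "g \<in> Kd \<delta>"
  obtain a b c d where g': "g = mat2 a b c d" by (rule mat2_cases)
  show "g \<in> SL2" "adj2 g \<in> Kd \<delta>" using g by (auto simp: g' k algebra_simps)
  assume h: "h \<in> Kd \<delta>"
  obtain a' b' c' d' where h': "h = mat2 a' b' c' d'" by (rule mat2_cases)
  have "b * c' \<in> Zp" "c * b' \<in> Zp"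
    using g h pZp_mult[of b "- int \<delta>" c' "int \<delta>"] pZp_mult[of c "int \<delta>" b' "- int \<delta>"] by (auto simp: g' h' k)
  moreover have "a * b' + b * d' \<in> pZp (- int \<delta>)" "c * a' + d * c' \<in> pZp (int \<delta>)"
    using g h by (auto simp: g' h' k intro!: pZp_add intro: pZp_mult_Zp pZp_Zp_mult)
  moreover have "g ** h \<in> SL2" using SL2_mult[of g h] g h by (simp add: g' h' k)
  ultimately show "g ** h \<in> Kd \<delta>" using g h by (auto simp: g' h' k)
next
  show "mat 1 \<in> Kd \<delta>" by (auto simp: mat_1_mat2 Kd_mat2[OF assms])
qed

lemma matgroup_Iw: "matgroup Iw"
  unfolding matgroup_def
proof (intro conjI ballI subsetI)
  fix g h :: "'a mat2" assume g: "g \<in> Iw"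
  obtain a b c d where g': "g = mat2 a b c d" by (rule mat2_cases)
  show "g \<in> SL2" "adj2 g \<in> Iw" using g by (auto simp: g' Iw_mat2 algebra_simps)
  assume h: "h \<in> Iw"
  obtain a' b' c' d' where h': "h = mat2 a' b' c' d'" by (rule mat2_cases)
  have "b * c' \<in> Zp" "c * b' \<in> Zp"
    using g h pZp_Zp[of c' 1] pZp_Zp[of c 1] by (auto simp: g' h' Iw_mat2)
  moreover have "c * a' + d * c' \<in> pZp 1"
    using g h by (auto simp: g' h' Iw_mat2 intro!: pZp_add intro: pZp_mult_Zp pZp_Zp_mult)
  moreover have "g ** h \<in> SL2" using SL2_mult[of g h] g h by (simp add: g' h' Iw_mat2)
  ultimately show "g ** h \<in> Iw" using g h by (auto simp: g' h' Iw_mat2)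
next
  show "mat 1 \<in> Iw" by (auto simp: mat_1_mat2 Iw_mat2)
qed

text \<open>The second column determines a matrix of determinant 1 up to a lower unipotent on the
  right, which turns the Iwasawa decomposition into a question about columns. The parameter is the
  determinant of the two first columns.\<close>

lemma lower_unipotent_right_factor:
  fixes a :: "'a::comm_ring_1"
  assumes "a * d - b * c = 1" "a' * d - b * c' = 1"
  shows "\<exists>z. mat2 a b c d = mat2 a' b c' d ** mat2 1 0 z 1"
proof (intro exI)
  have "a' + b * (a' * c - c' * a) = a' * (1 + b * c) - b * c' * a" by (simp add: algebra_simps)
  also have "1 + b * c = a * d" using assms(1) by (simp add: algebra_simps)
  also have "a' * (a * d) - b * c' * a = a * (a' * d - b * c')" by (simp add: algebra_simps)
  finally have 1: "a' + b * (a' * c - c' * a) = a" using assms by simp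
  have "c' + d * (a' * c - c' * a) = c * (a' * d) - c' * (a * d - 1)" by (simp add: algebra_simps)
  also have "a * d - 1 = b * c" using assms(1) by (simp add: algebra_simps)
  also have "c * (a' * d) - c' * (b * c) = c * (a' * d - b * c')" by (simp add: algebra_simps)
  finally have 2: "c' + d * (a' * c - c' * a) = c" using assms by simp
  show "mat2 a b c d = mat2 a' b c' d ** mat2 1 0 (a' * c - c' * a) 1" using 1 2 by simp
qed

lemma Iwasawa:
  fixes g :: "'p::prime_type mat2"
  assumes \<delta>: "\<delta> \<le> 1" and g: "g \<in> SL2"
  obtains k n z where "k \<in> Kd \<delta>" "g = k ** (hm (unif powi n) ** ym z)"
proof -
  obtain a b c d where g': "g = mat2 a b c d" by (rule mat2_cases)
  have det: "a * d - b * c = 1" using g by (simp add: g')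
  note main = that
  \<comment> \<open>It suffices that p^n times the second column of g completes to an element of
    K^\<delta>.\<close>
  have *: thesis if k: "mat2 a' (b * unif powi n) c' (d * unif powi n) \<in> Kd \<delta>" for a' c' n
  proof -
    let ?t = "unif powi n :: 'p padic"
    have t: "?t \<noteq> 0" by (simp add: power_int_eq_0_iff)
    let ?k = "mat2 a' (b * ?t) c' (d * ?t)"
    have "a' * ?t * d - b * (c' * ?t) = 1" using k by (simp add: Kd_mat2[OF \<delta>] ac_simps)
    then obtain z where "g = mat2 (a' * ?t) b (c' * ?t) d ** mat2 1 0 z 1"
      using lower_unipotent_right_factor[OF det] g' by blast
    also have "mat2 (a' * ?t) b (c' * ?t) d = ?k ** hm ?t" using t by (simp add: hm_def)
    finally have "g = ?k ** (hm ?t ** ym z)" by (simp add: ym_def matrix_mul_assoc)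
    then show thesis using main k by blast
  qed
  have **: "mat2 0 (unif powi (- int \<delta>) * u) (- (unif powi (int \<delta>) * inverse u)) e \<in> Kd \<delta>"
    if "u \<in> Zp_units" "e \<in> Zp" for u e :: "'p padic"
  proof -
    have "unif powi (- int \<delta>) * u * (unif powi (int \<delta>) * inverse u) = 1"
      using Zp_units_nz[OF that(1)] by (simp add: power_int_minus field_simps)
    then show ?thesis using that
      using pZp_mult_Zp[OF unif_power_pZp[of \<delta>] Zp_units_Zp[OF Zp_units_inverse[OF that(1)]]]
      by (auto simp: Kd_mat2[OF \<delta>] powi_unit_pZp_iff Zp_units_inverse)
  qed
  show thesis
  proof (cases "d = 0")
    case True
    then have "b \<noteq> 0" using det by auto
    then obtain i u where u: "u \<in> Zp_units" "b = unif powi i * u" by (rule padic_decomp)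
    have "b * unif powi (- i - int \<delta>) = unif powi (- int \<delta>) * u"
      by (simp add: u power_int_diff power_int_minus field_simps)
    then show thesis using *[of 0 "- i - int \<delta>"] **[OF u(1), of 0] True by simp
  next
    case d: False
    then obtain j v where v: "v \<in> Zp_units" "d = unif powi j * v" by (rule padic_decomp)
    \<comment> \<open>The larger of d and p^\<delta> b decides n: either d p^n is made a unit, or b
      p^n is made p^(-\<delta>) times a unit.\<close>
    show thesis
    proof (cases "b \<in> pZp (j - int \<delta>)")
      case True
      have "b * unif powi (- j) \<in> pZp (- int \<delta>)"
        using pZp_mult[OF True powi_pZp[of "- j"]] by simp
      moreover have dv: "d * unif powi (- j) = v" by (simp add: v power_int_minus)
      ultimately have "mat2 (inverse v) (b * unif powi (- j)) 0 (d * unif powi (- j)) \<in> Kd \<delta>"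
        unfolding dv using Zp_units_nz[OF v(1)] Zp_units_Zp[OF v(1)] Zp_units_Zp[OF Zp_units_inverse[OF v(1)]]
        by (simp add: Kd_mat2[OF \<delta>])
      then show thesis by (rule *)
    next
      case False
      then have "b \<noteq> 0" by auto
      then obtain i u where u: "u \<in> Zp_units" "b = unif powi i * u" by (rule padic_decomp)
      have ij: "i + int \<delta> < j" using False powi_unit_pZp_iff[OF u(1), of i "j - int \<delta>"]
        by (simp add: u)
      have bn: "b * unif powi (- i - int \<delta>) = unif powi (- int \<delta>) * u"
        by (simp add: u power_int_diff power_int_minus field_simps)
      have "unif powi j * unif powi (- i - int \<delta>) = (unif powi (j - i - int \<delta>) :: 'p padic)"
        by (simp add: power_int_add[symmetric] algebra_simps)
      moreover have "d * unif powi (- i - int \<delta>) = (unif powi j * unif powi (- i - int \<delta>)) * v"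
        unfolding v(2) by (simp only: ac_simps)
      ultimately have dn: "d * unif powi (- i - int \<delta>) = unif powi (j - i - int \<delta>) * v" by simp
      have vz: "unif powi (j - i - int \<delta>) * v \<in> Zp"
        using powi_unit_pZp_iff[OF v(1), of "j - i - int \<delta>" 0] ij by simp
      have "mat2 0 (b * unif powi (- i - int \<delta>)) (- (unif powi (int \<delta>) * inverse u)) (d * unif powi (- i - int \<delta>)) \<in> Kd \<delta>"
        unfolding bn dn by (rule **[OF u(1) vz])
      then show thesis by (rule *)
    qed
  qed
qed

section \<open>The cocycle\<close>

lemma tau_nz: "g \<in> SL2 \<Longrightarrow> tau_entry g \<noteq> 0"
  by (cases g rule: mat2_cases) (auto simp: tau_entry_def)

text \<open>The square is 1 or t^(-2), according to which entry defines \<tau>; the symbol sees only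
  the factor t.\<close>

lemma tau_torus_right:
  assumes "t \<noteq> 0" "g \<in> SL2" obtains c
    where "c \<noteq> 0" "tau_entry (g ** hm t) = tau_entry g * t * c\<^sup>2"
proof (cases "g $ 2 $ 1 = 0")
  case True
  have "tau_entry (g ** hm t) = tau_entry g * t * (inverse t)\<^sup>2"
    using True assms(1) by (cases g rule: mat2_cases) (auto simp: tau_entry_def hm_def power2_eq_square)
  then show thesis using that[of "inverse t"] assms by simp
next
  case False
  have "tau_entry (g ** hm t) = tau_entry g * t * 1\<^sup>2"
    using False assms(1) by (cases g rule: mat2_cases) (auto simp: tau_entry_def hm_def)
  then show thesis using that[of 1] by simp
qed

lemma tau_torus_left:
  "t \<noteq> 0 \<Longrightarrow> tau_entry (hm t ** g) = tau_entry g * t * (inverse t)\<^sup>2"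
  by (cases g rule: mat2_cases) (auto simp: tau_entry_def hm_def power2_eq_square)

lemma tau_hm: "t \<noteq> 0 \<Longrightarrow> tau_entry (hm t) = t * (inverse t)\<^sup>2"
  by (auto simp: tau_entry_def hm_def power2_eq_square)

lemma s_p_pm: "s_p g = 1 \<or> s_p g = -1"
  using hilbert_pm by (auto simp: s_p_def)

lemma s_p_sq [simp]: "s_p g * s_p g = 1" using s_p_pm[of g] by auto

lemma pm_cancel [simp]:
  "hilbert a b * (hilbert a b * n) = n" "s_p g * (s_p g * n) = n"
  by (simp_all add: mult.assoc[symmetric])

lemma cocycle_pm: "cocycle g h = 1 \<or> cocycle g h = -1"
  using s_p_pm[of g] s_p_pm[of h] s_p_pm[of "g ** h"]
    hilbert_pm[of "tau_entry (g ** h) * tau_entry g" "tau_entry (g ** h) * tau_entry h"]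
  by (auto simp: cocycle_def)

lemma cocycle_sq [simp]: "cocycle g h * cocycle g h = 1" "cocycle g h * (cocycle g h * n) = n"
  using cocycle_pm[of g h] by auto

lemma cocycle_1_left [simp]: "g \<in> SL2 \<Longrightarrow> cocycle (mat 1) g = 1"
  using hilbert_square_right[of "tau_entry g" "tau_entry g" 1] tau_nz[of g]
  by (simp add: cocycle_def tau_entry_def[of "mat 1"] s_p_def[of "mat 1"] power2_eq_square) (simp add: mat_def)

lemmas hilbert_bimult = hilbert_mult_left hilbert_mult_right

text \<open>Multiplication by a torus element changes \<open>\<tau>\<close> by a fixed factor up to squares, so for
  triples containing a torus element the cocycle identity reduces to bimultiplicativity of the
  Hilbert symbol.\<close>

lemma cocycle_torus_third:
  fixes g h :: "'p::prime_type mat2"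
  assumes odd: "odd CARD('p)" and g: "g \<in> SL2" and h: "h \<in> SL2" and t: "t \<noteq> 0"
  shows "cocycle g h * cocycle (g ** h) (hm t) = cocycle g (h ** hm t) * cocycle h (hm t)"
proof -
  obtain c where c: "c \<noteq> 0" "tau_entry (h ** hm t) = tau_entry h * t * c\<^sup>2"
    using tau_torus_right[OF t h] .
  obtain d where d: "d \<noteq> 0" "tau_entry (g ** h ** hm t) = tau_entry (g ** h) * t * d\<^sup>2"
    using tau_torus_right[OF t SL2_mult[OF g h]] .
  note nz = tau_nz[OF g] tau_nz[OF h] tau_nz[OF SL2_mult[OF g h]]
  have ii: "inverse t \<noteq> 0" using t by simp
  have "hilbert (tau_entry (g ** h) * tau_entry g) (tau_entry (g ** h) * tau_entry h)
      * hilbert (tau_entry (g ** h) * t * d\<^sup>2 * tau_entry (g ** h)) (tau_entry (g ** h) * t * d\<^sup>2 * (t * (inverse t)\<^sup>2))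
    = hilbert (tau_entry (g ** h) * t * d\<^sup>2 * tau_entry g) (tau_entry (g ** h) * t * d\<^sup>2 * (tau_entry h * t * c\<^sup>2))
      * hilbert (tau_entry h * t * c\<^sup>2 * tau_entry h) (tau_entry h * t * c\<^sup>2 * (t * (inverse t)\<^sup>2))"
    using nz t c(1) d(1) ii
    by (simp add: hilbert_bimult[OF odd] power2_eq_square del: inverse_eq_iff_eq) (simp add: ac_simps hilbert_sym)
  then show ?thesis
    unfolding cocycle_def matrix_mul_assoc c d tau_hm[OF t]
    by (simp add: ac_simps)
qed

lemma cocycle_torus_second:
  fixes g h :: "'p::prime_type mat2"
  assumes odd: "odd CARD('p)" and g: "g \<in> SL2" and h: "h \<in> SL2" and t: "t \<noteq> 0"
  shows "cocycle g (hm t) * cocycle (g ** hm t) h = cocycle g (hm t ** h) * cocycle (hm t) h"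
proof -
  obtain c where c: "c \<noteq> 0" "tau_entry (g ** hm t) = tau_entry g * t * c\<^sup>2"
    using tau_torus_right[OF t g] .
  let ?D = "tau_entry (g ** hm t ** h)"
  note nz = tau_nz[OF g] tau_nz[OF h] tau_nz[OF SL2_mult[OF SL2_mult[OF g SL2_hm[OF t]] h]]
  have ii: "inverse t \<noteq> 0" using t by simp
  have "hilbert (tau_entry g * t * c\<^sup>2 * tau_entry g) (tau_entry g * t * c\<^sup>2 * (t * (inverse t)\<^sup>2))
      * hilbert (?D * (tau_entry g * t * c\<^sup>2)) (?D * tau_entry h)
    = hilbert (?D * tau_entry g) (?D * (tau_entry h * t * (inverse t)\<^sup>2))
      * hilbert (tau_entry h * t * (inverse t)\<^sup>2 * (t * (inverse t)\<^sup>2)) (tau_entry h * t * (inverse t)\<^sup>2 * tau_entry h)"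
    using nz t c(1) ii
    by (simp add: hilbert_bimult[OF odd] power2_eq_square del: inverse_eq_iff_eq) (simp add: ac_simps hilbert_sym)
  then show ?thesis
    unfolding cocycle_def matrix_mul_assoc c tau_hm[OF t] tau_torus_left[OF t]
    by (simp add: ac_simps)
qed

lemma ord_p_mult_square:
  assumes "c \<noteq> 0"
    "x \<noteq> 0" shows "odd (ord_p (x * c\<^sup>2)) \<longleftrightarrow> odd (ord_p x)"
proof -
  obtain i u where u: "u \<in> Zp_units" "x = unif powi i * u" using assms(2) by (rule padic_decomp)
  obtain j v where v: "v \<in> Zp_units" "c = unif powi j * v" using assms(1) by (rule padic_decomp)
  have "x * c\<^sup>2 = unif powi (i + 2 * j) * (u * v\<^sup>2)"
    by (simp add: u v power_int_add power_mult_distrib power_int_mult mult.commute[of 2 j] ac_simps)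
  then have "ord_p (x * c\<^sup>2) = i + 2 * j"
    using ord_p_eq[OF Zp_units_mult[OF u(1) Zp_units_power[OF v(1)]]] by metis
  then show ?thesis using ord_p_eq[OF u(1), of i] by (simp add: u)
qed

text \<open>The second matrix is the conjugate of the first by h(t). Its \<open>s_p\<close> is the
  same and its \<tau> differs by a square, so moving h(t) across the matrix produces the same sign
  on both sides.\<close>

lemma cocycle_torus_conj:
  fixes a :: "'p::prime_type padic"
  assumes odd: "odd CARD('p)" and k: "mat2 a b c d \<in> SL2" and t: "t \<noteq> 0"
  shows "cocycle (hm t) (mat2 a b c d) * cocycle (mat2 a (t\<^sup>2 * b) (c * (inverse t)\<^sup>2) d) (hm t) = 1"
proof -
  let ?k = "mat2 a b c d" and ?k' = "mat2 a (t\<^sup>2 * b) (c * (inverse t)\<^sup>2) d"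
  have e: "?k' ** hm t = hm t ** ?k" using t by (simp add: hm_def power2_eq_square field_simps)
  have "t\<^sup>2 * b * (c * (inverse t)\<^sup>2) = (t * inverse t)\<^sup>2 * (b * c)"
    unfolding power2_eq_square by (simp only: ac_simps)
  also have "\<dots> = b * c" using t by simp
  finally have bc: "t\<^sup>2 * b * (c * (inverse t)\<^sup>2) = b * c" .
  have k': "?k' \<in> SL2" using k unfolding SL2_mat2 bc .
  have "s_p ?k' = s_p ?k"
    using t hilbert_square_left[of "inverse t" c d] ord_p_mult_square[of "inverse t" c]
      by (auto simp: s_p_def)
  moreover obtain e where e': "e \<noteq> 0" "tau_entry ?k' = tau_entry ?k * e\<^sup>2"
    using that[of 1] that[of "inverse t"] t by (cases "c = 0") (auto simp: tau_entry_def)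
  moreover have "hilbert (tau_entry ?k * t * (inverse t)\<^sup>2 * (t * (inverse t)\<^sup>2)) (tau_entry ?k * t * (inverse t)\<^sup>2 * tau_entry ?k)
     * hilbert (tau_entry ?k * t * (inverse t)\<^sup>2 * (tau_entry ?k * e\<^sup>2)) (tau_entry ?k * t * (inverse t)\<^sup>2 * (t * (inverse t)\<^sup>2)) = 1"
    using t e'(1) tau_nz[OF k]
    by (simp add: hilbert_bimult[OF odd] power2_eq_square del: inverse_eq_iff_eq) (simp add: ac_simps hilbert_sym)
  ultimately show ?thesis
    unfolding cocycle_def e tau_hm[OF t] tau_torus_left[OF t]
    by (simp add: ac_simps)
qed

lemma splittingD:
  assumes "is_splitting \<delta> s" "g \<in> Kd \<delta>" "h \<in> Kd \<delta>"
  shows "s (g ** h) = s g * s h * cocycle g h" "s g = 1 \<or> s g = - 1"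
  using assms by (auto simp: is_splitting_def hom_def cover_def GL2_def)

lemma splitting_1:
  assumes "is_splitting \<delta> s" shows "s (mat 1) = 1"
proof -
  have "xm 0 = (mat 1 :: 'a mat2)" by (simp add: xm_def mat_1_mat2)
  then show ?thesis using assms by (auto simp: is_splitting_def split: if_splits) (metis Zp_0, metis pZp_zero)
qed

text \<open>The matrix factors as y(c/a) h(a) x(b/a), because a is a unit on the Iwahori subgroup.
  Both cocycles in this product are trivial, so the value comes from h(a) alone, and (a/p) = (d/p)
  because ad is 1 modulo p.\<close>

lemma splitting_Iw:
  fixes s :: "'p::prime_type mat2 \<Rightarrow> int"
  assumes odd: "odd CARD('p)" and \<delta>: "\<delta> \<le> 1" and s: "is_splitting \<delta> s"
    and k: "mat2 a b c d \<in> Iw"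
  shows "s (mat2 a b c d) = (if \<delta> = 0 then 1 else legendre_p d)"
proof -
  note a = Iw_diag_units(1)[OF k] and d = Iw_diag_units(2)[OF k]
  note a' = Zp_units_inverse[OF a] and anz = Zp_units_nz[OF a]
  have k': "a * d - b * c = 1" "b \<in> Zp" "c \<in> pZp 1" using k by (auto simp: Iw_mat2)
  define x where "x = b * inverse a"
  define y where "y = c * inverse a"
  have x: "x \<in> Zp" and y: "y \<in> pZp 1"
    using k' Zp_units_Zp[OF a'] by (auto simp: x_def y_def intro: pZp_mult_Zp)
  have xd: "x \<in> pZp (- int \<delta>)" and yd: "y \<in> pZp (int \<delta>)"
    using x y \<delta> pZp_mono[of x 0 "- int \<delta>"] pZp_mono[of y 1 "int \<delta>"] by auto
  have K: "xm x \<in> Kd \<delta>" "ym y \<in> Kd \<delta>" "hm a \<in> Kd \<delta>"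
    using xd yd anz Zp_units_Zp[OF a] Zp_units_Zp[OF a']
      by (auto simp: xm_def ym_def hm_def Kd_mat2[OF \<delta>])
  have K2: "ym y ** hm a \<in> Kd \<delta>" using matgroupD(3)[OF matgroup_Kd[OF \<delta>] K(2,3)] .
  have "d = inverse a + y * a * x"
  proof -
    have "d = inverse a * (a * d)" using anz by simp
    also have "a * d = 1 + b * c" using k'(1) by (simp add: algebra_simps)
    also have "inverse a * (1 + b * c) = inverse a + y * a * x" using anz
      by (simp add: x_def y_def distrib_left ac_simps)
    finally show ?thesis .
  qed
  then have dec: "mat2 a b c d = ym y ** hm a ** xm x"
    using anz by (simp add: ym_def hm_def xm_def x_def y_def)
  have yh: "ym y ** hm a = mat2 a 0 (y * a) (inverse a)" by (simp add: ym_def hm_def)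
  \<comment> \<open>For y nonzero the symbol reduces to (a, y), and the factor \<open>s_p\<close> of
    the product is the same sign, (a/p) to the power ord y.\<close>
  have "cocycle (ym y) (hm a) = 1"
  proof (cases "y = 0")
    case True
    then have "ym y = mat 1" by (simp add: ym_def mat_1_mat2)
    then show ?thesis using anz by simp
  next
    case False
    then obtain i v where v: "v \<in> Zp_units" "y = unif powi i * v" by (rule padic_decomp)
    have "y * a * inverse a = y" using anz by (simp add: mult.assoc)
    moreover have "y * a * y = a * y\<^sup>2" by (simp add: power2_eq_square)
    ultimately have "hilbert (y * a * y) (y * a * inverse a) = hilbert (a * y\<^sup>2) y" by (simp only:)
    also have "\<dots> = hilbert a y" using False by (simp add: hilbert_square_left)
    also have "\<dots> = (if odd i then legendre_p a else 1)"
      using hilbert_formula[OF odd a v(1), of 0 i] by (simp add: v)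
    finally have 1: "hilbert (y * a * y) (y * a * inverse a) = (if odd i then legendre_p a else 1)" .
    have ya: "y * a = unif powi i * (v * a)" by (simp add: v)
    have l: "legendre_p (inverse a) = legendre_p a"
      using legendre_p_mult[OF odd a a'] anz legendre_p_cases[OF a] legendre_p_cases[OF a'] by auto
    have 2: "s_p (ym y ** hm a) = (if odd i then legendre_p a else 1)"
      using hilbert_formula[OF odd Zp_units_mult[OF v(1) a] a', of i 0] ord_p_eq[OF Zp_units_mult[OF v(1) a], of i] anz Zp_units_nz[OF v(1)] False
      by (auto simp: yh s_p_def ya l)
    have 3: "s_p (ym y) = 1" "s_p (hm a) = 1" by (simp_all add: s_p_def ym_def hm_def)
    show ?thesis
      using 1 2 3 legendre_p_cases[OF a] False anz
      by (auto simp: cocycle_def tau_entry_def yh) (auto simp: ym_def hm_def)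
  qed
  \<comment> \<open>Multiplication by x(x) keeps the lower left entry and changes the lower right
    one by a multiple of p, so \<open>s_p\<close> is unchanged, while the symbol has a square as an
    argument.\<close>
  moreover have "cocycle (ym y ** hm a) (xm x) = 1"
  proof (cases "y = 0")
    case True
    then show ?thesis unfolding yh using anz hilbert_square_left[of "inverse a" 1 "inverse a"]
      by (simp add: cocycle_def tau_entry_def s_p_def xm_def power2_eq_square)
  next
    case False
    then obtain i v where v: "v \<in> Zp_units" "y = unif powi i * v" by (rule padic_decomp)
    have ya: "y * a = unif powi i * (v * a)" by (simp add: v)
    have "y * a * x \<in> pZp 1" using y x Zp_units_Zp[OF a] by (intro pZp_mult_Zp)
    then have e: "inverse a + y * a * x \<in> Zp_units"
      "legendre_p (inverse a + y * a * x) = legendre_p (inverse a)"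
      using Zp_units_add[OF a'] legendre_p_cong[of "inverse a + y * a * x" "inverse a"] Zp_units_Zp[OF a']
        by simp_all
    have "s_p (ym y ** hm a) = (if odd i then legendre_p (inverse a) else 1)"
      using hilbert_formula[OF odd Zp_units_mult[OF v(1) a] a', of i 0] ord_p_eq[OF Zp_units_mult[OF v(1) a], of i] anz False
      by (auto simp: yh s_p_def ya dest: Zp_units_nz[OF v(1), THEN notE])
    moreover have "s_p (ym y ** hm a ** xm x) = (if odd i then legendre_p (inverse a) else 1)"
      using hilbert_formula[OF odd Zp_units_mult[OF v(1) a] e(1), of i 0] ord_p_eq[OF Zp_units_mult[OF v(1) a], of i] anz False e Zp_units_nz[OF e(1)]
      by (auto simp: yh s_p_def xm_def ya add.commute dest: Zp_units_nz[OF v(1), THEN notE])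
    moreover have "hilbert (y * a * (y * a)) (y * a) = 1"
      using hilbert_square_left[of "y * a" 1 "y * a"] False anz by (simp add: power2_eq_square)
    ultimately show ?thesis using False anz legendre_p_cases[OF a']
      by (auto simp: cocycle_def tau_entry_def yh xm_def s_p_def[of "mat2 1 x 0 1"])
  qed
  moreover have "s (xm x) = 1 \<and> s (ym y) = 1 \<and> s (hm a) = (if \<delta> = 0 then 1 else legendre_p a)"
    using s x y a pZp_Zp[of y 1] pZp_mono[of x 0 "-1"] by (cases "\<delta> = 0") (auto simp: is_splitting_def)
  moreover have "legendre_p a = legendre_p d"
  proof -
    have "legendre_p (a * d) = 1" using legendre_p_cong[OF Iw_diag_units(3)[OF k]] by simp
    then show ?thesis using legendre_p_mult[OF odd a d] legendre_p_cases[OF a] legendre_p_cases[OF d] by auto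
  qed
  ultimately show ?thesis
    using splittingD(1)[OF s K2 K(1)] splittingD(1)[OF s K(2,3)] by (simp add: dec)
qed

section \<open>Representations\<close>

lemma rep_GLsub: "representation (GLsub K) V \<rho> \<longleftrightarrow>
    complex_vector.subspace V \<and> (\<forall>g\<in>K. clinear_on V V (\<rho> g)) \<and> (\<forall>v\<in>V. \<rho> (mat 1) v = v) \<and>
    (\<forall>g\<in>K. \<forall>h\<in>K. \<forall>v\<in>V. \<rho> (g ** h) v = \<rho> g (\<rho> h v))"
  by (simp add: representation_def GL2_def)

lemma repD:
  assumes "representation (GLsub K) V \<rho>"
  shows "complex_vector.subspace V" "g \<in> K \<Longrightarrow> clinear_on V V (\<rho> g)"
    "v \<in> V \<Longrightarrow> \<rho> (mat 1) v = v"
    "g \<in> K \<Longrightarrow> h \<in> K \<Longrightarrow> v \<in> V \<Longrightarrow> \<rho> (g ** h) v = \<rho> g (\<rho> h v)"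
  using assms unfolding rep_GLsub by blast+

lemma clinear_onD:
  assumes "clinear_on V W T"
  shows "v \<in> V \<Longrightarrow> T v \<in> W"
    "u \<in> V \<Longrightarrow> v \<in> V \<Longrightarrow> T (u + v) = T u + T v"
    "v \<in> V \<Longrightarrow> T (c *\<^sub>C v) = c *\<^sub>C T v"
  using assms unfolding clinear_on_def by blast+

lemma repV: "representation (GLsub K) V \<rho> \<Longrightarrow> g \<in> K \<Longrightarrow> v \<in> V \<Longrightarrow> \<rho> g v \<in> V"
  by (rule clinear_onD(1)[OF repD(2)])

lemma clinear_on_0:
  assumes "complex_vector.subspace V" "clinear_on V W T" shows "T 0 = 0"
  using clinear_onD(3)[OF assms(2) complex_vector.subspace_0[OF assms(1)], of 0] by simp

lemma clinear_on_sum: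
  assumes "complex_vector.subspace V" "clinear_on V W T" "finite I"
    "\<And>i. i \<in> I \<Longrightarrow> f i \<in> V"
  shows "T (\<Sum>i\<in>I. f i) = (\<Sum>i\<in>I. T (f i))"
  using assms(3,4)
proof (induction I rule: finite_induct)
  case empty
  then show ?case using clinear_on_0[OF assms(1,2)] by simp
next
  case (insert i I)
  then show ?case
    using clinear_onD(2)[OF assms(2), of "f i"
    "\<Sum>i\<in>I. f i"] complex_vector.subspace_sum[OF assms(1), of I f] by simp
qed

text \<open>The vector form of Hom_S(1, V) = 0. S is an arbitrary set, which covers unions of two
  unipotent groups as well as sets of parameters such as p^e Z_p.\<close>

definition nofix :: "'g set \<Rightarrow> 'v::complex_vector set \<Rightarrow> ('g \<Rightarrow> 'v \<Rightarrow> 'v) \<Rightarrow> bool"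
  where "nofix S V \<rho> \<longleftrightarrow> (\<forall>v\<in>V. (\<forall>g\<in>S. \<rho> g v = v) \<longrightarrow> v = 0)"

lemma nofixD: "nofix S V \<rho> \<Longrightarrow> v \<in> V \<Longrightarrow> (\<And>g. g \<in> S \<Longrightarrow> \<rho> g v = v) \<Longrightarrow> v = 0"
  by (auto simp: nofix_def)

lemma nofix_mono: "nofix S V \<rho> \<Longrightarrow> S \<subseteq> S' \<Longrightarrow> nofix S' V \<rho>"
  by (auto simp: nofix_def)

lemma Hom_from_triv_zero_iff:
  assumes "complex_vector.subspace V" "\<And>g. g \<in> S \<Longrightarrow> clinear_on V V (\<rho> g)"
  shows "Hom_from_triv_zero S V \<rho> \<longleftrightarrow> nofix S V \<rho>"
proof
  assume h: "Hom_from_triv_zero S V \<rho>"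
  show "nofix S V \<rho>"
    unfolding nofix_def
  proof (intro ballI impI)
    fix v assume v: "v \<in> V" "\<forall>g\<in>S. \<rho> g v = v"
    have "(\<lambda>z. z *\<^sub>C v) \<in> Hom_rep S (UNIV::complex set) (\<lambda>_ z. z) V \<rho>"
      unfolding Hom_rep_def
    proof (intro CollectI conjI ballI)
      show "clinear_on UNIV V (\<lambda>z. z *\<^sub>C v)"
        using complex_vector.subspace_scale[OF assms(1) v(1)]
        by (simp add: clinear_on_def scaleC_add_left scaleC_scaleC scaleC_complex_def)
      show "z *\<^sub>C v = \<rho> h (z *\<^sub>C v)" if "h \<in> S" for h z
        using clinear_onD(3)[OF assms(2)[OF that] v(1), of z] v(2) that by simp
    qed
    from spec[OF bspec[OF h[unfolded Hom_from_triv_zero_def] this], of 1]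
    show "v = 0" by (simp add: scaleC_one)
  qed
next
  assume n: "nofix S V \<rho>"
  show "Hom_from_triv_zero S V \<rho>"
    unfolding Hom_from_triv_zero_def
  proof (intro ballI allI)
    fix T z assume "T \<in> Hom_rep S (UNIV::complex set) (\<lambda>_ z. z) V \<rho>"
    then have T: "clinear_on UNIV V T" "\<forall>h\<in>S. \<forall>z\<in>UNIV. T z = \<rho> h (T z)"
      unfolding Hom_rep_def by blast+
    have "T z \<in> V" by (rule clinear_onD(1)[OF T(1) UNIV_I])
    moreover have "\<rho> h (T z) = T z" if "h \<in> S" for h using bspec[OF bspec[OF T(2) that] UNIV_I]
      by (rule sym)
    ultimately show "T z = 0" by (rule nofixD[OF n])
  qed
qed

section \<open>Sums over the additive groups p^e Z_p\<close>

definition addact :: "int \<Rightarrow> 'v::complex_vector set \<Rightarrow> ('p::prime_type padic \<Rightarrow> 'v \<Rightarrow> 'v) \<Rightarrow> bool" where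
  "addact e V A \<longleftrightarrow> complex_vector.subspace V \<and> (\<forall>s\<in>pZp e. clinear_on V V (A s)) \<and>
     (\<forall>s\<in>pZp e. \<forall>t\<in>pZp e. \<forall>v\<in>V. A (s + t) v = A s (A t v))"

text \<open>The sum over representatives of p^e modulo p^(e+k), that is, p^k times the projection to
  the fixed vectors once p^(e+k) acts trivially. Actions are parametrised additively so that upper
  and lower unipotents, and translations by either, are treated alike.\<close>

definition addavg :: "int \<Rightarrow> nat \<Rightarrow> ('p::prime_type padic \<Rightarrow> 'v::complex_vector \<Rightarrow> 'v) \<Rightarrow> 'v \<Rightarrow> 'v" where
  "addavg e k A v = (\<Sum>j<CARD('p) ^ k. A (of_nat j * unif powi e) v)"

lemma periodic_sum:
  fixes F :: "nat \<Rightarrow> 'a::ab_group_add"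
  assumes "\<And>j. F (j + q) = F j" shows "(\<Sum>j<q. F (m + j)) = (\<Sum>j<q. F j)"
proof (induction m)
  case (Suc m)
  have "(\<Sum>j<q. F (Suc m + j)) + F m = (\<Sum>j<Suc q. F (m + j))"
    by (simp add: sum.lessThan_Suc_shift del: sum.lessThan_Suc)
  also have "\<dots> = (\<Sum>j<q. F (m + j)) + F m" using assms[of m] by simp
  finally show ?case using Suc by simp
qed simp

lemma pZp_decomp:
  assumes "(s::'p::prime_type padic) \<in> pZp e"
  obtains m r where "m < CARD('p) ^ k" "r \<in> pZp (e + int k)" "s = of_nat m * unif powi e + r"
proof -
  have "unif powi (- e) * s \<in> Zp" using assms by (simp add: pZp_iff)
  then obtain a where a: "0 \<le> a" "a < int CARD('p) ^ k" "unif powi (- e) * s - of_int a \<in> pZp (int k)"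
    using Zp_residue by blast
  let ?r = "unif powi e * (unif powi (- e) * s - of_int a)"
  have "s = of_int a * unif powi e + ?r"
    by (simp add: right_diff_distrib mult.assoc[symmetric] power_int_add[symmetric])
  moreover have "?r \<in> pZp (e + int k)" using a(3) by (intro pZp_mult) auto
  moreover have "of_int a = (of_nat (nat a) :: 'p padic)" using a(1) by simp
  moreover have "nat a < CARD('p) ^ k" using a by (simp add: nat_less_iff)
  ultimately show thesis using that by metis
qed

text \<open>Acting by m p^e + r shifts the summation index by m: r lies in the subgroup acting
  trivially, which also makes the summands periodic in the index.\<close>

lemma addact_context:
  assumes A: "addact e V (A :: 'p::prime_type padic \<Rightarrow> _)"
    and triv: "\<And>s v. s \<in> pZp (e + int k) \<Longrightarrow> v \<in> V \<Longrightarrow> A s v = v"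
    and v: "v \<in> V"
  shows addavg_in: "addavg e k A v \<in> V"
    and addavg_fixed: "s \<in> pZp e \<Longrightarrow> A s (addavg e k A v) = addavg e k A v"
proof -
  have V: "complex_vector.subspace V" and lin: "\<And>s. s \<in> pZp e \<Longrightarrow> clinear_on V V (A s)"
    and add: "\<And>s t v. s \<in> pZp e \<Longrightarrow> t \<in> pZp e \<Longrightarrow> v \<in> V \<Longrightarrow> A (s + t) v = A s (A t v)"
    using A by (auto simp: addact_def)
  have in_e: "of_nat j * unif powi e \<in> (pZp e :: 'p padic set)" for j by (intro pZp_Zp_mult) auto
  have in_V: "A (of_nat j * unif powi e) v \<in> V" for j using lin[OF in_e] v by (rule clinear_onD(1))
  show "addavg e k A v \<in> V" unfolding addavg_def by (intro complex_vector.subspace_sum[OF V] in_V)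
  assume s: "s \<in> pZp e"
  then obtain m r where mr: "m < CARD('p) ^ k" "r \<in> pZp (e + int k)" "s = of_nat m * unif powi e + r"
    by (rule pZp_decomp)
  have re: "r \<in> pZp e" using pZp_mono[OF mr(2)] by simp
  let ?F = "\<lambda>j. A (of_nat j * unif powi e) v"
  have per: "?F (j + CARD('p) ^ k) = ?F j" for j
  proof -
    have q: "of_nat (CARD('p) ^ k) * unif powi e \<in> (pZp (e + int k) :: 'p padic set)"
      using pZp_mult[OF powi_pZp powi_pZp, of "int k" e] by (simp add: add.commute)
    have "?F (j + CARD('p) ^ k) = A (of_nat j * unif powi e + of_nat (CARD('p) ^ k) * unif powi e) v"
      by (simp add: distrib_right)
    also have "\<dots> = ?F j" using add[OF in_e in_e v] triv[OF q v] by metis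
    finally show ?thesis .
  qed
  have "A s (addavg e k A v) = (\<Sum>j<CARD('p) ^ k. A s (?F j))"
    unfolding addavg_def by (rule clinear_on_sum[OF V lin[OF s]]) (auto intro: in_V)
  also have "\<dots> = (\<Sum>j<CARD('p) ^ k. ?F (m + j))"
  proof (rule sum.cong[OF refl])
    fix j
    have "A s (?F j) = A (s + of_nat j * unif powi e) v" using add[OF s in_e v] by simp
    also have "s + of_nat j * unif powi e = of_nat (m + j) * unif powi e + r"
      by (simp add: mr(3) algebra_simps)
    also have "A \<dots> v = ?F (m + j)" using add[OF in_e re v] triv[OF mr(2) v] by (simp del: of_nat_add)
    finally show "A s (?F j) = ?F (m + j)" .
  qed
  also have "\<dots> = addavg e k A v" unfolding addavg_def by (rule periodic_sum[of ?F, OF per])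
  finally show "A s (addavg e k A v) = addavg e k A v" .
qed

lemma addavg_0:
  assumes "addact e V A"
    "\<And>s v. s \<in> pZp (e + int k) \<Longrightarrow> v \<in> V \<Longrightarrow> A s v = v" "v \<in> V"
    "nofix (pZp e) V A"
  shows "addavg e k A v = 0"
  using nofixD[OF assms(4) addavg_in[OF assms(1-3)]] addavg_fixed[OF assms(1-3)] by blast

lemma p_power_scale_eq_0: "of_nat (CARD('p::prime_type) ^ k) *\<^sub>C (w :: 'v::complex_vector) = 0 \<Longrightarrow> w = 0"
  using p_pos[where 'p='p] by (auto simp: complex_vector.scale_eq_0_iff)

lemma sum_const_scaleC: "(\<Sum>j<n. w) = of_nat n *\<^sub>C (w :: 'v::complex_vector)"
  by (induction n) (simp_all add: scaleC_add_left scaleC_one add.commute)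

text \<open>Absence of fixed vectors passes to subquotients: a fixed w = T u satisfies p^k w = T
  (\<open>addavg e k A u\<close>), and that sum is a fixed vector of V, hence 0.\<close>

lemma addavg_quotient:
  assumes A: "addact e V (A :: 'p::prime_type padic \<Rightarrow> _)"
    and triv: "\<And>s v. s \<in> pZp (e + int k) \<Longrightarrow> v \<in> V \<Longrightarrow> A s v = v"
    and nf: "nofix (pZp e) V A"
      and U: "complex_vector.subspace U" "U \<subseteq> V"
      "\<And>s u. s \<in> pZp e \<Longrightarrow> u \<in> U \<Longrightarrow> A s u \<in> U"
    and T: "clinear_on U W T" "T ` U = W"
      "\<And>s u. s \<in> pZp e \<Longrightarrow> u \<in> U \<Longrightarrow> T (A s u) = B s (T u)"
  shows "nofix (pZp e) W B"
  unfolding nofix_def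
proof (intro ballI impI)
  fix w assume w: "w \<in> W" and fx: "\<forall>s\<in>pZp e. B s w = w"
  obtain u where u: "u \<in> U" "w = T u" using T(2) w by blast
  have in_e: "of_nat j * unif powi e \<in> (pZp e :: 'p padic set)" for j by (intro pZp_Zp_mult) auto
  have "addavg e k A u = 0" using U u by (intro addavg_0[OF A triv _ nf]) auto
  then have "0 = T (addavg e k A u)" using clinear_on_0[OF U(1) T(1)] by simp
  also have "\<dots> = (\<Sum>j<CARD('p) ^ k. T (A (of_nat j * unif powi e) u))"
    unfolding addavg_def by (rule clinear_on_sum[OF U(1) T(1)]) (auto intro: U(3) in_e u)
  also have "\<dots> = (\<Sum>j<CARD('p) ^ k. w)"
    using T(3)[OF in_e u(1)] fx in_e u(2) by simp
  also have "\<dots> = of_nat (CARD('p) ^ k) *\<^sub>C w" by (rule sum_const_scaleC)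
  finally show "w = 0" using p_power_scale_eq_0 by metis
qed

text \<open>The image of an invariant functional is a quotient with trivial action, and the
  statement about subquotients shows that it is 0.\<close>

lemma addact_Hom_to_zero:
  assumes A: "addact e V (A :: 'p::prime_type padic \<Rightarrow> _)"
    and triv: "\<And>s v. s \<in> pZp (e + int k) \<Longrightarrow> v \<in> V \<Longrightarrow> A s v = v"
    and nf: "nofix (pZp e) V A"
      and T: "clinear_on V (UNIV :: complex set) T"
      "\<And>s v. s \<in> pZp e \<Longrightarrow> v \<in> V \<Longrightarrow> T (A s v) = T v"
    and v: "v \<in> V"
  shows "T v = 0"
proof -
  have "nofix (pZp e :: 'p padic set) (T ` V) (\<lambda>_ z. z)"
  proof (rule addavg_quotient[OF A triv nf, where U = V and T = T])
    show "complex_vector.subspace V" using A by (simp add: addact_def)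
    show "clinear_on V (T ` V) T" using T(1) by (auto simp: clinear_on_def)
    show "A s u \<in> V" if "s \<in> pZp e" "u \<in> V" for s u
      using A that clinear_onD(1)[of V V "A s" u] by (simp add: addact_def)
  qed (use T(2) in auto)
  then show ?thesis using v by (auto simp: nofix_def)
qed

lemma rep_addact:
  assumes "representation (GLsub K) V (\<rho> :: 'p::prime_type mat2 \<Rightarrow> _)"
    "\<And>s :: 'p padic. s \<in> pZp e \<Longrightarrow> f s \<in> K" "\<And>s t. f (s + t) = f s ** f t"
  shows "addact e V (\<lambda>s. \<rho> (f s))"
  using assms by (simp add: addact_def rep_GLsub)

lemma nofix_image: "nofix (f ` S) V \<rho> \<longleftrightarrow> nofix S V (\<lambda>s. \<rho> (f s))"
  by (auto simp: nofix_def)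

text \<open>Passes from fixed vectors to invariant functionals, in terms of which strong cuspidality
  and the defect are stated. A larger S is allowed in order to absorb the intersections with
  K^\<delta>.\<close>

lemma Hom_to_triv_zeroI:
  assumes rep: "representation (GLsub K) V (\<rho> :: 'p::prime_type mat2 \<Rightarrow> _)"
    and f: "\<And>s :: 'p padic. s \<in> pZp e \<Longrightarrow> f s \<in> K"
    "\<And>s t. f (s + t) = f s ** f t"
    and triv: "\<And>s v. s \<in> pZp (e + int k) \<Longrightarrow> v \<in> V \<Longrightarrow> \<rho> (f s) v = v"
    and nf: "nofix (f ` pZp e) V \<rho>" and S: "f ` pZp e \<subseteq> S"
  shows "Hom_to_triv_zero S V \<rho>"
  unfolding Hom_to_triv_zero_def
proof (intro ballI)
  fix T v assume T: "T \<in> Hom_rep S V \<rho> (UNIV::complex set) (\<lambda>_ z. z)" and v: "v \<in> V"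
  show "T v = 0"
  proof (rule addact_Hom_to_zero[where A = "\<lambda>s. \<rho> (f s)" and k = k and e = e and V = V])
    show "addact e V (\<lambda>s. \<rho> (f s))" by (rule rep_addact[OF rep f])
    show "nofix (pZp e) V (\<lambda>s. \<rho> (f s))" using nf by (simp only: nofix_image)
    show "clinear_on V (UNIV :: complex set) T" using T by (simp add: Hom_rep_def)
    show "T (\<rho> (f s) v) = T v" if "s \<in> pZp e" "v \<in> V" for s v
    proof -
      have "f s \<in> S" using S that(1) by blast
      then show ?thesis using T that(2) by (simp add: Hom_rep_def)
    qed
  qed (use triv v in auto)
qed

section \<open>Equivariant vectors in compactly induced representations\<close>

lemma cover_simps [simp]:
  "carrier cover = SL2 \<times> {1, - 1}"
  "(g, e) \<otimes>\<^bsub>cover\<^esub> (h, e') = (g ** h, e * e' * cocycle g h)"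
  by (simp_all add: cover_def)

lemma two_unit: "odd CARD('p) \<Longrightarrow> 2 \<in> (Zp_units :: 'p::prime_type padic set)"
proof -
  assume odd: "odd CARD('p)"
  have "\<not> int CARD('p) dvd 2"
  proof
    assume "int CARD('p) dvd 2"
    from zdvd_imp_le[OF this] have "int CARD('p) = 2" using p_gt_1[where 'p='p] by simp
    then show False using odd by simp
  qed
  then have "(of_int 2 :: 'p padic) \<in> Zp_units"
    using of_int_pZp[of 2 1, where 'p='p] Zp_of_int[of 2, where 'a='p] unfolding Zp_units_iff by simp
  then show ?thesis by simp
qed

text \<open>With g the matrix (t, 0; zt, i), the conjugates x(x) y(c) x(-x) and g x(b) g^(-1) both
  fix the line of (x, 1), which is spanned by the first column of g. They therefore agree for a
  suitable multiple b of c.\<close>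

lemma unipotent_transfer:
  fixes x z t i c :: "'a::idom"
  assumes "x * z = 1" "t * i = 1"
  shows "mat2 1 x 0 1 ** mat2 1 0 c 1 ** mat2 1 (- x) 0 1 ** mat2 t 0 (z * t) i
    = mat2 t 0 (z * t) i ** mat2 1 (- (c * i\<^sup>2 * x\<^sup>2)) 0 1"
proof -
  have "(1 + x * c) * t + ((1 + x * c) * - x + x) * (z * t) = t + x * c * t * (1 - x * z)"
    "((1 + x * c) * - x + x) * i = - (x\<^sup>2 * c * i)"
      "t * - (c * i\<^sup>2 * x\<^sup>2) = - (t * i * (x\<^sup>2 * c * i))"
    "c * t + (c * - x + 1) * (z * t) = z * t + c * t * (1 - x * z)"
    "(c * - x + 1) * i = i - c * x * i"
    "z * t * - (c * i\<^sup>2 * x\<^sup>2) + i = i - (x * z) * (t * i) * (c * x * i)"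
    by (simp_all add: power2_eq_square algebra_simps)
  then have "(1 + x * c) * t + ((1 + x * c) * - x + x) * (z * t) = t"
    "((1 + x * c) * - x + x) * i = t * - (c * i\<^sup>2 * x\<^sup>2)"
    "c * t + (c * - x + 1) * (z * t) = z * t" "(c * - x + 1) * i = z * t * - (c * i\<^sup>2 * x\<^sup>2) + i"
    unfolding assms by (simp_all only: mult_1 mult_1_right diff_self mult_zero_right add_0_right)
  then show ?thesis unfolding mat2_mult mat2_inject
    by (simp only: mult_1 mult_1_right mult_zero_left mult_zero_right add_0 add_0_right simp_thms)
qed

lemma genuine_lift_pair: "genuine_lift s \<rho> (k, e) v = of_int (e * s k) *\<^sub>C \<rho> k v"
  by (simp add: genuine_lift_def)

text \<open>The representation of K^\<delta> is kept abstract because constituents, their conjugates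
  by \<alpha> and induced representations all take its place later.\<close>

locale genuine_rep =
  fixes \<delta> :: nat and s :: "'p::prime_type mat2 \<Rightarrow> int" and X :: "'v::complex_vector set"
    and \<rho> :: "'p mat2 \<Rightarrow> 'v \<Rightarrow> 'v"
  assumes odd: "odd CARD('p)" and \<delta>: "\<delta> \<le> 1" and s: "is_splitting \<delta> s"
    and rep: "representation (GLsub (Kd \<delta>)) X \<rho>"
begin

abbreviation "K \<equiv> Kd \<delta>"
abbreviation "\<rho>t \<equiv> genuine_lift s \<rho>"
abbreviation "\<pi> \<equiv> c_Ind cover (full_preimage K) X \<rho>t"

lemmas K = matgroupD[OF matgroup_Kd[OF \<delta>]]
lemmas K_adj = matgroup_adj2[OF matgroup_Kd[OF \<delta>]]
lemmas R = repD[OF rep] repV[OF rep]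

lemma s_sq: "k \<in> K \<Longrightarrow> s k * s k = 1"
  using splittingD(2)[OF s, of k k] by auto

lemma unit_sign: "k \<in> K \<Longrightarrow> k' \<in> K \<Longrightarrow> s (k ** k') = s k * s k' * cocycle k k'"
  by (rule splittingD(1)[OF s])

lemma rho_scale: "k \<in> K \<Longrightarrow> v \<in> X \<Longrightarrow> \<rho> k (c *\<^sub>C v) = c *\<^sub>C \<rho> k v"
  by (rule clinear_onD(3)[OF R(2)])

lemma rho_0: "k \<in> K \<Longrightarrow> \<rho> k 0 = 0"
  using clinear_on_0[OF R(1,2)] .

lemma rho_adj: "k \<in> K \<Longrightarrow> v \<in> X \<Longrightarrow> \<rho> k (\<rho> (adj2 k) v) = v"
  using R(4)[of k "adj2 k" v] K_adj(2)[of k] R(3)[of v] K(4)[of k] by simp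

lemma pi_left:
  assumes "f \<in> \<pi>" "k \<in> K" "e = 1 \<or> e = - 1" "g \<in> SL2"
    "\<epsilon> = 1 \<or> \<epsilon> = - 1"
  shows "f (k ** g, e * \<epsilon> * cocycle k g) = of_int (e * s k) *\<^sub>C \<rho> k (f (g, \<epsilon>))"
proof -
  have *: "\<forall>h\<in>full_preimage K. \<forall>x\<in>carrier cover. f (h \<otimes>\<^bsub>cover\<^esub> x) = \<rho>t h (f x)"
    using assms(1) by (simp add: c_Ind_def Ind_def)
  have "f ((k, e) \<otimes>\<^bsub>cover\<^esub> (g, \<epsilon>)) = \<rho>t (k, e) (f (g, \<epsilon>))"
  proof -
    have "(k, e) \<in> full_preimage K" "(g, \<epsilon>) \<in> carrier cover" using assms(2-5)
      by (auto simp: full_preimage_def)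
    then show ?thesis using * by blast
  qed
  then show ?thesis by (simp add: genuine_lift_def)
qed

lemma pi_in: "f \<in> \<pi> \<Longrightarrow> g \<in> SL2 \<Longrightarrow> \<epsilon> = 1 \<or> \<epsilon> = - 1 \<Longrightarrow> f (g, \<epsilon>) \<in> X"
  by (auto simp: c_Ind_def Ind_def)

lemma pi_out: "f \<in> \<pi> \<Longrightarrow> \<not> (g \<in> SL2 \<and> (\<epsilon> = 1 \<or> \<epsilon> = - 1)) \<Longrightarrow> f (g, \<epsilon>) = 0"
  by (simp add: c_Ind_def Ind_def)

section \<open>Vectors supported on a single coset of the maximal compact subgroup\<close>

context
  fixes m :: nat and t :: "'p padic" and h :: "'p mat2" and v :: 'v
  assumes t: "t = unif ^ m" and h: "h = hm t" and v: "v \<in> X"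
begin

lemma t_nz: "t \<noteq> 0" using t by simp

lemma h_inv: "g ** hm (inverse t) ** h = g" "g ** h ** hm (inverse t) = g"
proof -
  have "hm (inverse t) ** h = mat 1" "h ** hm (inverse t) = mat 1"
    using t_nz by (simp_all add: h hm_def mat_1_mat2)
  then show "g ** hm (inverse t) ** h = g" "g ** h ** hm (inverse t) = g"
    by (simp_all add: matrix_mul_assoc[symmetric])
qed

lemma h_SL2: "h \<in> SL2" using t_nz by (simp add: h)

lemma f_vec_eq: "f_vec m K \<rho>t v (g, \<epsilon>) = (if g ** hm (inverse t) \<in> K \<and> (\<epsilon> = 1 \<or> \<epsilon> = - 1)
    then of_int (cocycle (g ** hm (inverse t)) h * \<epsilon> * s (g ** hm (inverse t))) *\<^sub>C \<rho> (g ** hm (inverse t)) v else 0)"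
  using t_nz
    by (simp add: f_vec_def Let_def t[symmetric] h[symmetric] genuine_lift_def scaleC_scaleC) (simp add: h)

lemma f_vec_K: "k \<in> K \<Longrightarrow> \<epsilon> = 1 \<or> \<epsilon> = - 1 \<Longrightarrow>
    f_vec m K \<rho>t v (k ** h, \<epsilon>) = of_int (cocycle k h * \<epsilon> * s k) *\<^sub>C \<rho> k v"
  by (simp only: f_vec_eq h_inv) simp

lemma f_vec_out: "g ** hm (inverse t) \<notin> K \<Longrightarrow> f_vec m K \<rho>t v (g, \<epsilon>) = 0"
  by (simp add: f_vec_eq)

lemma f_vec_nz: "v \<noteq> 0 \<Longrightarrow> f_vec m K \<rho>t v \<noteq> 0"
proof
  assume "v \<noteq> 0" and 0: "f_vec m K \<rho>t v = 0"
  have "f_vec m K \<rho>t v (mat 1 ** h, 1) = v"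
    using splitting_1[OF s] h_SL2 R(3)[OF v] by (subst f_vec_K[OF K(2)]) (simp_all add: scaleC_one)
  then show False using 0 \<open>v \<noteq> 0\<close> by simp
qed

lemma f_vec_pi: "f_vec m K \<rho>t v \<in> \<pi>"
proof -
  let ?F = "f_vec m K \<rho>t v"
  have 1: "?F (g, \<epsilon>) \<in> X" for g \<epsilon>
    unfolding f_vec_eq using complex_vector.subspace_scale[OF R(1)] complex_vector.subspace_0[OF R(1)] R(5) v
      by simp
  have 2: "?F (g, \<epsilon>) = 0" if "\<not> (g \<in> SL2 \<and> (\<epsilon> = 1 \<or> \<epsilon> = - 1))"
    for g \<epsilon>
  proof -
    have "g \<in> SL2" if "g ** hm (inverse t) \<in> K"
      using SL2_mult[OF K(1)[OF that] h_SL2] by (simp add: h_inv)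
    then show ?thesis unfolding f_vec_eq using that by auto
  qed
  have 3: "?F (k' ** g, e * \<epsilon> * cocycle k' g) = of_int (e * s k') *\<^sub>C \<rho> k' (?F (g, \<epsilon>))"
    if k': "k' \<in> K" and e: "e = 1 \<or> e = - 1" and \<epsilon>: "\<epsilon> = 1 \<or> \<epsilon> = - 1"
      for k' g e \<epsilon>
  proof (cases "g ** hm (inverse t) \<in> K")
    case True
    define k where "k = g ** hm (inverse t)"
    then have k: "k \<in> K" "g = k ** h" using True by (simp_all add: h_inv)
    have sg: "e * \<epsilon> * cocycle k' g = 1 \<or> e * \<epsilon> * cocycle k' g = - 1"
      using e \<epsilon> cocycle_pm[of k' g] by auto
    \<comment> \<open>This instance of the cocycle identity gives left equivariance; the other signs
      match because s splits the cover over K.\<close>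
    have c: "cocycle k' k * cocycle (k' ** k) h = cocycle k' (k ** h) * cocycle k h"
      unfolding h by (rule cocycle_torus_third[OF odd K(1)[OF k'] K(1)[OF k(1)] t_nz])
    have "?F (k' ** g, e * \<epsilon> * cocycle k' g) = of_int (cocycle (k' ** k) h * (e * \<epsilon> * cocycle k' g) * s (k' ** k)) *\<^sub>C \<rho> (k' ** k) v"
      using f_vec_K[OF K(3)[OF k' k(1)] sg] by (simp add: k(2) matrix_mul_assoc)
    also have "cocycle (k' ** k) h * (e * \<epsilon> * cocycle k' g) * s (k' ** k) = e * s k' * (cocycle k h * \<epsilon> * s k)"
    proof -
      have "cocycle (k' ** k) h * (e * \<epsilon> * cocycle k' g) * s (k' ** k)
        = (cocycle k' k * cocycle (k' ** k) h) * cocycle k' g * e * \<epsilon> * s k' * s k"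
        by (simp add: unit_sign[OF k' k(1)] ac_simps)
      also have "\<dots> = e * s k' * (cocycle k h * \<epsilon> * s k)"
        unfolding c k(2) by (simp add: ac_simps)
      finally show ?thesis .
    qed
    also have "of_int \<dots> *\<^sub>C \<rho> (k' ** k) v = of_int (e * s k') *\<^sub>C \<rho> k' (?F (g, \<epsilon>))"
      using R(4)[OF k' k(1) v] rho_scale[OF k' R(5)[OF k(1) v]] f_vec_K[OF k(1) \<epsilon>]
      by (simp add: k(2) scaleC_scaleC)
    finally show ?thesis .
  next
    case False
    have "k' ** g ** hm (inverse t) \<notin> K"
    proof
      assume "k' ** g ** hm (inverse t) \<in> K"
      from K(3)[OF K(4)[OF k'] this] have "(adj2 k' ** k') ** (g ** hm (inverse t)) \<in> K"
        by (simp add: matrix_mul_assoc)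
      then show False using False K_adj(1)[OF k'] by simp
    qed
    then show ?thesis using False rho_0[OF k'] by (simp add: f_vec_out)
  qed
  have 4: "{x. ?F x \<noteq> 0} \<subseteq> full_preimage K <#>\<^bsub>cover\<^esub> {(h, 1)}"
  proof (rule subsetI)
    fix x assume "x \<in> {x. ?F x \<noteq> 0}"
    then obtain g \<epsilon> where x: "x = (g, \<epsilon>)" "?F (g, \<epsilon>) \<noteq> 0" by (cases x) auto
    let ?k = "g ** hm (inverse t)"
    have k: "?k \<in> K" "\<epsilon> = 1 \<or> \<epsilon> = - 1" using x(2) unfolding f_vec_eq
      by (auto split: if_splits)
    have "(?k, \<epsilon> * cocycle ?k h) \<in> full_preimage K"
      using k cocycle_pm[of ?k h] by (auto simp: full_preimage_def)
    moreover have "x = (?k, \<epsilon> * cocycle ?k h) \<otimes>\<^bsub>cover\<^esub> (h, 1)"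
      by (simp add: x(1) h_inv mult.assoc)
    ultimately show "x \<in> full_preimage K <#>\<^bsub>cover\<^esub> {(h, 1)}" unfolding set_mult_def
      by blast
  qed
  have 5: "?F (x \<otimes>\<^bsub>cover\<^esub> y) = \<rho>t x (?F y)"
    if "x \<in> full_preimage K" "y \<in> carrier cover" for x y
    using that 3[of "fst x" "snd x" "snd y" "fst y"]
    by (cases x; cases y) (simp add: full_preimage_def genuine_lift_pair)
  show ?thesis
    unfolding c_Ind_def Ind_def
  proof (intro CollectI conjI exI[of _ "{(h, 1)}"] ballI allI impI)
    show "?F x \<in> X" for x using 1 by (cases x) simp
    show "?F x = 0" if "x \<notin> carrier cover" for x using 2 that by (cases x) auto
  qed (use 4 5 h_SL2 in auto)
qed

text \<open>Equivariance is assumed for the single vector v, under the conjugates by h of elements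
  of K_r. It spreads to the whole coset K h because the cocycle signs cancel.\<close>

lemma f_vec_eta_space:
  assumes eq: "\<And>a b c d. mat2 a b c d \<in> Kr r \<Longrightarrow>
      mat2 a (t\<^sup>2 * b) (c * (inverse t)\<^sup>2) d \<in> K \<and>
      of_int (s (mat2 a (t\<^sup>2 * b) (c * (inverse t)\<^sup>2) d)) *\<^sub>C \<rho> (mat2 a (t\<^sup>2 * b) (c * (inverse t)\<^sup>2) d) v = \<eta> d *\<^sub>C v"
  shows "f_vec m K \<rho>t v \<in> eta_space \<pi> \<eta> r"
  unfolding eta_space_def
proof (intro CollectI conjI ballI f_vec_pi)
  let ?F = "f_vec m K \<rho>t v"
  fix x assume "x \<in> full_preimage (Kr r :: 'p mat2 set)"
  then obtain k0 e where x: "x = (k0, e)" "k0 \<in> Kr r" "e = 1 \<or> e = - 1"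
    by (auto simp: full_preimage_def)
  obtain a b c d where k0: "k0 = mat2 a b c d" by (rule mat2_cases)
  define k'' where "k'' = mat2 a (t\<^sup>2 * b) (c * (inverse t)\<^sup>2) d"
  have k0S: "k0 \<in> SL2" using x(2) by (simp add: k0 Kr_mat2)
  have k'': "k'' \<in> K" "of_int (s k'') *\<^sub>C \<rho> k'' v = \<eta> d *\<^sub>C v"
    using eq[of a b c d] x(2) by (simp_all add: k0 k''_def)
  have rk: "\<rho> k'' v = (of_int (s k'') * \<eta> d) *\<^sub>C v"
  proof -
    have "\<rho> k'' v = (of_int (s k'' * s k'')) *\<^sub>C \<rho> k'' v"
      by (simp only: s_sq[OF k''(1)]) (simp add: scaleC_one)
    then show ?thesis using k''(2) by (metis of_int_mult scaleC_scaleC)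
  qed
  have hk: "k'' ** h = h ** k0" using t_nz by (simp add: k''_def k0 h hm_def power2_eq_square field_simps)
  have cj: "cocycle h k0 * cocycle k'' h = 1"
    unfolding h k0 k''_def by (rule cocycle_torus_conj[OF odd k0S[unfolded k0] t_nz])
  show "right_transl cover x ?F = eta_cover \<eta> x *\<^sub>C ?F"
  proof (rule ext)
    fix y :: "'p mat2 \<times> int" obtain g \<epsilon> where y: "y = (g, \<epsilon>)" by (cases y)
    show "right_transl cover x ?F y = (eta_cover \<eta> x *\<^sub>C ?F) y"
    proof (cases "g \<in> SL2 \<and> (\<epsilon> = 1 \<or> \<epsilon> = - 1)")
      case False
      then show ?thesis using pi_out[OF f_vec_pi False] by (auto simp: right_transl_def y scaleC_fun_def)
    next
      case in_cover: True
      have L: "right_transl cover x ?F y = ?F (g ** k0, \<epsilon> * e * cocycle g k0)"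
        using in_cover by (simp add: right_transl_def x(1) y)
      have Rt: "(eta_cover \<eta> x *\<^sub>C ?F) y = (of_int e * \<eta> d) *\<^sub>C ?F (g, \<epsilon>)"
        by (simp add: scaleC_fun_def eta_cover_def x(1) k0 y)
      show ?thesis
      proof (cases "g ** hm (inverse t) \<in> K")
        case True
        define k where "k = g ** hm (inverse t)"
        then have k: "k \<in> K" "g = k ** h" using True by (simp_all add: h_inv)
        have gk: "g ** k0 = (k ** k'') ** h" by (simp add: k(2) matrix_mul_assoc[symmetric] hk)
        have sg: "\<epsilon> * e * cocycle g k0 = 1 \<or> \<epsilon> * e * cocycle g k0 = - 1"
          using in_cover x(3) cocycle_pm[of g k0] by auto
        have c1: "cocycle k k'' * cocycle (k ** k'') h = cocycle k (h ** k0) * cocycle k'' h"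
          unfolding hk[symmetric] unfolding h
            by (rule cocycle_torus_third[OF odd K(1)[OF k(1)] K(1)[OF k''(1)] t_nz])
        have c2: "cocycle k h * cocycle g k0 = cocycle k (h ** k0) * cocycle h k0"
          unfolding k(2) unfolding h by (rule cocycle_torus_second[OF odd K(1)[OF k(1)] k0S t_nz])
        \<comment> \<open>Since k'' h = h k0, the factor c(k, h k0) is common to both identities and
          cancels; the two remaining cocycles multiply to 1 by \<open>cj\<close>.\<close>
        have c3: "cocycle k k'' * cocycle (k ** k'') h * cocycle g k0 = cocycle k h"
        proof -
          have "cocycle k k'' * cocycle (k ** k'') h * cocycle g k0
            = cocycle k k'' * cocycle (k ** k'') h * (cocycle k h * (cocycle k h * cocycle g k0))" by simp
          also have "\<dots> = cocycle k h * (cocycle h k0 * cocycle k'' h)" unfolding c1 c2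
            by (simp add: ac_simps)
          finally show ?thesis by (simp add: cj)
        qed
        have "?F (g ** k0, \<epsilon> * e * cocycle g k0)
          = of_int (cocycle (k ** k'') h * (\<epsilon> * e * cocycle g k0) * s (k ** k'')) *\<^sub>C \<rho> (k ** k'') v"
          unfolding gk by (rule f_vec_K[OF K(3)[OF k(1) k''(1)] sg])
        also have "\<rho> (k ** k'') v = (of_int (s k'') * \<eta> d) *\<^sub>C \<rho> k v"
          using R(4)[OF k(1) k''(1) v] rho_scale[OF k(1) v] by (simp add: rk)
        also have "cocycle (k ** k'') h * (\<epsilon> * e * cocycle g k0) * s (k ** k'')
           = (cocycle k k'' * cocycle (k ** k'') h * cocycle g k0) * \<epsilon> * e * s k * s k''"
          by (simp add: unit_sign[OF k(1) k''(1)] ac_simps)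
        also have "\<dots> = cocycle k h * \<epsilon> * e * s k * s k''" unfolding c3 ..
        also have "of_int \<dots> *\<^sub>C (of_int (s k'') * \<eta> d) *\<^sub>C \<rho> k v
          = (of_int (cocycle k h * \<epsilon> * e * s k * (s k'' * s k'')) * \<eta> d) *\<^sub>C \<rho> k v"
          by (simp add: scaleC_scaleC ac_simps)
        also have "\<dots> = (of_int e * \<eta> d) *\<^sub>C ?F (g, \<epsilon>)"
          using f_vec_K[OF k(1), of \<epsilon>] in_cover unfolding s_sq[OF k''(1)]
            by (simp add: k(2) scaleC_scaleC ac_simps)
        finally show ?thesis unfolding L Rt .
      next
        case False
        have "g ** k0 ** hm (inverse t) \<notin> K"
        proof
          assume *: "g ** k0 ** hm (inverse t) \<in> K"
          have "k0 ** hm (inverse t) = hm (inverse t) ** (h ** k0) ** hm (inverse t)"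
            using t_nz by (simp add: k0 h hm_def)
          also have "\<dots> = hm (inverse t) ** k''" unfolding hk[symmetric]
            by (simp add: matrix_mul_assoc h_inv)
          finally have "g ** hm (inverse t) ** k'' \<in> K" using * by (simp add: matrix_mul_assoc[symmetric])
          from K(3)[OF this K(4)[OF k''(1)]] have "g ** hm (inverse t) ** (k'' ** adj2 k'') \<in> K"
            by (simp add: matrix_mul_assoc)
          then show False using False K_adj(2)[OF k''(1)] by simp
        qed
        then show ?thesis unfolding L Rt using False by (simp add: f_vec_out)
      qed
    qed
  qed
qed

end

text \<open>A lift of a unipotent element of the level group acts by a sign, which is trivial on squares.\<close>

lemma eta_unipotent_fixed:
  assumes f: "f \<in> eta_space \<pi> \<eta> r" and \<eta>: "\<eta> 1 = 1" and g: "g \<in> SL2"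
    and u: "u \<in> Kr r" "u $ 2 $ 2 = 1" and k: "k \<in> K" and ku: "k ** g = g ** u"
  shows "\<rho> (k ** k) (f (g, 1)) = f (g, 1)"
proof -
  have fpi: "f \<in> \<pi>" using f by (simp add: eta_space_def)
  have "(u, 1) \<in> full_preimage (Kr r)" using u by (simp add: full_preimage_def)
  then have "right_transl cover (u, 1) f = eta_cover \<eta> (u, 1) *\<^sub>C f" using f
    by (simp add: eta_space_def)
  then have "right_transl cover (u, 1) f (g, 1) = (eta_cover \<eta> (u, 1) *\<^sub>C f) (g, 1)" by simp
  then have 1: "f (g ** u, cocycle g u) = f (g, 1)"
    using g u(2) \<eta> by (simp add: right_transl_def scaleC_fun_def eta_cover_def scaleC_one)
  \<comment> \<open>The sign for which the lift (k, ?e) moves (g, 1) to the same point of the cover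
    as right multiplication by (u, 1).\<close>
  let ?e = "cocycle k g * cocycle g u"
  have e: "?e = 1 \<or> ?e = - 1" using cocycle_pm[of k g] cocycle_pm[of g u] by auto
  have e1: "?e * 1 * cocycle k g = cocycle g u" by (simp add: ac_simps)
  have "f (k ** g, ?e * 1 * cocycle k g) = of_int (?e * s k) *\<^sub>C \<rho> k (f (g, 1))"
    by (rule pi_left[OF fpi k e g]) simp
  then have 2: "f (g, 1) = of_int (?e * s k) *\<^sub>C \<rho> k (f (g, 1))" unfolding e1 ku 1 .
  have v: "f (g, 1) \<in> X" using pi_in[OF fpi g] by simp
  have ss: "?e * s k * (?e * s k) = 1" using e s_sq[OF k] by auto
  have 3: "\<rho> k (f (g, 1)) = of_int (?e * s k) *\<^sub>C f (g, 1)"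
  proof -
    have "of_int (?e * s k) *\<^sub>C f (g, 1) = of_int (?e * s k) *\<^sub>C of_int (?e * s k) *\<^sub>C \<rho> k (f (g, 1))"
      using 2 by metis
    also have "\<dots> = of_int (?e * s k * (?e * s k)) *\<^sub>C \<rho> k (f (g, 1))"
      by (simp only: scaleC_scaleC of_int_mult)
    finally show ?thesis unfolding ss by (simp add: scaleC_one)
  qed
  have "\<rho> (k ** k) (f (g, 1)) = \<rho> k (of_int (?e * s k) *\<^sub>C f (g, 1))"
    using R(4)[OF k k v] 3 by simp
  also have "\<dots> = of_int (?e * s k) *\<^sub>C \<rho> k (f (g, 1))" by (rule rho_scale[OF k v])
  finally show ?thesis using 2 by simp
qed

text \<open>Put z' = z p^(-2n), so that h(p^n) y(z) = y(z') h(p^n). If y(z') lies in K, only the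
  value at h(p^n) matters, and H1 excludes it. Otherwise the value at h(p^n) y(z) is fixed by
  Nbar_(r-2n), and its translate by x(-1/z') is fixed by Nbar_(2n+2\<delta>-2), both within K; H2
  excludes one of the two.\<close>

lemma eta_space_vanish:
  assumes f: "f \<in> eta_space \<pi> \<eta> r" and \<eta>: "\<eta> 1 = 1"
    and H1: "\<And>n. nofix ((N_grp (2 * n) \<union> Nbar_grp (int r - 2 * n)) \<inter> K) X \<rho>"
    and H2: "\<And>n. nofix (Nbar_grp (int r - 2 * n) \<inter> K) X \<rho> \<or> nofix (Nbar_grp (2 * n + 2 * int \<delta> - 2) \<inter> K) X \<rho>"
  shows "f = 0"
proof -
  have fpi: "f \<in> \<pi>" using f by (simp add: eta_space_def)
  have left0: "f (k ** g, \<epsilon>) = 0" if k: "k \<in> K" and g: "g \<in> SL2"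
    and \<epsilon>: "\<epsilon> = 1 \<or> \<epsilon> = - 1" and 0: "f (g, 1) = 0" for k g \<epsilon>
  proof -
    let ?e = "\<epsilon> * cocycle k g"
    have "?e = 1 \<or> ?e = - 1" using \<epsilon> cocycle_pm[of k g] by auto
    from pi_left[OF fpi k this g, of 1] show ?thesis using rho_0[OF k] 0 by (simp add: mult.assoc)
  qed
  \<comment> \<open>Because 2 is a unit, halving the parameter exhibits every unipotent as the
    square of one in the same group.\<close>
  have half: "x * inverse 2 \<in> pZp e" if "x \<in> pZp e" for x :: "'p padic" and e
    using that Zp_units_Zp[OF Zp_units_inverse[OF two_unit[OF odd]]] by (rule pZp_mult_Zp)
  have half2: "x / 2 \<in> pZp e" if "x \<in> pZp e" for x :: "'p padic" and e
    using half[OF that] by (simp only: divide_inverse)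
  have two: "x * inverse 2 + x * inverse 2 = x" for x :: "'p padic"
  proof -
    have "x * inverse 2 + x * inverse 2 = x * (2 * inverse 2)"
      by (simp only: mult_2 distrib_right distrib_left mult_1 mult.assoc)
    then show ?thesis unfolding right_inverse[OF Zp_units_nz[OF two_unit[OF odd]]] mult_1_right .
  qed
  have base: "f (hm (unif powi n) ** ym z, 1) = 0" for n z
  proof -
    define t where "t = (unif powi n :: 'p padic)"
    have t: "t \<noteq> 0" by (simp add: t_def power_int_eq_0_iff)
    have t2: "t\<^sup>2 \<in> pZp (2 * n)" "(inverse t)\<^sup>2 \<in> pZp (- 2 * n)"
      using pZp_mult[OF powi_pZp[of n] powi_pZp[of n]] pZp_mult[OF powi_pZp[of "- n"] powi_pZp[of "- n"]]
      by (simp_all add: t_def power2_eq_square power_int_minus)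
    define z' where "z' = z * (inverse t)\<^sup>2"
    have z: "z = z' * t\<^sup>2" using t by (simp add: z'_def power2_eq_square field_simps)
    have conv: "hm t ** ym z = ym z' ** hm t"
      using t by (simp add: hm_def ym_def z power2_eq_square)
    have S: "hm t \<in> SL2" "hm t ** ym z \<in> SL2" using t by (auto intro: SL2_mult)
    \<comment> \<open>Moving y(c) to the right across h(t) y(y) turns it into y(c t^2), which lies
      in K_r when c is in p^(r-2n).\<close>
    have lower: "\<rho> (ym c) (f (hm t ** ym y, 1)) = f (hm t ** ym y, 1)"
      if c: "c \<in> pZp (int r - 2 * n)" "ym c \<in> K" for c y
    proof -
      have "ym (c * inverse 2) \<in> K" using c(2)
        by (auto simp: ym_def Kd_mat2[OF \<delta>] intro: half half2)
      moreover have "ym (c * inverse 2 * t\<^sup>2) \<in> Kr r"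
        using pZp_mult[OF half[OF c(1)] t2(1)] by (simp add: ym_def Kr_mat2)
      moreover have "ym (c * inverse 2) ** (hm t ** ym y) = (hm t ** ym y) ** ym (c * inverse 2 * t\<^sup>2)"
        using t by (simp add: ym_def hm_def power2_eq_square algebra_simps)
      ultimately have "\<rho> (ym (c * inverse 2) ** ym (c * inverse 2)) (f (hm t ** ym y, 1)) = f (hm t ** ym y, 1)"
        using t by (intro eta_unipotent_fixed[OF f \<eta>]) (auto simp: SL2_mult ym_def)
      then show ?thesis unfolding ym_add[symmetric] two .
    qed
    have "f (hm t ** ym z, 1) = 0"
    proof (cases "z' \<in> pZp (int \<delta>)")
      case True
      have "f (hm t, 1) = 0"
      proof (rule nofixD[OF H1[of n]])
        show "f (hm t, 1) \<in> X" using pi_in[OF fpi S(1)] by simp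
        fix g :: "'p mat2" assume g: "g \<in> (N_grp (2 * n) \<union> Nbar_grp (int r - 2 * n)) \<inter> K"
        show "\<rho> g (f (hm t, 1)) = f (hm t, 1)"
        proof (cases "g \<in> N_grp (2 * n)")
          case True
          then obtain b where b: "g = xm b" "b \<in> pZp (2 * n)" by (auto simp: N_grp_def)
          have "xm (b * inverse 2) \<in> K" using g
            by (auto simp: b xm_def Kd_mat2[OF \<delta>] intro: half half2)
          moreover have "xm (b * inverse 2 * (inverse t)\<^sup>2) \<in> Kr r"
            using pZp_mult[OF half[OF b(2)] t2(2)] by (simp add: xm_def Kr_mat2)
          moreover have "xm (b * inverse 2) ** hm t = hm t ** xm (b * inverse 2 * (inverse t)\<^sup>2)"
            using t by (simp add: xm_def hm_def power2_eq_square)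
          ultimately have "\<rho> (xm (b * inverse 2) ** xm (b * inverse 2)) (f (hm t, 1)) = f (hm t, 1)"
            using t by (intro eta_unipotent_fixed[OF f \<eta>]) (auto simp: xm_def)
          then show ?thesis unfolding xm_add[symmetric] two b(1) .
        next
          case False
          then obtain c where "g = ym c" "c \<in> pZp (int r - 2 * n)" using g by (auto simp: Nbar_grp_def)
          moreover have "hm t ** ym 0 = hm t" by (simp add: hm_def ym_def)
          ultimately show ?thesis using lower[of c 0] g by simp
        qed
      qed
      moreover have "ym z' \<in> K" using True by (simp add: ym_def Kd_mat2[OF \<delta>])
      ultimately show ?thesis unfolding conv using left0 S by simp
    next
      case z': False
      let ?v = "f (hm t ** ym z, 1)"
      have vX: "?v \<in> X" using pi_in[OF fpi S(2)] by simp
      from H2[of n] show ?thesis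
      proof
        assume nf: "nofix (Nbar_grp (int r - 2 * n) \<inter> K) X \<rho>"
        show ?thesis by (rule nofixD[OF nf vX]) (auto simp: Nbar_grp_def intro: lower)
      next
        assume nf: "nofix (Nbar_grp (2 * n + 2 * int \<delta> - 2) \<inter> K) X \<rho>"
        \<comment> \<open>As z' is outside p^\<delta> Z_p, x lies in p^(1-\<delta>) and x(x) in K.
          The exponent 2n + 2\<delta> - 2 for c is the one that makes c t^(-2) x^2 integral.\<close>
        define x where "x = inverse z'"
        have x: "x \<in> pZp (1 - int \<delta>)" "z' \<noteq> 0" using nonintegral_inverse[OF z']
          by (auto simp: x_def)
        have xK: "xm x \<in> K" "xm (- x) \<in> K"
          using pZp_mono[OF x(1), of "- int \<delta>"] by (auto simp: xm_def Kd_mat2[OF \<delta>])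
        have adj: "adj2 (xm x) = xm (- x)" by (simp add: xm_def)
        have "\<rho> (xm (- x)) ?v = 0"
        proof (rule nofixD[OF nf R(5)[OF xK(2) vX]])
          fix g :: "'p mat2" assume g: "g \<in> Nbar_grp (2 * n + 2 * int \<delta> - 2) \<inter> K"
          then obtain c where c: "g = ym c" "c \<in> pZp (2 * n + 2 * int \<delta> - 2)"
            by (auto simp: Nbar_grp_def)
          let ?c = "c * inverse 2"
          let ?b = "- (?c * (inverse t)\<^sup>2 * x\<^sup>2)"
          have cK: "ym ?c \<in> K" using g by (auto simp: c ym_def Kd_mat2[OF \<delta>] intro: half half2)
          let ?k = "xm x ** ym ?c ** xm (- x)"
          have kK: "?k \<in> K" by (intro K(3) xK cK)
          have "?c * (inverse t)\<^sup>2 * x\<^sup>2 \<in> pZp (2 * n + 2 * int \<delta> - 2 + (- 2 * n) + ((1 - int \<delta>) + (1 - int \<delta>)))"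
            unfolding power2_eq_square[of x] by (intro pZp_mult half c t2 x)
          then have "xm ?b \<in> Kr r" by (simp add: xm_def Kr_mat2 Zp_uminus)
          moreover have "?k ** (hm t ** ym z) = (hm t ** ym z) ** xm ?b"
          proof -
            have g0: "hm t ** ym z = mat2 t 0 (z' * t) (inverse t)"
              unfolding conv using t by (simp add: ym_def hm_def)
            have "x * z' = 1" "t * inverse t = 1" using x(2) t by (simp_all add: x_def)
            from unipotent_transfer[OF this] show ?thesis unfolding g0 unfolding xm_def ym_def .
          qed
          ultimately have "\<rho> (?k ** ?k) ?v = ?v"
            using kK by (intro eta_unipotent_fixed[OF f \<eta> S(2)]) (auto simp: xm_def)
          moreover have "?k ** ?k = xm x ** ym c ** xm (- x)"
          proof -
            have "xm (- x) ** xm x = mat 1" by (simp add: xm_def mat_1_mat2)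
            moreover have "?k ** ?k = xm x ** ym ?c ** (xm (- x) ** xm x) ** ym ?c ** xm (- x)"
              by (simp only: matrix_mul_assoc)
            ultimately have "?k ** ?k = xm x ** (ym ?c ** ym ?c) ** xm (- x)"
              by (simp only: matrix_mul_rid matrix_mul_assoc)
            then show ?thesis unfolding ym_add[symmetric] two .
          qed
          ultimately have "\<rho> (xm x ** ym c ** xm (- x)) ?v = ?v" by simp
          then have "\<rho> (xm (- x)) (\<rho> (xm x) (\<rho> (ym c) (\<rho> (xm (- x)) ?v))) = \<rho> (xm (- x)) ?v"
            using g xK vX by (simp add: R(4) R(5) K(3) c(1))
          moreover have "\<rho> (xm (- x)) (\<rho> (xm x) w) = w" if "w \<in> X" for w
            using rho_adj[OF xK(2) that] by (simp add: xm_def)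
          ultimately show "\<rho> g (\<rho> (xm (- x)) ?v) = \<rho> (xm (- x)) ?v"
            using g xK vX by (simp add: R(5) c(1))
        qed
        then have "\<rho> (xm x) (\<rho> (adj2 (xm x)) ?v) = 0" using rho_0[OF xK(1)] by (simp add: adj)
        then show ?thesis using rho_adj[OF xK(1) vX] by simp
      qed
    qed
    then show ?thesis by (simp add: t_def)
  qed
  show "f = 0"
  proof (rule ext)
    fix y :: "'p mat2 \<times> int" obtain g \<epsilon> where y: "y = (g, \<epsilon>)" by (cases y)
    show "f y = 0 y"
    proof (cases "g \<in> SL2 \<and> (\<epsilon> = 1 \<or> \<epsilon> = - 1)")
      case True
      then obtain k n z where k: "k \<in> K" "g = k ** (hm (unif powi n) ** ym z)" using Iwasawa[OF \<delta>]
        by blast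
      have "hm (unif powi n) ** ym z \<in> SL2" by (intro SL2_mult) (auto simp: power_int_eq_0_iff)
      then show ?thesis using left0[OF k(1) _ _ base, of n z \<epsilon>] True by (simp add: y k(2))
    next
      case False
      then show ?thesis using pi_out[OF fpi False] by (simp add: y)
    qed
  qed
qed

lemma eta_space_antimono: "r \<le> r' \<Longrightarrow> eta_space \<pi> \<eta> r \<subseteq> eta_space \<pi> \<eta> r'"
proof -
  assume r: "r \<le> r'"
  have "Kr r' \<subseteq> (Kr r :: 'p mat2 set)" using r by (auto simp: Kr_def intro: pZp_mono)
  then show ?thesis by (auto simp: eta_space_def full_preimage_def)
qed

text \<open>The spaces grow with the level, so vanishing at N - 1 excludes all smaller levels at
  once.\<close>

lemma newvector_level:
  assumes mem: "\<And>w. w \<in> Y \<Longrightarrow> F w \<in> eta_space \<pi> \<eta> N"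
    and nz: "\<And>w. w \<in> Y \<Longrightarrow> w \<noteq> 0 \<Longrightarrow> F w \<noteq> 0"
    and ex: "\<exists>w\<in>Y. w \<noteq> 0" and N: "N \<ge> 1" "char_conductor \<eta> \<le> N"
    and van: "\<And>f. f \<in> eta_space \<pi> \<eta> (N - 1) \<Longrightarrow> f = 0"
  shows "has_eta_conductor \<pi> \<eta> N"
    "\<And>w. w \<in> Y \<Longrightarrow> w \<noteq> 0 \<Longrightarrow> is_newvector \<pi> \<eta> (F w)"
proof -
  have adm: "eta_admissible \<pi> \<eta> N" using mem nz ex N(2) unfolding eta_admissible_def by blast
  have "N \<le> r" if "eta_admissible \<pi> \<eta> r" for r
  proof (rule ccontr)
    assume "\<not> N \<le> r"
    then have "r \<le> N - 1" by simp
    then show False using that van eta_space_antimono[of r "N - 1" \<eta>] unfolding eta_admissible_def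
      by blast
  qed
  then have c: "eta_conductor \<pi> \<eta> = N" unfolding eta_conductor_def using adm
    by (intro Least_equality)
  show "has_eta_conductor \<pi> \<eta> N" using adm c unfolding has_eta_conductor_def by blast
  show "is_newvector \<pi> \<eta> (F w)" if "w \<in> Y" "w \<noteq> 0" for w
    using mem nz that c unfolding is_newvector_def by auto
qed

end

section \<open>Nonvanishing of weight spaces\<close>

lemma root_unity_sum:
  fixes z :: complex
  assumes "z ^ q = 1" "z \<noteq> 1" shows "(\<Sum>j<q. z ^ j) = 0"
  using assms by (simp add: geometric_sum)

text \<open>The operator \<open>X = \<rho> (x 1)\<close> has an eigenvector whose eigenvalue \<open>c\<close> is a primitive
  \<open>p^l\<close>-th root of unity, since otherwise it would be fixed by \<open>N_{l-1}\<close>. The torus permutes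
  the \<open>X\<close>-eigenspaces through \<open>u \<mapsto> u\<^sup>2\<close>, with stabiliser \<open>\<plusminus>1\<close>, so projecting such a vector to a
  weight compatible with \<open>-1\<close> gives a nonzero vector.\<close>

lemma weight_space_nonzero:
  fixes \<rho> :: "'p::prime_type mat2 \<Rightarrow> 'w::complex_vector \<Rightarrow> 'w"
    and \<mu> :: "'p padic \<Rightarrow> complex"
  assumes odd: "odd CARD('p)" and rep: "representation (GLsub H) W \<rho>"
    and W: "\<exists>w\<in>W. w \<noteq> 0"
    and Hx: "\<And>s. s \<in> Zp \<Longrightarrow> xm s \<in> H"
      and Hh: "\<And>u. u \<in> Zp_units \<Longrightarrow> hm u \<in> H" and l: "l \<ge> 1"
    and trx: "\<And>s w. s \<in> pZp (int l) \<Longrightarrow> w \<in> W \<Longrightarrow> \<rho> (xm s) w = w"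
    and trh: "\<And>u w. u \<in> Zp_units \<Longrightarrow> u - 1 \<in> pZp (int l) \<Longrightarrow> w \<in> W \<Longrightarrow> \<rho> (hm u) w = w"
    and nf: "nofix (N_grp (int l - 1)) W \<rho>"
    and \<mu>_mult: "\<And>u v. u \<in> Zp_units \<Longrightarrow> v \<in> Zp_units \<Longrightarrow> \<mu> (u * v) = \<mu> u * \<mu> v"
    and \<mu>_sq: "\<And>u. u \<in> Zp_units \<Longrightarrow> \<mu> u * \<mu> u = 1"
    and \<mu>_1: "\<And>u. u \<in> Zp_units \<Longrightarrow> u - 1 \<in> pZp 1 \<Longrightarrow> \<mu> u = 1"
    and cc: "centrally_compatible W \<rho> \<mu>"
  shows "\<exists>w\<in>weight_space W \<rho> \<mu>. w \<noteq> 0"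
proof -
  note R = repD[OF rep] and RV = repV[OF rep]
  define q where "q = CARD('p) ^ l"
  have p3: "CARD('p) \<ge> 3" using p_gt_1[where 'p='p] odd by (cases "CARD('p) = 2") auto
  have q3: "q \<ge> 3"
  proof -
    have "CARD('p) ^ 1 \<le> q" unfolding q_def using l p3 by (intro power_increasing) auto
    then show ?thesis using p3 by simp
  qed
  have q_pZp: "of_nat q \<in> (pZp (int l) :: 'p padic set)" by (simp add: q_def unif_power_pZp)
  have HxN: "xm (of_nat j) \<in> H" for j by (intro Hx) simp
  define X where "X j v = \<rho> (xm (of_nat j)) v" for j v
  have XW: "X j v \<in> W" if "v \<in> W" for j v unfolding X_def by (rule RV[OF HxN that])
  have X_lin: "X j (c *\<^sub>C v) = c *\<^sub>C X j v" if "v \<in> W" for j c v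
    unfolding X_def by (rule clinear_onD(3)[OF R(2)[OF HxN] that])
  have X_add: "X (i + j) v = X i (X j v)" if "v \<in> W" for i j v
    unfolding X_def using R(4)[OF HxN HxN that, of i j] by (simp add: xm_add[symmetric])
  have X_per: "X (j + q) v = X j v" if "v \<in> W" for j v
  proof -
    have "X q v = v" unfolding X_def by (rule trx[OF q_pZp that])
    then show ?thesis using X_add[OF that] by simp
  qed
  have Wsub: "complex_vector.subspace W" by (rule R(1))
  note Wscale = complex_vector.subspace_scale[OF Wsub]
  \<comment> \<open>For c^q = 1 this is q times the projection to the c-eigenspace of
    \<open>X 1\<close>, whose q-th power is the identity on W.\<close>
  define E where "E c v = (\<Sum>j<q. (inverse c) ^ j *\<^sub>C X j v)" for c :: complex and v
  have EW: "E c v \<in> W" if "v \<in> W" for c v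
    unfolding E_def by (intro complex_vector.subspace_sum[OF Wsub] Wscale XW that)
  have E_eigen: "X 1 (E c v) = c *\<^sub>C E c v" if c: "c ^ q = 1" and v: "v \<in> W" for c v
  proof -
    have c0: "c \<noteq> 0" using c q3 by (auto simp: power_0_left)
    let ?G = "\<lambda>j. (inverse c) ^ j *\<^sub>C X j v"
    have per: "?G (j + q) = ?G j" for j using c X_per[OF v] by (simp add: power_add power_inverse)
    have "X 1 (E c v) = (\<Sum>j<q. X 1 (?G j))"
      unfolding E_def X_def[of 1] by (rule clinear_on_sum[OF Wsub R(2)[OF HxN]]) (auto intro: Wscale XW v)
    also have "\<dots> = (\<Sum>j<q. c *\<^sub>C ?G (1 + j))"
      using c0
        by (intro sum.cong refl) (simp add: X_lin[OF XW[OF v]] X_add[OF v, of 1, simplified, symmetric] scaleC_scaleC)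
    also have "\<dots> = c *\<^sub>C (\<Sum>j<q. ?G (1 + j))" by (simp only: complex_vector.scale_sum_right)
    also have "(\<Sum>j<q. ?G (1 + j)) = E c v" unfolding E_def by (rule periodic_sum[of ?G, OF per])
    finally show ?thesis .
  qed
  define \<omega> where "\<omega> = exp (2 * of_real pi * \<i> * of_nat 1 / of_nat q)"
  have \<omega>: "\<omega> ^ n = 1 \<longleftrightarrow> q dvd n" for n
  proof -
    have "\<omega> ^ n = exp (2 * of_real pi * \<i> * of_nat n / of_nat q)"
      unfolding \<omega>_def exp_of_nat_mult[symmetric] by (simp add: field_simps)
    then show ?thesis using complex_root_unity_eq_1[of q n] q3 by simp
  qed
  have \<omega>0: "\<omega> \<noteq> 0" by (simp add: \<omega>_def)
  obtain v where v: "v \<in> W" "v \<noteq> 0" using W by blast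
  \<comment> \<open>Fourier inversion: the eigencomponents of v add up to q v, so at least one of
    them is nonzero.\<close>
  have "(\<Sum>k<q. E (\<omega> ^ k) v) = of_nat q *\<^sub>C v"
  proof -
    have "(\<Sum>k<q. E (\<omega> ^ k) v) = (\<Sum>j<q. \<Sum>k<q. (inverse (\<omega> ^ k)) ^ j *\<^sub>C X j v)"
      unfolding E_def by (rule sum.swap)
    also have "\<dots> = (\<Sum>j<q. (\<Sum>k<q. (inverse (\<omega> ^ j)) ^ k) *\<^sub>C X j v)"
      by (intro sum.cong refl) (simp add: complex_vector.scale_sum_left power_inverse power_mult[symmetric] mult.commute)
    also have "\<dots> = (\<Sum>j<q. if j = 0 then of_nat q *\<^sub>C v else 0)"
    proof (intro sum.cong refl)
      fix j assume j: "j \<in> {..<q}"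
      show "(\<Sum>k<q. (inverse (\<omega> ^ j)) ^ k) *\<^sub>C X j v = (if j = 0 then of_nat q *\<^sub>C v else 0)"
      proof (cases "j = 0")
        case True
        have "xm 0 = (mat 1 :: 'p mat2)" by (simp add: xm_def mat_1_mat2)
        then show ?thesis using True R(3)[OF v(1)] by (simp add: X_def)
      next
        case False
        then have "\<not> q dvd j" using j by (auto dest: dvd_imp_le)
        then have "inverse (\<omega> ^ j) \<noteq> 1" using \<omega>[of j] by simp
        moreover have "inverse (\<omega> ^ j) ^ q = 1"
          using \<omega>[of "j * q"] by (simp add: power_inverse power_mult[symmetric])
        ultimately show ?thesis using root_unity_sum False by simp
      qed
    qed
    also have "\<dots> = of_nat q *\<^sub>C v" using q3 by simp
    finally show ?thesis .
  qed
  moreover have "of_nat q *\<^sub>C v \<noteq> 0" using v q3 by (simp add: complex_vector.scale_eq_0_iff)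
  ultimately have "(\<Sum>k<q. E (\<omega> ^ k) v) \<noteq> 0" by simp
  then obtain k where k: "E (\<omega> ^ k) v \<noteq> 0" by (rule sum.not_neutral_contains_not_neutral)
  define c where "c = \<omega> ^ k"
  define v0 where "v0 = E c v"
  have cq: "c ^ q = 1" using \<omega>[of "k * q"] by (simp add: c_def power_mult[symmetric])
  have c0: "c \<noteq> 0" using \<omega>0 by (simp add: c_def)
  have v0: "v0 \<in> W" "v0 \<noteq> 0" "X 1 v0 = c *\<^sub>C v0"
    using EW[OF v(1)] k E_eigen[OF cq v(1)] by (simp_all add: v0_def c_def)
  have Xv0: "X j v0 = c ^ j *\<^sub>C v0" for j
  proof (induction j)
    case 0
    have "xm 0 = (mat 1 :: 'p mat2)" by (simp add: xm_def mat_1_mat2)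
    then show ?case using R(3)[OF v0(1)] by (simp add: X_def scaleC_one)
  next
    case (Suc j)
    have "X (Suc j) v0 = X 1 (X j v0)" using X_add[OF v0(1), of 1 j] by simp
    also have "\<dots> = c ^ j *\<^sub>C c *\<^sub>C v0" by (simp only: Suc X_lin[OF v0(1)] v0(3))
    finally show ?case by (simp add: scaleC_scaleC mult.commute)
  qed
  have xv0: "\<rho> (xm z) v0 = c ^ m *\<^sub>C v0" if z: "z - of_nat m \<in> pZp (int l)" for z m
  proof -
    have zH: "xm (z - of_nat m) \<in> H" using z by (intro Hx pZp_Zp[of _ "int l"]) auto
    have "xm z = xm (of_nat m) ** xm (z - of_nat m)" by (simp add: xm_add[symmetric])
    then have "\<rho> (xm z) v0 = X m (\<rho> (xm (z - of_nat m)) v0)"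
      unfolding X_def using R(4)[OF HxN zH v0(1)] by simp
    then show ?thesis using trx[OF z v0(1)] Xv0 by simp
  qed
  have prim: "c ^ (CARD('p) ^ (l - 1)) \<noteq> 1"
  proof
    assume c1: "c ^ (CARD('p) ^ (l - 1)) = 1"
    have "v0 = 0"
    proof (rule nofixD[OF nf v0(1)])
      fix g :: "'p mat2" assume "g \<in> N_grp (int l - 1)"
      then obtain z where z: "g = xm z" "z \<in> pZp (int l - 1)" by (auto simp: N_grp_def)
      from z(2) obtain m r
        where mr: "r \<in> pZp (int l - 1 + int 1)" "z = of_nat m * unif powi (int l - 1) + r"
        by (rule pZp_decomp)
      have pw: "unif powi (int l - 1) = (unif ^ (l - 1) :: 'p padic)"
        using l by (metis of_nat_diff of_nat_1 power_int_of_nat)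
      have "z - of_nat (m * CARD('p) ^ (l - 1)) \<in> pZp (int l)" using mr by (simp add: pw)
      from xv0[OF this] have "\<rho> (xm z) v0 = c ^ (m * CARD('p) ^ (l - 1)) *\<^sub>C v0" .
      also have "c ^ (m * CARD('p) ^ (l - 1)) = 1" using c1 by (simp add: power_mult mult.commute[of m])
      finally show "\<rho> g v0 = v0" by (simp add: z(1) scaleC_one)
    qed
    then show False using v0 by simp
  qed
  have c_pow: "c ^ n = 1 \<longleftrightarrow> q dvd n" for n
  proof
    assume "q dvd n"
    then show "c ^ n = 1" using cq by (auto simp: power_mult)
  next
    assume cn: "c ^ n = 1"
    have "\<not> CARD('p) dvd k"
    proof
      assume "CARD('p) dvd k"
      then have "q dvd k * CARD('p) ^ (l - 1)" using l by (cases l) (auto simp: q_def mult_dvd_mono)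
      then show False using prim \<omega> by (simp add: c_def power_mult[symmetric])
    qed
    then have "coprime q k"
      using prime_imp_coprime[OF prime_type[where 'a='p], of k] unfolding q_def by simp
    moreover have "q dvd k * n" using cn \<omega> by (simp add: c_def power_mult[symmetric])
    ultimately show "q dvd n" using coprime_dvd_mult_right_iff by blast
  qed
  \<comment> \<open>\<open>rp\<close> and \<open>U\<close> model the finite quotient of the units by
    1 + p^l Z_p on natural numbers below q.\<close>
  define rp where "rp z = (SOME m. m < q \<and> z - of_nat m \<in> pZp (int l))" for z :: "'p padic"
  have rp: "rp z < q" "z - of_nat (rp z) \<in> pZp (int l)" if "z \<in> Zp" for z
  proof -
    obtain a where a: "0 \<le> a" "a < int CARD('p) ^ l" "z - of_int a \<in> pZp (int l)"
      using Zp_residue[OF \<open>z \<in> Zp\<close>] by blast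
    then have "nat a < q \<and> z - of_nat (nat a) \<in> pZp (int l)" by (simp add: q_def nat_less_iff)
    then have "rp z < q \<and> z - of_nat (rp z) \<in> pZp (int l)" unfolding rp_def by (rule someI)
    then show "rp z < q" "z - of_nat (rp z) \<in> pZp (int l)" by auto
  qed
  have nat_pZp: "of_nat a - of_nat b \<in> (pZp (int l) :: 'p padic set) \<longleftrightarrow> [a = b] (mod q)" for a b
    using of_int_pZp[of "int a - int b" l, where 'p='p]
    by (simp add: q_def cong_int_iff[symmetric] cong_iff_dvd_diff)
  define U where "U = {u. u < q \<and> of_nat u \<in> (Zp_units :: 'p padic set)}"
  have finU: "finite U" unfolding U_def by simp
  have unit_near: "y \<in> Zp_units" if "x \<in> Zp_units" "x - y \<in> pZp (int l)" for x y :: "'p padic"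
    using Zp_units_add[OF that(1), of "- (x - y)"] pZp_mono[OF that(2), of 1] l
      by (simp add: pZp_uminus del: minus_diff_eq)
  \<comment> \<open>The summands of the projection of \<open>v0\<close> to the weight \<mu>; \<mu>
    appears in place of its inverse because it is quadratic.\<close>
  define F where "F u = \<mu> u *\<^sub>C \<rho> (hm u) v0" for u
  have FW: "F u \<in> W" if "u \<in> Zp_units" for u unfolding F_def by (intro Wscale RV Hh that v0)
  have hm_mult: "hm (a * b) = hm a ** hm b" for a b :: "'p padic" by (simp add: hm_def)
  have F_mult: "\<rho> (hm a) (F b) = \<mu> a *\<^sub>C F (a * b)" if "a \<in> Zp_units" "b \<in> Zp_units"
    for a b
  proof -
    have "\<rho> (hm a) (F b) = \<mu> b *\<^sub>C \<rho> (hm (a * b)) v0"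
      using clinear_onD(3)[OF R(2)[OF Hh[OF that(1)]] RV[OF Hh[OF that(2)] v0(1)]] R(4)[OF Hh Hh v0(1), OF that]
      by (simp add: F_def hm_mult)
    also have "\<mu> b = \<mu> a * \<mu> (a * b)" using \<mu>_mult[OF that] \<mu>_sq[OF that(1)]
      by (simp add: mult.assoc[symmetric])
    finally show ?thesis by (simp add: F_def scaleC_scaleC)
  qed
  have F_cong: "F a = F b" if ab: "a \<in> Zp_units" "b \<in> Zp_units" "a - b \<in> pZp (int l)" for a b
  proof -
    let ?e = "inverse b * a"
    have e: "?e \<in> Zp_units" using ab by (intro Zp_units_mult Zp_units_inverse)
    have "?e - 1 = inverse b * (a - b)" using Zp_units_nz[OF ab(2)] by (simp add: algebra_simps)
    then have e1: "?e - 1 \<in> pZp (int l)"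
      using pZp_Zp_mult[OF Zp_units_Zp[OF Zp_units_inverse[OF ab(2)]] ab(3)] by simp
    have a: "a = b * ?e" using Zp_units_nz[OF ab(2)] by simp
    have "\<mu> a = \<mu> b" using \<mu>_mult[OF ab(2) e] \<mu>_1[OF e] pZp_mono[OF e1, of 1] l a by simp
    moreover have "\<rho> (hm a) v0 = \<rho> (hm b) v0"
      using R(4)[OF Hh[OF ab(2)] Hh[OF e] v0(1)] trh[OF e e1 v0(1)] a by (simp add: hm_mult[symmetric])
    ultimately show ?thesis by (simp add: F_def)
  qed
  define w where "w = (\<Sum>u\<in>U. F (of_nat u))"
  have wW: "w \<in> W" unfolding w_def by (intro complex_vector.subspace_sum[OF Wsub] FW) (simp add: U_def)
  have "\<rho> (hm a) w = \<mu> a *\<^sub>C w" if a: "a \<in> Zp_units" for a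
  proof -
    let ?g = "\<lambda>u. rp (a * of_nat u)"
    have au: "a * of_nat u \<in> Zp_units" if "u \<in> U" for u using that a
      by (simp add: U_def Zp_units_mult)
    note g = rp[OF Zp_units_Zp[OF au]]
    have gU: "?g u \<in> U" if "u \<in> U" for u
      using g[OF that] unit_near[OF au[OF that] g(2)[OF that]] by (simp add: U_def)
    have "inj_on ?g U"
    proof (rule inj_onI)
      fix u u' assume u: "u \<in> U" "u' \<in> U" "?g u = ?g u'"
      have "a * (of_nat u - of_nat u') \<in> pZp (int l)"
        using pZp_diff[OF g(2)[OF u(1)] g(2)[OF u(2)]] u(3) by (simp add: algebra_simps)
      then have "[u = u'] (mod q)" using nat_pZp by (simp add: unit_mult_pZp_iff[OF a])
      then show "u = u'" using u by (simp add: U_def cong_less_modulus_unique_nat)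
    qed
    then have bij: "bij_betw ?g U U"
      using gU finU by (metis bij_betw_def endo_inj_surj image_subsetI)
    have "\<rho> (hm a) w = (\<Sum>u\<in>U. \<rho> (hm a) (F (of_nat u)))"
      unfolding w_def by (rule clinear_on_sum[OF Wsub R(2)[OF Hh[OF a]] finU]) (simp add: FW U_def)
    also have "\<dots> = (\<Sum>u\<in>U. \<mu> a *\<^sub>C F (of_nat (?g u)))"
    proof (rule sum.cong[OF refl])
      fix u assume u: "u \<in> U"
      have "F (a * of_nat u) = F (of_nat (?g u))"
        using g(2)[OF u] au[OF u] gU[OF u] by (intro F_cong) (simp_all add: U_def)
      then show "\<rho> (hm a) (F (of_nat u)) = \<mu> a *\<^sub>C F (of_nat (?g u))"
        using F_mult[OF a, of "of_nat u"] u by (simp add: U_def)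
    qed
    also have "\<dots> = (\<Sum>u\<in>U. \<mu> a *\<^sub>C F (of_nat u))"
      by (rule sum.reindex_bij_betw[OF bij, of "\<lambda>u. \<mu> a *\<^sub>C F (of_nat u)"])
    also have "\<dots> = \<mu> a *\<^sub>C w" unfolding w_def by (simp only: complex_vector.scale_sum_right)
    finally show ?thesis .
  qed
  then have "w \<in> weight_space W \<rho> \<mu>" using wW by (simp add: weight_space_def)
  moreover have "w \<noteq> 0"
  proof
    assume w0: "w = 0"
    \<comment> \<open>The vector h(u) \<open>v0\<close> has eigenvalue c to the power u^(-2), so
      \<open>E c\<close> annihilates it unless u^2 = 1 modulo q. For u = 1 and u = -1 central
      compatibility makes \<open>F\<close> equal to \<open>v0\<close>, so the two contributions add
      instead of cancelling.\<close>
    have EF: "E c (F (of_nat u)) = (if u = 1 \<or> u = q - 1 then of_nat q *\<^sub>C v0 else 0)"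
      if u: "u \<in> U" for u
    proof -
      let ?u = "of_nat u :: 'p padic"
      have uu: "?u \<in> Zp_units" using u by (simp add: U_def)
      define i where "i = (inverse ?u)\<^sup>2"
      have iu: "i \<in> Zp_units" unfolding i_def by (intro Zp_units_power Zp_units_inverse uu)
      define m where "m = rp i"
      have m: "i - of_nat m \<in> pZp (int l)" unfolding m_def by (rule rp(2)[OF Zp_units_Zp[OF iu]])
      have hv: "\<rho> (hm ?u) v0 \<in> W" by (intro RV Hh uu v0)
      have X1: "X j (\<rho> (hm ?u) v0) = (c ^ m) ^ j *\<^sub>C \<rho> (hm ?u) v0" for j
      proof -
        have comm: "xm (of_nat j) ** hm ?u = hm ?u ** xm (of_nat j * i)"
          using Zp_units_nz[OF uu] by (simp add: xm_def hm_def i_def power2_eq_square field_simps)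
        have H2: "xm (of_nat j * i) \<in> H" by (rule Hx[OF Zp_mult[OF Zp_of_nat Zp_units_Zp[OF iu]]])
        have "of_nat j * i - of_nat (m * j) \<in> pZp (int l)"
          using pZp_Zp_mult[of "of_nat j", OF _ m] by (simp add: algebra_simps)
        from xv0[OF this] have "\<rho> (xm (of_nat j * i)) v0 = c ^ (m * j) *\<^sub>C v0" .
        then have "X j (\<rho> (hm ?u) v0) = \<rho> (hm ?u) (c ^ (m * j) *\<^sub>C v0)"
          unfolding X_def using R(4)[OF HxN Hh[OF uu] v0(1), of j] R(4)[OF Hh[OF uu] H2 v0(1)] comm by metis
        then show ?thesis using clinear_onD(3)[OF R(2)[OF Hh[OF uu]] v0(1)] by (simp add: power_mult)
      qed
      have "E c (F ?u) = (\<Sum>j<q. (inverse c * c ^ m) ^ j *\<^sub>C F ?u)"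
        unfolding E_def F_def
        by (intro sum.cong refl) (simp add: X_lin[OF hv] X1 scaleC_scaleC power_mult_distrib ac_simps)
      then have E1: "E c (F ?u) = (\<Sum>j<q. (inverse c * c ^ m) ^ j) *\<^sub>C F ?u"
        by (simp only: complex_vector.scale_sum_left)
      have one: "inverse c * c ^ m = 1 \<longleftrightarrow> u = 1 \<or> u = q - 1"
      proof -
        have "inverse c * c ^ m = 1 \<longleftrightarrow> c ^ m = c" using c0 by (simp add: field_simps)
        also have "\<dots> \<longleftrightarrow> c ^ (m + (q - 1)) = 1"
        proof -
          have "c ^ (m + (q - 1)) * c = c ^ m * c ^ q" using q3
            by (simp add: power_add[symmetric] mult.commute power_Suc[symmetric] del: power_Suc)
          then show ?thesis using cq c0 by (metis mult_1_right mult_cancel_right2 mult_cancel_right)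
        qed
        also have "\<dots> \<longleftrightarrow> [m = 1] (mod q)"
        proof -
          have "c ^ (m + (q - 1)) = 1 \<longleftrightarrow> [m + (q - 1) = 0] (mod q)"
            by (simp only: c_pow cong_0_iff)
          also have "\<dots> \<longleftrightarrow> [m + (q - 1) + 1 = 0 + 1] (mod q)"
            by (rule cong_add_rcancel_nat[symmetric])
          also have "m + (q - 1) + 1 = m + q" using q3 by simp
          also have "[m + q = 0 + 1] (mod q) \<longleftrightarrow> [m = 1] (mod q)" by (simp add: cong_def)
          finally show ?thesis .
        qed
        also have "\<dots> \<longleftrightarrow> of_nat m - 1 \<in> (pZp (int l) :: 'p padic set)"
          using nat_pZp[of m 1] by simp
        also have "\<dots> \<longleftrightarrow> i - 1 \<in> pZp (int l)"
          using pZp_add[OF m, of "of_nat m - 1"] pZp_diff[OF _ m, of "i - 1"] by auto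
        also have "\<dots> \<longleftrightarrow> ?u\<^sup>2 * (i - 1) \<in> pZp (int l)"
          by (rule unit_mult_pZp_iff[OF Zp_units_power[OF uu], symmetric])
        also have "?u\<^sup>2 * (i - 1) = - ((?u - 1) * (?u + 1))"
          using Zp_units_nz[OF uu] by (simp add: i_def power2_eq_square field_simps)
        \<comment> \<open>u - 1 and u + 1 differ by the unit 2, so one of them is a unit and the
          other carries the whole power of p.\<close>
        also have "\<dots> \<in> pZp (int l) \<longleftrightarrow> ?u - 1 \<in> pZp (int l) \<or> ?u + 1 \<in> pZp (int l)"
        proof
          assume h: "- ((?u - 1) * (?u + 1)) \<in> pZp (int l)"
          show "?u - 1 \<in> pZp (int l) \<or> ?u + 1 \<in> pZp (int l)"
          proof (cases "?u + 1 \<in> Zp_units")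
            case True
            then show ?thesis using h unit_mult_pZp_iff[OF True, of "?u - 1"] by (simp add: mult.commute)
          next
            case False
            then have "?u + 1 \<in> pZp 1" using Zp_add[of ?u 1] by (auto simp: Zp_units_iff)
            moreover have "?u - 1 = - 2 + (?u + 1)" by simp
            ultimately have "?u - 1 \<in> Zp_units" using Zp_units_add[OF Zp_units_uminus] two_unit[OF odd]
              by metis
            then show ?thesis using h unit_mult_pZp_iff by fastforce
          qed
        next
          assume "?u - 1 \<in> pZp (int l) \<or> ?u + 1 \<in> pZp (int l)"
          moreover have "?u - 1 \<in> Zp" "?u + 1 \<in> Zp" using Zp_units_Zp[OF uu]
            by (auto intro: Zp_add Zp_diff)
          ultimately have "(?u - 1) * (?u + 1) \<in> pZp (int l)" using pZp_mult_Zp pZp_Zp_mult by blast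
          then show "- ((?u - 1) * (?u + 1)) \<in> pZp (int l)" by (rule pZp_uminus)
        qed
        also have "?u - 1 \<in> pZp (int l) \<longleftrightarrow> u = 1"
          using nat_pZp[of u 1] u q3 by (auto simp: U_def cong_less_modulus_unique_nat)
        also have "?u + 1 \<in> pZp (int l) \<longleftrightarrow> u = q - 1"
        proof -
          have "?u + 1 \<in> pZp (int l) \<longleftrightarrow> q dvd u + 1" using nat_pZp[of "u + 1" 0]
            by (simp add: cong_0_iff add.commute)
          also have "\<dots> \<longleftrightarrow> u = q - 1" using u q3
            by (auto simp: U_def dest: dvd_imp_le)
          finally show ?thesis .
        qed
        finally show ?thesis .
      qed
      show ?thesis
      proof (cases "u = 1 \<or> u = q - 1")
        case True
        have hm1: "hm 1 = (mat 1 :: 'p mat2)" by (simp add: hm_def mat_1_mat2)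
        have F1: "F 1 = v0" using \<mu>_1[of 1] R(3)[OF v0(1)] by (simp add: F_def hm1 scaleC_one)
        have Fm1: "F (- 1) = v0"
        proof -
          have "hm (- 1) = (- mat 1 :: 'p mat2)" by (simp add: hm_def mat_1_mat2 uminus_mat2)
          then have "\<rho> (hm (- 1)) v0 = \<mu> (- 1) *\<^sub>C v0" using cc v0(1)
            by (simp add: centrally_compatible_def)
          then show ?thesis using \<mu>_sq[of "- 1"] by (simp add: F_def scaleC_scaleC scaleC_one)
        qed
        have "F ?u = v0"
        proof (cases "u = 1")
          case False
          then have "?u - (- 1) = of_nat q" using True q3 by (simp add: of_nat_diff)
          then have "F ?u = F (- 1)" using q_pZp uu by (intro F_cong) auto
          then show ?thesis using Fm1 by simp
        qed (simp add: F1)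
        then show ?thesis using E1 one True by simp
      next
        case False
        have "(inverse c * c ^ m) ^ q = 1"
          using cq c0
            by (simp add: power_mult_distrib power_inverse power_mult[symmetric] mult.commute[of m q]) (simp add: power_mult)
        then show ?thesis using E1 one False root_unity_sum by simp
      qed
    qed
    have UU: "1 \<in> U" "q - 1 \<in> U" "1 \<noteq> q - 1"
    proof -
      have "(- 1 :: 'p padic) - of_nat (q - 1) = - of_nat q" using q3 by (simp add: of_nat_diff)
      then show "q - 1 \<in> U" using unit_near[OF Zp_units_m1, of "of_nat (q - 1)"] pZp_uminus[OF q_pZp] q3
        by (simp add: U_def)
      show "1 \<in> U" "1 \<noteq> q - 1" using q3 by (auto simp: U_def)
    qed
    have E_sum: "E c w = (\<Sum>u\<in>U. E c (F (of_nat u)))"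
    proof -
      have "E c w = (\<Sum>j<q. \<Sum>u\<in>U. inverse c ^ j *\<^sub>C X j (F (of_nat u)))"
        unfolding E_def
      proof (rule sum.cong[OF refl])
        fix j
        have "X j w = (\<Sum>u\<in>U. X j (F (of_nat u)))"
          unfolding w_def X_def by (rule clinear_on_sum[OF Wsub R(2)[OF HxN] finU]) (simp add: FW U_def)
        then show "inverse c ^ j *\<^sub>C X j w = (\<Sum>u\<in>U. inverse c ^ j *\<^sub>C X j (F (of_nat u)))"
          by (simp only: complex_vector.scale_sum_right)
      qed
      also have "\<dots> = (\<Sum>u\<in>U. E c (F (of_nat u)))" unfolding E_def by (rule sum.swap)
      finally show ?thesis .
    qed
    also have "\<dots> = (\<Sum>u\<in>{1, q - 1}. of_nat q *\<^sub>C v0)"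
    proof (rule sum.mono_neutral_cong_right[OF finU])
      show "{1, q - 1} \<subseteq> U" using UU by blast
      show "\<forall>u\<in>U - {1, q - 1}. E c (F (of_nat u)) = 0" using EF by simp
      fix u assume u: "u \<in> {1, q - 1}"
      then have "u \<in> U" using UU by blast
      from EF[OF this] show "E c (F (of_nat u)) = of_nat q *\<^sub>C v0" using u by simp
    qed
    also have "\<dots> = of_nat q *\<^sub>C v0 + of_nat q *\<^sub>C v0" using UU(3) by simp
    also have "\<dots> = (of_nat q + of_nat q) *\<^sub>C v0" by (rule scaleC_add_left[symmetric])
    finally have "E c w = (of_nat q + of_nat q) *\<^sub>C v0" .
    moreover have "E c w = 0" unfolding w0 using clinear_on_0[OF Wsub R(2)[OF HxN]] by (simp add: E_def X_def)
    moreover have "(of_nat q + of_nat q :: complex) \<noteq> 0"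
      using q3 by (metis add_is_0 not_numeral_le_zero of_nat_add of_nat_eq_0_iff)
    ultimately show False using v0(2) by (simp add: complex_vector.scale_eq_0_iff)
  qed
  ultimately show ?thesis by blast
qed

section \<open>Fixed vectors and conductors\<close>

lemma N_grp_antimono: "r \<le> r' \<Longrightarrow> N_grp r' \<subseteq> N_grp r"
  and Nbar_grp_antimono: "r \<le> r' \<Longrightarrow> Nbar_grp r' \<subseteq> Nbar_grp r"
  by (auto simp: N_grp_def Nbar_grp_def intro: pZp_mono)

lemma N_grp_Kd: "\<delta> \<le> 1 \<Longrightarrow> - int \<delta> \<le> r \<Longrightarrow> N_grp r \<subseteq> Kd \<delta>" and Nbar_grp_Kd: "\<delta> \<le> 1 \<Longrightarrow> int \<delta> \<le> r \<Longrightarrow> Nbar_grp r \<subseteq> Kd \<delta>"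
  by (auto simp: N_grp_def Nbar_grp_def xm_def ym_def Kd_mat2 intro: pZp_mono)

lemma J_grp_antimono: "\<delta> \<le> 1 \<Longrightarrow> r \<le> r' \<Longrightarrow> J_grp \<delta> r' \<subseteq> J_grp \<delta> r"
  by (auto simp: J_grp_def intro: pZp_mono)

lemma rep_conductor_eqI:
  fixes \<rho> :: "'p::prime_type mat2 \<Rightarrow> 'v::complex_vector \<Rightarrow> 'v"
  assumes "\<delta> \<le> 1" "acts_trivially (J_grp \<delta> (Suc n)) V \<rho>"
    "\<not> acts_trivially (J_grp \<delta> n) V \<rho>"
  shows "rep_conductor \<delta> V \<rho> = Suc n"
  unfolding rep_conductor_def
proof (rule Least_equality)
  show "acts_trivially (J_grp \<delta> (Suc n)) V \<rho>" by (rule assms(2))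
  fix r assume r: "acts_trivially (J_grp \<delta> r) V \<rho>"
  show "Suc n \<le> r"
  proof (rule ccontr)
    assume "\<not> Suc n \<le> r"
    then have "r \<le> n" by simp
    then have "J_grp \<delta> n \<subseteq> (J_grp \<delta> r :: 'p mat2 set)"
      by (rule J_grp_antimono[OF assms(1)])
    then show False using r assms(3) by (auto simp: acts_trivially_def)
  qed
qed

lemma not_acts_trivially:
  assumes "nofix S V \<rho>" "S \<subseteq> S'" "v \<in> V"
    "v \<noteq> 0" shows "\<not> acts_trivially S' V \<rho>"
  using assms unfolding nofix_def acts_trivially_def by blast

text \<open>A and B are exponents at which the upper and lower unipotents have no fixed vector.
  \<open>dich\<close> says that no even number lies strictly between A and r - B; when 2n is at most
  A, \<open>AB\<close> supplies the second alternative of H2.\<close>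

lemma (in genuine_rep) eta_space_vanish_unipotents:
  assumes f: "f \<in> eta_space \<pi> \<eta> r" and \<eta>: "\<eta> 1 = 1"
    and A: "nofix (N_grp A) X \<rho>" "- int \<delta> \<le> A"
      and B: "nofix (Nbar_grp B) X \<rho>" "int \<delta> \<le> B"
    and AB: "A + 2 * int \<delta> - 2 \<le> B" and dich: "\<And>n. 2 * n \<le> A \<or> int r - 2 * n \<le> B"
  shows "f = 0"
proof (rule eta_space_vanish[OF f \<eta>])
  have 1: "nofix (N_grp a \<inter> K) X \<rho>" if "a \<le> A" for a
    by (rule nofix_mono[OF A(1)]) (use N_grp_antimono[OF that] N_grp_Kd[OF \<delta> A(2)] in blast)
  have 2: "nofix (Nbar_grp b \<inter> K) X \<rho>" if "b \<le> B" for b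
    by (rule nofix_mono[OF B(1)]) (use Nbar_grp_antimono[OF that] Nbar_grp_Kd[OF \<delta> B(2)] in blast)
  show "nofix ((N_grp (2 * n) \<union> Nbar_grp (int r - 2 * n)) \<inter> K) X \<rho>" for n
    using dich[of n] 1[of "2 * n"] 2[of "int r - 2 * n"] by (auto elim!: nofix_mono)
  show "nofix (Nbar_grp (int r - 2 * n) \<inter> K) X \<rho> \<or> nofix (Nbar_grp (2 * n + 2 * int \<delta> - 2) \<inter> K) X \<rho>" for n
    using dich[of n] 2[of "int r - 2 * n"] 2[of "2 * n + 2 * int \<delta> - 2"] AB by linarith
qed

text \<open>The operator of g carries vectors fixed by S' to vectors fixed by S.\<close>

lemma nofix_conj:
  assumes rep: "representation (GLsub K) V \<rho>" and nf: "nofix S V \<rho>"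
    and S: "S \<subseteq> K" "S' \<subseteq> K"
    and g: "g \<in> K" "g' \<in> K" "g' ** g = mat 1"
      and conj: "\<And>s. s \<in> S \<Longrightarrow> \<exists>s'\<in>S'. s ** g = g ** s'"
  shows "nofix S' V \<rho>"
  unfolding nofix_def
proof (intro ballI impI)
  fix v assume v: "v \<in> V" "\<forall>s\<in>S'. \<rho> s v = v"
  have "\<rho> g v = 0"
  proof (rule nofixD[OF nf repV[OF rep g(1) v(1)]])
    fix s assume s: "s \<in> S"
    then obtain s' where s': "s' \<in> S'" "s ** g = g ** s'" using conj by blast
    have "\<rho> s (\<rho> g v) = \<rho> (s ** g) v" using repD(4)[OF rep _ g(1) v(1)] S(1) s by auto
    also have "\<dots> = \<rho> g (\<rho> s' v)" unfolding s'(2) using repD(4)[OF rep g(1) _ v(1)] S(2) s'(1)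
      by auto
    finally show "\<rho> s (\<rho> g v) = \<rho> g v" using v(2) s'(1) by simp
  qed
  then have "\<rho> g' (\<rho> g v) = 0" using clinear_on_0[OF repD(1)[OF rep] repD(2)[OF rep g(2)]] by simp
  then show "v = 0" using repD(4)[OF rep g(2,1) v(1)] repD(3)[OF rep v(1)] g(3) by simp
qed

text \<open>Shared by \<eta> and \<eta>_l. Triviality on 1 + p Z_p makes the values at the two
  diagonal entries of an Iwahori element equal.\<close>

definition quadratic_char :: "('p::prime_type padic \<Rightarrow> complex) \<Rightarrow> bool" where
  "quadratic_char \<mu> \<longleftrightarrow> (\<forall>u\<in>Zp_units. \<forall>v\<in>Zp_units. \<mu> (u * v) = \<mu> u * \<mu> v) \<and> (\<forall>u\<in>Zp_units. \<mu> u * \<mu> u = 1) \<and>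
     (\<forall>u\<in>Zp_units. u - 1 \<in> pZp 1 \<longrightarrow> \<mu> u = 1)"

lemma quadratic_char_1: "quadratic_char (\<lambda>_. 1)"
  by (simp add: quadratic_char_def)

lemma quadratic_char_legendre:
  assumes "odd CARD('p)" shows "quadratic_char (\<lambda>u :: 'p::prime_type padic. of_int (legendre_p u))"
  unfolding quadratic_char_def
proof (intro conjI ballI impI)
  fix u v :: "'p padic" assume u: "u \<in> Zp_units"
  show "complex_of_int (legendre_p u) * of_int (legendre_p u) = 1"
    using legendre_p_cases[OF u] by auto
  show "complex_of_int (legendre_p u) = 1" if "u - 1 \<in> pZp 1"
    using legendre_p_cong[OF that] by simp
  assume "v \<in> Zp_units"
  then show "complex_of_int (legendre_p (u * v)) = of_int (legendre_p u) * of_int (legendre_p v)"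
    using legendre_p_mult[OF assms u] by simp
qed

lemma quadratic_char_mult:
  "quadratic_char \<mu> \<Longrightarrow> quadratic_char \<nu> \<Longrightarrow> quadratic_char (\<lambda>u. \<mu> u * \<nu> u)"
proof -
  assume *: "quadratic_char \<mu>" "quadratic_char \<nu>"
  have "\<mu> u * \<nu> u * (\<mu> u * \<nu> u) = 1" if "u \<in> Zp_units" for u
  proof -
    have "\<mu> u * \<nu> u * (\<mu> u * \<nu> u) = (\<mu> u * \<mu> u) * (\<nu> u * \<nu> u)"
      by (simp only: ac_simps)
    moreover have "\<mu> u * \<mu> u = 1" "\<nu> u * \<nu> u = 1" using * that
      by (auto simp: quadratic_char_def)
    ultimately show ?thesis by simp
  qed
  then show ?thesis using * by (simp add: quadratic_char_def)
qed

lemma quadratic_char_conductor: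
  assumes "quadratic_char \<eta>" "1 \<le> N" shows "char_conductor \<eta> \<le> N"
proof -
  have "char_conductor \<eta> \<le> 1"
    unfolding char_conductor_def
      by (rule Least_le) (use assms(1) in \<open>simp add: quadratic_char_def\<close>)
  then show ?thesis using assms(2) by simp
qed

lemma weight_vector_exists:
  fixes \<rho> :: "'p::prime_type mat2 \<Rightarrow> 'w::complex_vector \<Rightarrow> 'w"
  assumes odd: "odd CARD('p)" and rep: "representation (GLsub H) W \<rho>" and W: "W \<noteq> {0}"
    and H: "Iw \<subseteq> H" and l: "l \<ge> 1"
    and tr: "\<And>a b c d w. mat2 a b c d \<in> Iw \<Longrightarrow> a - 1 \<in> pZp (int l) \<Longrightarrow> d - 1 \<in> pZp (int l) \<Longrightarrow> b \<in> pZp (int l) \<Longrightarrow> c \<in> pZp (int l + 1)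
       \<Longrightarrow> w \<in> W \<Longrightarrow> \<rho> (mat2 a b c d) w = w"
    and nf: "nofix (N_grp (int l - 1)) W \<rho>" and \<mu>: "quadratic_char \<mu>"
      and cc: "centrally_compatible W \<rho> \<mu>"
  shows "\<exists>w\<in>weight_space W \<rho> \<mu>. w \<noteq> 0"
proof (rule weight_space_nonzero[OF odd rep _ _ _ l _ _ nf _ _ _ cc])
  show "\<exists>w\<in>W. w \<noteq> 0" using W complex_vector.subspace_0[OF repD(1)[OF rep]] by blast
  show "xm s \<in> H" if "s \<in> Zp" for s using that H by (auto simp: xm_def Iw_mat2)
  show "hm u \<in> H" if "u \<in> Zp_units" for u
    using that H by (auto simp: hm_def Iw_mat2 Zp_units_nz Zp_units_Zp Zp_units_inverse)
  show "\<rho> (xm s) w = w" if "s \<in> pZp (int l)" "w \<in> W" for s w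
    unfolding xm_def using that pZp_Zp[OF that(1)] by (intro tr) (auto simp: Iw_mat2)
  show "\<rho> (hm u) w = w" if u: "u \<in> Zp_units" "u - 1 \<in> pZp (int l)" and w: "w \<in> W" for u w
  proof -
    have "inverse u - 1 = - (inverse u * (u - 1))" using Zp_units_nz[OF u(1)] by (simp add: algebra_simps)
    then have "inverse u - 1 \<in> pZp (int l)"
      using pZp_Zp_mult[OF Zp_units_Zp[OF Zp_units_inverse[OF u(1)]] u(2)] by simp
    then show ?thesis
      unfolding hm_def using u w by (intro tr) (auto simp: Iw_mat2 Zp_units_nz Zp_units_Zp Zp_units_inverse)
  qed
qed (use \<mu> in \<open>auto simp: quadratic_char_def\<close>)

text \<open>Splitting off h(a) leaves a matrix with diagonal 1 and ad, where ad - 1 = bc lies in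
  p^l, so it acts trivially; moreover \<mu>(a) = \<mu>(d). The exponent e is l for constituents on
  K^0 and l + 1 for Iwahori constituents.\<close>

lemma weight_action:
  fixes \<rho> :: "'p::prime_type mat2 \<Rightarrow> 'w::complex_vector \<Rightarrow> 'w"
  assumes rep: "representation (GLsub H) W \<rho>" and H: "matgroup H" "Iw \<subseteq> H" and l: "l \<ge> 1"
    and tr: "\<And>a b c d w. mat2 a b c d \<in> Iw \<Longrightarrow> a - 1 \<in> pZp (int l) \<Longrightarrow> d - 1 \<in> pZp (int l) \<Longrightarrow> b \<in> pZp (int l) \<Longrightarrow> c \<in> pZp e
       \<Longrightarrow> w \<in> W \<Longrightarrow> \<rho> (mat2 a b c d) w = w"
    and e: "int l \<le> e" and \<mu>: "quadratic_char \<mu>" and w: "w \<in> weight_space W \<rho> \<mu>"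
    and k: "mat2 a b c d \<in> Iw" "b \<in> pZp (int l)" "c \<in> pZp e"
  shows "\<rho> (mat2 a b c d) w = \<mu> d *\<^sub>C w"
proof -
  note a = Iw_diag_units(1)[OF k(1)] and d = Iw_diag_units(2)[OF k(1)] and ad = Iw_diag_units(3)[OF k(1)]
  note ai = Zp_units_inverse[OF a]
  have wW: "w \<in> W"
    and ww: "\<And>u. u \<in> Zp_units \<Longrightarrow> \<rho> (hm u) w = \<mu> u *\<^sub>C w" using w
    by (auto simp: weight_space_def)
  have hI: "hm u \<in> Iw" if "u \<in> Zp_units" for u :: "'p padic"
    using that by (auto simp: hm_def Iw_mat2 Zp_units_nz Zp_units_Zp Zp_units_inverse)
  define j where "j = hm (inverse a) ** mat2 a b c d"
  have j: "j = mat2 1 (inverse a * b) (a * c) (a * d)" using Zp_units_nz[OF a] by (simp add: j_def hm_def)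
  have jI: "j \<in> Iw" unfolding j_def by (rule matgroupD(3)[OF matgroup_Iw hI[OF ai] k(1)])
  have "a * d - 1 = b * c" using k(1) by (simp add: Iw_mat2 algebra_simps)
  moreover have "b * c \<in> pZp (int l)" using k e by (intro pZp_mult_Zp) (auto intro: pZp_Zp)
  ultimately have "\<rho> j w = w"
    using jI k wW unfolding j by (intro tr pZp_Zp_mult) (auto simp: Zp_units_Zp[OF a] Zp_units_Zp[OF ai])
  moreover have "mat2 a b c d = hm a ** j"
    using Zp_units_nz[OF a] by (simp add: j hm_def mult.assoc[symmetric])
  ultimately have "\<rho> (mat2 a b c d) w = \<mu> a *\<^sub>C w"
    using repD(4)[OF rep _ _ wW, of "hm a" j] hI[OF a] jI H(2) ww[OF a] by auto
  moreover have "\<mu> a = \<mu> d"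
  proof -
    have "\<mu> (a * d) = 1" using ad a d \<mu> by (auto simp: quadratic_char_def Zp_units_mult)
    then have "\<mu> a * \<mu> d = 1" using a d \<mu> by (simp add: quadratic_char_def)
    moreover have "\<mu> d * \<mu> d = 1" using d \<mu> by (simp add: quadratic_char_def)
    ultimately show ?thesis by (metis mult.assoc mult.commute mult_1_right)
  qed
  ultimately show ?thesis by simp
qed

section \<open>Constituents of very cuspidal data\<close>

lemma irreducible_constituentE:
  assumes "irreducible_constituent (GLsub H) V \<tau> W \<sigma>"
  obtains U T
    where "irreducible_rep (GLsub H) W \<sigma>" "U \<subseteq> V" "complex_vector.subspace U"
    "\<And>g u. g \<in> H \<Longrightarrow> u \<in> U \<Longrightarrow> \<tau> g u \<in> U"
    "clinear_on U W T"
      "\<And>g u. g \<in> H \<Longrightarrow> u \<in> U \<Longrightarrow> T (\<tau> g u) = \<sigma> g (T u)"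
      "T ` U = W"
  using assms by (fastforce simp: irreducible_constituent_def stable_subspace_def Hom_rep_def)

lemma constituent_trivial:
  assumes c: "irreducible_constituent (GLsub H) V \<tau> W \<sigma>" and g: "g \<in> H"
    and tr: "\<And>v. v \<in> V \<Longrightarrow> \<tau> g v = v" and w: "w \<in> W"
  shows "\<sigma> g w = w"
proof -
  obtain U T
    where U: "U \<subseteq> V"
    "\<And>g u. g \<in> H \<Longrightarrow> u \<in> U \<Longrightarrow> T (\<tau> g u) = \<sigma> g (T u)"
    "T ` U = W"
    by (rule irreducible_constituentE[OF c]) blast
  obtain u where "u \<in> U" "w = T u" using w U(3) by blast
  then show ?thesis using U(1) U(2)[OF g, of u] tr[of u] by auto
qed

text \<open>Carries very cuspidality from the datum to a constituent. Sums over p^e modulo p^(e+1)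
  are enough because the datum is trivial one step further down.\<close>

lemma constituent_nofix:
  fixes \<tau> :: "'p::prime_type mat2 \<Rightarrow> 'v::complex_vector \<Rightarrow> 'v"
    and f :: "'p padic \<Rightarrow> 'p mat2"
  assumes c: "irreducible_constituent (GLsub H) V \<tau> W \<sigma>"
    and rep: "representation (GLsub H') V \<tau>"
    and f: "\<And>s. s \<in> pZp e \<Longrightarrow> f s \<in> H'"
      "\<And>s. s \<in> pZp e \<Longrightarrow> f s \<in> H" "\<And>s t. f (s + t) = f s ** f t"
    and tr: "\<And>s v. s \<in> pZp (e + 1) \<Longrightarrow> v \<in> V \<Longrightarrow> \<tau> (f s) v = v"
      and nf: "nofix (f ` pZp e) V \<tau>"
  shows "nofix (f ` pZp e) W \<sigma>"
proof -
  obtain U T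
    where U: "U \<subseteq> V" "complex_vector.subspace U"
    "\<And>g u. g \<in> H \<Longrightarrow> u \<in> U \<Longrightarrow> \<tau> g u \<in> U"
    and T: "clinear_on U W T"
      "\<And>g u. g \<in> H \<Longrightarrow> u \<in> U \<Longrightarrow> T (\<tau> g u) = \<sigma> g (T u)"
      "T ` U = W"
    by (rule irreducible_constituentE[OF c]) blast
  have A: "addact e V (\<lambda>s. \<tau> (f s))" by (rule rep_addact[OF rep f(1,3)])
  have nf': "nofix (pZp e) V (\<lambda>s. \<tau> (f s))" using nf by (simp only: nofix_image)
  have "nofix (pZp e) W (\<lambda>s. \<sigma> (f s))"
  proof (rule addavg_quotient[OF A _ nf' U(2,1) _ T(1) T(3)])
    show "\<tau> (f s) v = v" if "s \<in> pZp (e + int 1)" "v \<in> V" for s v using tr that by simp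
    show "\<tau> (f s) u \<in> U" if "s \<in> pZp e" "u \<in> U" for s u using U(3) f(2) that by blast
    show "T (\<tau> (f s) u) = \<sigma> (f s) (T u)" if "s \<in> pZp e" "u \<in> U" for s u
      using T(2) f(2) that by blast
  qed
  then show ?thesis by (simp only: nofix_image)
qed

lemma set_mult_GL2: "h \<in> H \<Longrightarrow> k \<in> K \<Longrightarrow> h ** k \<in> H <#>\<^bsub>GL2\<^esub> K"
  by (auto simp: set_mult_def GL2_def)

lemma mat1_Z_GL: "mat 1 \<in> Z_GL"
  by (simp add: Z_GL_def GL2_def)

lemma K_GL_ZK: "k \<in> K_GL \<Longrightarrow> k \<in> Z_GL <#>\<^bsub>GL2\<^esub> K_GL"
  using set_mult_GL2[OF mat1_Z_GL, of k K_GL] by simp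

lemma K0_K_GL: "K0 \<subseteq> K_GL"
  by (auto simp: K0_def K_GL_def SL2_def)

lemma xm_in: "s \<in> Zp \<Longrightarrow> xm s \<in> Iw" "s \<in> pZp 1 \<Longrightarrow> ym s \<in> Iw"
  "s \<in> Zp \<Longrightarrow> xm s \<in> K0"
  by (auto simp: xm_def ym_def Iw_mat2 K0_mat2)

lemma Iw_K0: "Iw \<subseteq> K0"
proof
  fix g :: "'a mat2" assume "g \<in> Iw"
  then show "g \<in> K0" by (cases g rule: mat2_cases) (auto simp: Iw_mat2 K0_mat2 intro: pZp_Zp)
qed

lemma Iw_K1: "Iw \<subseteq> K1"
proof
  fix g :: "'a mat2" assume "g \<in> Iw"
  then show "g \<in> K1" unfolding K1_Kd
    by (cases g rule: mat2_cases) (auto simp: Iw_mat2 Kd_mat2 intro: pZp_mono[of _ 0 "-1", simplified])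
qed

lemma principal_congruence_mat2:
  "mat2 a b c d \<in> principal_congruence l \<longleftrightarrow> a - 1 \<in> pZp (int l) \<and> b \<in> pZp (int l) \<and> c \<in> pZp (int l) \<and> d - 1 \<in> pZp (int l)"
  by (auto simp: principal_congruence_def forall_2 mat_1_mat2)

section \<open>Constituents of unramified data\<close>

context
  fixes l :: nat and V :: "'t::complex_vector set"
    and \<tau> :: "'p::prime_type mat2 \<Rightarrow> 't \<Rightarrow> 't"
    and W :: "'w::complex_vector set" and \<rho> :: "'p mat2 \<Rightarrow> 'w \<Rightarrow> 'w"
  assumes datum: "unramified_datum l V \<tau>"
    and constituent: "irreducible_constituent (GLsub K0) V \<tau> W \<rho>"
begin

lemma unramified_level: "l \<ge> 1" using datum by (simp add: unramified_datum_def)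

lemma unramified_rep: "representation (GLsub K0) W \<rho>" "W \<noteq> {0}"
  using constituent by (auto simp: irreducible_constituent_def irreducible_rep_def)

lemma unramified_trivial: "g \<in> J_grp 0 l \<Longrightarrow> w \<in> W \<Longrightarrow> \<rho> g w = w"
proof -
  assume g: "g \<in> J_grp 0 l" and w: "w \<in> W"
  obtain a b c d where g': "g = mat2 a b c d" by (rule mat2_cases)
  have "g \<in> principal_congruence l" using g by (simp add: g' J_grp_mat2 principal_congruence_mat2)
  then have "\<tau> g v = v" if "v \<in> V" for v
    using datum that by (simp add: unramified_datum_def acts_trivially_def)
  moreover have "g \<in> K0" using g by (simp add: J_grp_def Kd_def)
  ultimately show ?thesis using constituent_trivial[OF constituent _ _ w] by blast
qed

lemma unramified_nofix_N: "nofix (N_grp (int l - 1)) W \<rho>"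
proof -
  have rep: "representation (GLsub (Z_GL <#>\<^bsub>GL2\<^esub> K_GL)) V \<tau>"
    using datum by (simp add: unramified_datum_def irreducible_rep_def)
  have Zp: "s \<in> Zp" if "s \<in> pZp (int l - 1)" for s :: "'p padic"
    using pZp_Zp[OF that] unramified_level by simp
  have H': "xm s \<in> Z_GL <#>\<^bsub>GL2\<^esub> K_GL" if "s \<in> pZp (int l - 1)" for s :: "'p padic"
    using xm_in(3)[OF Zp[OF that]] K0_K_GL K_GL_ZK by blast
  have nf: "nofix (xm ` pZp (int l - 1)) V \<tau>"
    using datum Hom_from_triv_zero_iff[OF repD(1)[OF rep], of "N_grp (int l - 1)" \<tau>] repD(2)[OF rep H']
    by (auto simp: unramified_datum_def N_grp_def)
  have tr: "\<tau> (xm s) v = v" if "s \<in> pZp (int l - 1 + 1)" "v \<in> V" for s v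
    using datum that by (simp add: unramified_datum_def acts_trivially_def xm_def principal_congruence_mat2)
  show ?thesis unfolding N_grp_def
    by (rule constituent_nofix[OF constituent rep H' _ xm_add tr nf]) (auto intro: xm_in(3) Zp)
qed

text \<open>w(1) lies in K^0 and interchanges upper and lower unipotents of the same depth.\<close>

lemma unramified_nofix_Nbar: "nofix (Nbar_grp (int l - 1)) W \<rho>"
proof (rule nofix_conj[OF unramified_rep(1) unramified_nofix_N])
  show "N_grp (int l - 1) \<subseteq> (K0 :: 'p mat2 set)"
    "Nbar_grp (int l - 1) \<subseteq> (K0 :: 'p mat2 set)"
    unfolding K0_Kd using unramified_level by (intro N_grp_Kd Nbar_grp_Kd; simp)+
  show "wm 1 \<in> K0" "wm (- 1) \<in> K0" "wm (- 1) ** wm 1 = (mat 1 :: 'p mat2)"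
    by (auto simp: wm_def K0_mat2 mat_1_mat2)
  fix g :: "'p mat2" assume "g \<in> N_grp (int l - 1)"
  then obtain s where s: "g = xm s" "s \<in> pZp (int l - 1)" by (auto simp: N_grp_def)
  have "xm s ** wm 1 = wm 1 ** ym (- s)" by (simp add: xm_def ym_def wm_def)
  then show "\<exists>s'\<in>Nbar_grp (int l - 1). g ** wm 1 = wm 1 ** s'"
    using s pZp_uminus[OF s(2)] unfolding Nbar_grp_def by blast
qed

end

section \<open>Constituents of ramified data and the element (0, 1; p, 0)\<close>

lemma Pi_inverse: "inv\<^bsub>GL2\<^esub> (mat2 0 1 unif 0) = (mat2 0 (inverse unif) 1 0 :: 'p::prime_type mat2)"
  unfolding m_inv_def
proof (rule the_equality)
  let ?P = "mat2 0 1 unif 0 :: 'p mat2" and ?Q = "mat2 0 (inverse unif) 1 0 :: 'p mat2"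
  have PQ: "?P ** ?Q = mat 1" "?Q ** ?P = mat 1" by (simp_all add: mat_1_mat2)
  then show "?Q \<in> carrier GL2 \<and> ?P \<otimes>\<^bsub>GL2\<^esub> ?Q = \<one>\<^bsub>GL2\<^esub> \<and> ?Q \<otimes>\<^bsub>GL2\<^esub> ?P = \<one>\<^bsub>GL2\<^esub>" by (simp add: GL2_def)
  fix y assume "y \<in> carrier GL2 \<and> ?P \<otimes>\<^bsub>GL2\<^esub> y = \<one>\<^bsub>GL2\<^esub> \<and> y \<otimes>\<^bsub>GL2\<^esub> ?P = \<one>\<^bsub>GL2\<^esub>"
  then have "y ** ?P = mat 1" by (simp add: GL2_def)
  then have "(y ** ?P) ** ?Q = ?Q" by (simp only: matrix_mul_lid)
  then show "y = ?Q" unfolding matrix_mul_assoc[symmetric] PQ(1) matrix_mul_rid .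
qed

lemma I_GL_Z'I: "k \<in> I_GL \<Longrightarrow> k \<in> Z'_GL <#>\<^bsub>GL2\<^esub> I_GL"
proof -
  assume "k \<in> I_GL"
  moreover have "mat 1 \<in> (Z'_GL :: 'a mat2 set)" using generate.one[of GL2]
    by (simp add: Z'_GL_def GL2_def)
  ultimately show ?thesis using set_mult_GL2[of "mat 1" Z'_GL k I_GL] by simp
qed

lemma Pi_Z'I:
  "(mat2 0 1 unif 0 :: 'p::prime_type mat2) \<in> Z'_GL <#>\<^bsub>GL2\<^esub> I_GL"
  "(mat2 0 (inverse unif) 1 0 :: 'p mat2) \<in> Z'_GL <#>\<^bsub>GL2\<^esub> I_GL"
proof -
  have 1: "(mat2 0 1 unif 0 :: 'p mat2) \<in> Z'_GL" unfolding Z'_GL_def by (intro generate.incl) simp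
  have 2: "(mat2 0 (inverse unif) 1 0 :: 'p mat2) \<in> Z'_GL"
    unfolding Z'_GL_def Pi_inverse[symmetric] by (intro generate.inv) simp
  have 3: "mat 1 \<in> (I_GL :: 'p mat2 set)" using matgroupD(2)[OF matgroup_Iw] by (auto simp: Iw_def)
  have "g \<in> Z'_GL <#>\<^bsub>GL2\<^esub> I_GL" if "g \<in> Z'_GL" for g :: "'p mat2"
    using set_mult_GL2[OF that 3] by simp
  then show "(mat2 0 1 unif 0 :: 'p mat2) \<in> Z'_GL <#>\<^bsub>GL2\<^esub> I_GL"
    "(mat2 0 (inverse unif) 1 0 :: 'p mat2) \<in> Z'_GL <#>\<^bsub>GL2\<^esub> I_GL"
    using 1 2 by blast+
qed

context
  fixes l :: nat and V :: "'t::complex_vector set"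
    and \<tau> :: "'p::prime_type mat2 \<Rightarrow> 't \<Rightarrow> 't"
    and W :: "'w::complex_vector set" and \<sigma> :: "'p mat2 \<Rightarrow> 'w \<Rightarrow> 'w"
  assumes datum: "ramified_datum l V \<tau>"
    and constituent: "irreducible_constituent (GLsub Iw) V \<tau> W \<sigma>"
begin

lemma ramified_level: "l \<ge> 1" using datum by (simp add: ramified_datum_def)

lemma ramified_irreducible: "irreducible_rep (GLsub Iw) W \<sigma>"
  using constituent by (simp add: irreducible_constituent_def)

lemma ramified_trivial:
  assumes "mat2 a b c d \<in> Iw" "a - 1 \<in> pZp (int l)" "d - 1 \<in> pZp (int l)" "b \<in> pZp (int l)"
    "c \<in> pZp (int l + 1)" "w \<in> W"
  shows "\<sigma> (mat2 a b c d) w = w"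
proof (rule constituent_trivial[OF constituent assms(1) _ assms(6)])
  fix v assume "v \<in> V"
  moreover have "mat2 a b c d \<in> iwahori_congruence l" using assms
    by (simp add: iwahori_congruence_def Iw_def)
  ultimately show "\<tau> (mat2 a b c d) v = v" using datum
    by (simp add: ramified_datum_def acts_trivially_def)
qed

lemma ramified_rep: "representation (GLsub (Z'_GL <#>\<^bsub>GL2\<^esub> I_GL)) V \<tau>"
  using datum by (simp add: ramified_datum_def irreducible_rep_def)

lemma ramified_datum_nofix_N: "nofix (N_grp (int l - 1)) V \<tau>"
proof -
  have "g \<in> Z'_GL <#>\<^bsub>GL2\<^esub> I_GL" if "g \<in> N_grp (int l - 1)" for g :: "'p mat2"
    using that ramified_level xm_in(1)[OF pZp_Zp, of _ "int l - 1"] I_GL_Z'I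
    by (auto simp: N_grp_def Iw_def)
  then show ?thesis
    using datum Hom_from_triv_zero_iff[OF repD(1)[OF ramified_rep], of "N_grp (int l - 1)" \<tau>] repD(2)[OF ramified_rep]
    by (auto simp: ramified_datum_def)
qed

lemma ramified_nofix_N: "nofix (N_grp (int l - 1)) W \<sigma>"
proof -
  have Iw: "xm s \<in> Iw" if "s \<in> pZp (int l - 1)" for s :: "'p padic"
    using xm_in(1)[OF pZp_Zp[OF that]] ramified_level by simp
  have tr: "\<tau> (xm s) v = v" if s: "s \<in> pZp (int l - 1 + 1)" and v: "v \<in> V" for s v
  proof -
    have "xm s \<in> I_GL" using Iw[OF pZp_mono[OF s]] by (simp add: Iw_def)
    then have "xm s \<in> iwahori_congruence l" using s by (simp add: iwahori_congruence_def xm_def)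
    then show ?thesis using datum v by (simp add: ramified_datum_def acts_trivially_def)
  qed
  show ?thesis unfolding N_grp_def
    by (rule constituent_nofix[OF constituent ramified_rep _ Iw xm_add tr ramified_datum_nofix_N[unfolded N_grp_def]])
      (use Iw I_GL_Z'I in \<open>auto simp: Iw_def\<close>)
qed

text \<open>Conjugation by \<open>\<Pi> = (0, 1; p, 0)\<close>, which belongs to the group of the datum, exchanges the two
  unipotent filtrations.\<close>

lemma ramified_nofix_Nbar: "nofix (Nbar_grp (int l)) W \<sigma>"
proof -
  have Iw: "ym s \<in> Iw" if "s \<in> pZp (int l)" for s :: "'p padic"
    using xm_in(2)[OF pZp_mono[OF that]] ramified_level by simp
  have tr: "\<tau> (ym s) v = v" if s: "s \<in> pZp (int l + 1)" and v: "v \<in> V" for s v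
  proof -
    have "ym s \<in> I_GL" using Iw[OF pZp_mono[OF s]] by (simp add: Iw_def)
    then have "ym s \<in> iwahori_congruence l" using s by (simp add: iwahori_congruence_def ym_def)
    then show ?thesis using datum v by (simp add: ramified_datum_def acts_trivially_def)
  qed
  have "nofix (Nbar_grp (int l)) V \<tau>"
  proof (rule nofix_conj[OF ramified_rep ramified_datum_nofix_N])
    show "N_grp (int l - 1) \<subseteq> Z'_GL <#>\<^bsub>GL2\<^esub> (I_GL :: 'p mat2 set)"
      using ramified_level xm_in(1)[OF pZp_Zp, of _ "int l - 1"] I_GL_Z'I by (auto simp: N_grp_def Iw_def)
    show "Nbar_grp (int l) \<subseteq> Z'_GL <#>\<^bsub>GL2\<^esub> (I_GL :: 'p mat2 set)"
      using Iw I_GL_Z'I by (auto simp: Nbar_grp_def Iw_def)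
    show "mat2 0 (inverse unif) 1 0 ** mat2 0 1 unif 0 = (mat 1 :: 'p mat2)" by (simp add: mat_1_mat2)
    fix g :: "'p mat2" assume "g \<in> N_grp (int l - 1)"
    then obtain s where s: "g = xm s" "s \<in> pZp (int l - 1)" by (auto simp: N_grp_def)
    have "unif * s \<in> pZp (int l)" using s by (simp add: unif_pZp_iff)
    moreover have "xm s ** mat2 0 1 unif 0 = mat2 0 1 unif 0 ** ym (unif * s)" by (simp add: xm_def ym_def)
    ultimately show "\<exists>s'\<in>Nbar_grp (int l). g ** mat2 0 1 unif 0 = mat2 0 1 unif 0 ** s'"
      unfolding Nbar_grp_def s(1) by blast
  qed (rule Pi_Z'I)+
  then show ?thesis unfolding Nbar_grp_def
    by (intro constituent_nofix[OF constituent ramified_rep _ Iw ym_add tr])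
      (use Iw I_GL_Z'I in \<open>auto simp: Iw_def\<close>)
qed

end

section \<open>Conjugation by \<open>\<alpha>\<close>\<close>

definition conj_al :: "('p::prime_type) mat2 \<Rightarrow> 'p mat2" where
  "conj_al k = alpha ** k ** matrix_inv alpha"

lemma conj_al_mat2 [simp]: "conj_al (mat2 a b c d) = mat2 a (unif * b) (inverse unif * c) d"
  unfolding conj_al_def by (rule conj_alpha_mat2)

lemma conj_alpha_eq: "conj_alpha \<rho> = (\<lambda>k. \<rho> (conj_al k))"
  by (simp add: conj_alpha_def conj_al_def)

lemma conj_al_mult: "conj_al (g ** h) = conj_al g ** conj_al h"
proof -
  obtain a b c d where g: "g = mat2 a b c d" by (rule mat2_cases)
  obtain a' b' c' d' where h: "h = mat2 a' b' c' d'" by (rule mat2_cases)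
  show ?thesis by (simp add: g h field_simps)
qed

lemma conj_al_1 [simp]: "conj_al (mat 1) = mat 1" by (simp add: mat_1_mat2)

lemma conj_al_K1_iff: "conj_al g \<in> K0 \<longleftrightarrow> g \<in> K1" by (simp add: K1_iff conj_al_def)

lemma conj_al_surj: "\<exists>k. g = conj_al k"
proof -
  obtain a b c d where "g = mat2 a b c d" by (rule mat2_cases)
  then have "g = conj_al (mat2 a (inverse unif * b) (unif * c) d)" by simp
  then show ?thesis by blast
qed

lemma conj_alpha_rep: "representation (GLsub K0) V \<rho> \<Longrightarrow> representation (GLsub K1) V (conj_alpha \<rho>)"
  by (simp add: rep_GLsub conj_alpha_eq conj_al_K1_iff conj_al_mult)

lemma conj_alpha_irreducible:
  assumes "irreducible_rep (GLsub K0) V \<rho>" shows "irreducible_rep (GLsub K1) V (conj_alpha \<rho>)"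
proof -
  have "stable_subspace (GLsub K0) \<rho> U" if st: "stable_subspace (GLsub K1) (conj_alpha \<rho>) U" for U
  proof -
    have "\<rho> g v \<in> U" if g: "g \<in> K0" and v: "v \<in> U" for g v
    proof -
      obtain k where k: "g = conj_al k" using conj_al_surj by blast
      then have "k \<in> K1" using g by (simp add: conj_al_K1_iff[symmetric])
      then show ?thesis using st v by (simp add: stable_subspace_def conj_alpha_eq k)
    qed
    then show ?thesis using st by (simp add: stable_subspace_def)
  qed
  then show ?thesis using assms conj_alpha_rep by (auto simp: irreducible_rep_def)
qed

text \<open>\<alpha> multiplies the upper entry by p and divides the lower one by p, whence the
  opposite shifts for the two unipotent filtrations.\<close>

lemma conj_al_N: "conj_al ` N_grp r = N_grp (r + 1)"
proof -
  have "conj_al (xm s) = xm (unif * s)" for s :: "'a padic" by (simp add: xm_def)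
  then have "conj_al ` N_grp r = xm ` (\<lambda>s. unif * s) ` (pZp r :: 'a padic set)"
    by (simp add: N_grp_def image_image)
  also have "(\<lambda>s. unif * s) ` pZp r = (pZp (r + 1) :: 'a padic set)"
  proof
    show "pZp (r + 1) \<subseteq> (\<lambda>s. unif * s) ` (pZp r :: 'a padic set)"
    proof
      fix x :: "'a padic" assume "x \<in> pZp (r + 1)"
      then have "inverse unif * x \<in> pZp r" by (simp add: inverse_unif_pZp)
      moreover have "x = unif * (inverse unif * x)" by simp
      ultimately show "x \<in> (\<lambda>s. unif * s) ` pZp r" by blast
    qed
  qed (auto simp: unif_pZp_iff)
  finally show ?thesis by (simp add: N_grp_def)
qed

lemma conj_al_Nbar: "conj_al ` Nbar_grp (r + 1) = Nbar_grp r"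
proof -
  have "conj_al (ym s) = ym (inverse unif * s)" for s :: "'a padic" by (simp add: ym_def)
  then have "conj_al ` Nbar_grp (r + 1) = ym ` (\<lambda>s. inverse unif * s) ` (pZp (r + 1) :: 'a padic set)" by (simp add: Nbar_grp_def image_image)
  also have "(\<lambda>s. inverse unif * s) ` pZp (r + 1) = (pZp r :: 'a padic set)"
  proof
    show "pZp r \<subseteq> (\<lambda>s. inverse unif * s) ` (pZp (r + 1) :: 'a padic set)"
    proof
      fix x :: "'a padic" assume "x \<in> pZp r"
      then have "unif * x \<in> pZp (r + 1)" by (simp add: unif_pZp_iff)
      moreover have "x = inverse unif * (unif * x)" by simp
      ultimately show "x \<in> (\<lambda>s. inverse unif * s) ` pZp (r + 1)" by blast
    qed
  qed (auto simp: inverse_unif_pZp)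
  finally show ?thesis by (simp add: Nbar_grp_def)
qed

lemma conj_al_J: "conj_al g \<in> J_grp 0 r \<longleftrightarrow> g \<in> J_grp 1 r"
proof -
  obtain a b c d where g: "g = mat2 a b c d" by (rule mat2_cases)
  have e: "unif * b * (inverse unif * c) = b * c" by (simp add: field_simps)
  show ?thesis by (simp add: g J_grp_mat2 unif_pZp_iff inverse_unif_pZp e)
qed

lemma conj_alpha_acts_trivially: "acts_trivially (J_grp 1 r) V (conj_alpha \<rho>) \<longleftrightarrow> acts_trivially (J_grp 0 r) V \<rho>"
  unfolding acts_trivially_def conj_alpha_eq by (metis conj_al_J conj_al_surj)

lemma conj_alpha_conductor: "rep_conductor 1 V (conj_alpha \<rho>) = rep_conductor 0 V \<rho>"
  unfolding rep_conductor_def conj_alpha_acts_trivially ..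

lemma conj_alpha_nofix: "nofix S V (conj_alpha \<rho>) \<longleftrightarrow> nofix (conj_al ` S) V \<rho>"
  unfolding conj_alpha_eq by (rule nofix_image[symmetric])

lemma conj_alpha_Hom_to: "Hom_to_triv_zero S V (conj_alpha \<rho>) \<longleftrightarrow> Hom_to_triv_zero (conj_al ` S) V \<rho>"
  by (simp add: Hom_to_triv_zero_def Hom_rep_def conj_alpha_eq)

section \<open>Induction from the Iwahori subgroup\<close>

lemma sum_fun_app: "finite I \<Longrightarrow> (\<Sum>i\<in>I. g i) x = (\<Sum>i\<in>I. g i x)"
  by (induction I rule: finite_induct) auto

lemma ex_linear_functional:
  fixes w :: "'v::complex_vector"
  assumes "w \<noteq> 0"
  obtains \<phi> :: "'v::complex_vector \<Rightarrow> complex"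
    where "\<And>x y. \<phi> (x + y) = \<phi> x + \<phi> y"
    "\<And>c x. \<phi> (c *\<^sub>C x) = c *\<^sub>C \<phi> x" "\<phi> w \<noteq> 0"
proof -
  interpret vp: vector_space_pair "scaleC :: complex \<Rightarrow> 'v \<Rightarrow> 'v"
    "scaleC :: complex \<Rightarrow> complex \<Rightarrow> complex" ..
  have "\<not> complex_vector.dependent {w}" using assms by (simp add: complex_vector.dependent_single)
  then obtain g where g: "Vector_Spaces.linear scaleC scaleC g" "\<forall>x\<in>{w}. g x = (1::complex)"
    using vp.linear_independent_extend[of "{w}" "\<lambda>_. 1"] by blast
  show thesis
    by (rule that[of g])
      (use g in \<open>auto simp: Vector_Spaces.linear.axioms vp.linear_add vp.linear_scale\<close>)
qed

lemma addavg_of_fixed: "(\<And>s. s \<in> pZp e \<Longrightarrow> A s v = v) \<Longrightarrow> addavg e k (A :: 'p::prime_type padic \<Rightarrow> _) v = of_nat (CARD('p) ^ k) *\<^sub>C v"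
proof -
  assume A: "\<And>s. s \<in> pZp e \<Longrightarrow> A s v = v"
  have "of_nat j * unif powi e \<in> (pZp e :: 'p padic set)" for j by (intro pZp_Zp_mult) auto
  then show ?thesis unfolding addavg_def sum_const_scaleC[symmetric] using A by (intro sum.cong refl) blast
qed

text \<open>p^r times the order of matrices with integral diagonal, upper entry in p^(-\<delta>) and
  lower entry in p^\<delta>, whose elements of determinant 1 form K^\<delta>. In these terms
  \<open>J_grp\<close> consists of the elements of 1 + \<open>lat\<close> of determinant 1, which
  makes its normality in K^\<delta> visible.\<close>

definition lat :: "nat \<Rightarrow> int \<Rightarrow> 'p::prime_type mat2 set" where
  "lat \<delta> r = {N. N $ 1 $ 1 \<in> pZp r \<and> N $ 2 $ 2 \<in> pZp r \<and> N $ 1 $ 2 \<in> pZp (r - int \<delta>) \<and> N $ 2 $ 1 \<in> pZp (r + int \<delta>)}"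

lemma lat_mult: "M \<in> lat \<delta> r \<Longrightarrow> N \<in> lat \<delta> r' \<Longrightarrow> M ** N \<in> lat \<delta> (r + r')"
proof -
  assume M: "M \<in> lat \<delta> r" and N: "N \<in> lat \<delta> r'"
  have *: "x * y \<in> pZp t" if "x \<in> pZp a" "y \<in> pZp b" "t = a + b" for x y :: "'a padic" and a b t
    using pZp_mult[OF that(1,2)] that(3) by simp
  show ?thesis using M N
    by (cases M rule: mat2_cases; cases N rule: mat2_cases)
      (auto simp: lat_def intro!: pZp_add intro: *)
qed

lemma Kd_lat: "\<delta> \<le> 1 \<Longrightarrow> x \<in> Kd \<delta> \<Longrightarrow> x \<in> lat \<delta> 0"
  by (cases x rule: mat2_cases) (auto simp: Kd_mat2 lat_def)

lemma J_grp_lat: "\<delta> \<le> 1 \<Longrightarrow> g \<in> J_grp \<delta> r \<longleftrightarrow> g \<in> SL2 \<and> g - mat 1 \<in> lat \<delta> (int r)"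
  by (cases g rule: mat2_cases) (auto simp: J_grp_mat2 lat_def mat_1_mat2)

lemma matrix_add_rdistrib: "(B + C) ** A = B ** A + C ** (A :: 'a::semiring_1 ^ 'n ^ 'm)"
  by (simp add: vec_eq_iff matrix_matrix_mult_def sum.distrib distrib_right)

lemma J_grp_normal:
  fixes x g :: "'p::prime_type mat2"
  assumes "\<delta> \<le> 1" "x \<in> Kd \<delta>"
    "g \<in> J_grp \<delta> r" shows "x ** g ** adj2 x \<in> J_grp \<delta> r"
proof -
  note K = matgroupD[OF matgroup_Kd[OF assms(1), where 'a = 'p]]
  let ?N = "g - mat 1"
  have N: "g \<in> SL2" "?N \<in> lat \<delta> (int r)" using assms(3) J_grp_lat[OF assms(1)] by auto
  have "x ** (mat 1 + ?N) ** adj2 x = x ** adj2 x + x ** ?N ** adj2 x"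
    by (simp only: matrix_add_ldistrib matrix_add_rdistrib matrix_mul_rid)
  then have "x ** g ** adj2 x - mat 1 = x ** ?N ** adj2 x"
    using matgroup_adj2[OF matgroup_Kd[OF assms(1)] assms(2)] by simp
  moreover have "x ** ?N ** adj2 x \<in> lat \<delta> (int r)"
    using lat_mult[OF lat_mult[OF Kd_lat[OF assms(1,2)] N(2)] Kd_lat[OF assms(1) K(4)[OF assms(2)]]] by simp
  moreover have "x ** g ** adj2 x \<in> SL2" using K(1) K(4)[OF assms(2)] assms(2) N(1) by (intro SL2_mult)
  ultimately show ?thesis using J_grp_lat[OF assms(1), of "x ** g ** adj2 x" r] by simp
qed

text \<open>Treats K^0 and K^1 together: K is the union of I and I w0 u(p^b), and n is the conjugate
  of u by w0. The exponent e is such that u(p^e) acts trivially on W while n(p^e) fixes no nonzero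
  vector there.\<close>

locale iwahori_induction =
  fixes \<delta> :: nat and W :: "'w::complex_vector set"
    and \<sigma> :: "'p::prime_type mat2 \<Rightarrow> 'w \<Rightarrow> 'w"
    and w0 :: "'p mat2" and u n :: "'p padic \<Rightarrow> 'p mat2" and b e :: int
  assumes \<delta>: "\<delta> \<le> 1" and Iw_K: "Iw \<subseteq> (Kd \<delta> :: 'p mat2 set)"
    and irr: "irreducible_rep (GLsub Iw) W \<sigma>" and w0: "w0 \<in> Kd \<delta>"
    and u_add: "\<And>s t. u (s + t) = u s ** u t" and n_add: "\<And>s t. n (s + t) = n s ** n t"
    and u_Iw: "\<And>s. s \<in> pZp b \<Longrightarrow> u s \<in> Iw"
      and n_Iw: "\<And>s. s \<in> pZp (b + 1) \<Longrightarrow> n s \<in> Iw"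
    and w0_u: "\<And>s. w0 ** u s = n s ** w0" and be: "b + 1 \<le> e"
    and cover: "\<And>x. x \<in> Kd \<delta> \<Longrightarrow> x \<notin> Iw \<Longrightarrow> \<exists>i\<in>Iw. \<exists>z\<in>pZp b. x = i ** (w0 ** u z)"
    and u_triv: "\<And>s w. s \<in> pZp e \<Longrightarrow> w \<in> W \<Longrightarrow> \<sigma> (u s) w = w"
    and n_triv: "\<And>s w. s \<in> pZp (e + 1) \<Longrightarrow> w \<in> W \<Longrightarrow> \<sigma> (n s) w = w"
    and n_nofix: "nofix (n ` pZp e) W \<sigma>"
begin

abbreviation "K \<equiv> Kd \<delta>"
abbreviation "X \<equiv> Ind (GLsub K) Iw W \<sigma>"
abbreviation "R \<equiv> right_transl (GLsub K) :: 'p mat2 \<Rightarrow> ('p mat2 \<Rightarrow> 'w) \<Rightarrow> 'p mat2 \<Rightarrow> 'w"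
abbreviation "\<phi> \<equiv> phi_vec \<sigma>"

lemmas KG = matgroupD[OF matgroup_Kd[OF \<delta>, where 'a = 'p]]
lemmas K_adj = matgroup_adj2[OF matgroup_Kd[OF \<delta>, where 'a = 'p]]
lemmas IG = matgroupD[OF matgroup_Iw[where 'a = 'p]]

lemma srep: "representation (GLsub Iw) W \<sigma>" using irr by (simp add: irreducible_rep_def)

lemmas S = repD[OF srep] repV[OF srep]

lemma IK: "i \<in> Iw \<Longrightarrow> (i :: 'p mat2) \<in> K" using Iw_K by blast

lemma X_iff: "f \<in> X \<longleftrightarrow> (\<forall>x\<in>K. f x \<in> W) \<and> (\<forall>x. x \<notin> K \<longrightarrow> f x = 0) \<and> (\<forall>h\<in>Iw. \<forall>x\<in>K. f (h ** x) = \<sigma> h (f x))"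
  by (simp add: Ind_def GL2_def)

lemma XD: assumes "f \<in> X" shows "x \<in> K \<Longrightarrow> f x \<in> W"
  "x \<notin> K \<Longrightarrow> f x = 0"
  "h \<in> Iw \<Longrightarrow> x \<in> K \<Longrightarrow> f (h ** x) = \<sigma> h (f x)"
  using assms unfolding X_iff by blast+

lemma X_Iw: "f \<in> X \<Longrightarrow> h \<in> Iw \<Longrightarrow> f h = \<sigma> h (f (mat 1))"
  using XD(3)[of f h "mat 1"] KG(2) by simp

lemma R_eq: "R g f x = (if x \<in> K then f (x ** g) else 0)"
  by (simp add: right_transl_def GL2_def)

lemma Iw_mult_iff: "h \<in> Iw \<Longrightarrow> h ** x \<in> Iw \<longleftrightarrow> (x :: 'p mat2) \<in> Iw"
proof
  assume h: "h \<in> Iw" and "h ** x \<in> Iw"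
  then have "adj2 h ** (h ** x) \<in> Iw" using IG by blast
  then show "x \<in> Iw" using matgroup_adj2(1)[OF matgroup_Iw h] by (simp add: matrix_mul_assoc)
qed (rule IG(3))

lemma mult_Iw_iff: "h \<in> Iw \<Longrightarrow> x ** h \<in> Iw \<longleftrightarrow> (x :: 'p mat2) \<in> Iw"
proof
  assume h: "h \<in> Iw" and "x ** h \<in> Iw"
  then have "(x ** h) ** adj2 h \<in> Iw" using IG by blast
  then show "x \<in> Iw" using matgroup_adj2(2)[OF matgroup_Iw h] by (simp add: matrix_mul_assoc[symmetric])
qed (rule IG(3))

lemma X_subspace: "complex_vector.subspace X"
  unfolding complex_vector.subspace_def
proof (intro conjI ballI allI)
  show "0 \<in> X" unfolding X_iff using complex_vector.subspace_0[OF S(1)] clinear_on_0[OF S(1,2)] by simp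
  fix f assume f: "f \<in> X"
  show "c *\<^sub>C f \<in> X" for c
    unfolding X_iff using XD[OF f] complex_vector.subspace_scale[OF S(1)] clinear_onD(3)[OF S(2)]
      by (simp add: scaleC_fun_def)
  fix g assume g: "g \<in> X"
  show "f + g \<in> X"
    unfolding X_iff using XD[OF f] XD[OF g] complex_vector.subspace_add[OF S(1)] clinear_onD(2)[OF S(2)]
      by simp
qed

lemma X_rep: "representation (GLsub K) X R"
  unfolding rep_GLsub
proof (intro conjI ballI X_subspace)
  show "clinear_on X X (R g)" if g: "g \<in> K" for g
  proof -
    have "R g f \<in> X" if f: "f \<in> X" for f
      unfolding X_iff
    proof (intro conjI ballI allI impI)
      show "R g f x \<in> W" if "x \<in> K" for x using XD(1)[OF f KG(3)[OF that g]] that by (simp add: R_eq)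
      show "R g f x = 0" if "x \<notin> K" for x using that by (simp add: R_eq)
      show "R g f (h ** x) = \<sigma> h (R g f x)" if h: "h \<in> Iw" and x: "x \<in> K" for h x
        using XD(3)[OF f h KG(3)[OF x g]] KG(3)[OF IK[OF h] x] x by (simp add: R_eq matrix_mul_assoc)
    qed
    then show ?thesis by (auto simp: clinear_on_def R_eq fun_eq_iff scaleC_fun_def)
  qed
  show "R (mat 1) f = f" if "f \<in> X" for f using XD(2)[OF that] by (auto simp: R_eq fun_eq_iff)
  show "R (g ** h) f = R g (R h f)" if "g \<in> K" for g h f
    using KG(3) that by (auto simp: R_eq fun_eq_iff matrix_mul_assoc)
qed

lemma phi_eq: "\<phi> w x = (if x \<in> Iw then \<sigma> x w else 0)" by (simp add: phi_vec_def)

lemma phi_1: "w \<in> W \<Longrightarrow> \<phi> w (mat 1) = w" using IG(2) S(3) by (simp add: phi_eq)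

lemma phi_X: "w \<in> W \<Longrightarrow> \<phi> w \<in> X"
  unfolding X_iff using S(5) IK S(4) Iw_mult_iff complex_vector.subspace_0[OF S(1)] clinear_on_0[OF S(1,2)]
  by (auto simp: phi_eq)

lemma phi_nz: "w \<in> W \<Longrightarrow> w \<noteq> 0 \<Longrightarrow> \<phi> w \<noteq> 0"
  using phi_1[of w] by auto

lemma phi_zero: "\<phi> 0 = 0" using clinear_on_0[OF S(1,2)] by (auto simp: phi_eq fun_eq_iff)

lemma phi_scale: "w \<in> W \<Longrightarrow> \<phi> (c *\<^sub>C w) = c *\<^sub>C \<phi> w"
  using clinear_onD(3)[OF S(2)] by (auto simp: phi_eq fun_eq_iff scaleC_fun_def)

lemma phi_add: "w \<in> W \<Longrightarrow> w' \<in> W \<Longrightarrow> \<phi> (w + w') = \<phi> w + \<phi> w'"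
  using clinear_onD(2)[OF S(2)] by (auto simp: phi_eq fun_eq_iff)

lemma R_phi: "i \<in> Iw \<Longrightarrow> w \<in> W \<Longrightarrow> R i (\<phi> w) = \<phi> (\<sigma> i w)"
  using IK mult_Iw_iff S(4) by (auto simp: R_eq phi_eq fun_eq_iff)

lemma u_K: "s \<in> pZp e \<Longrightarrow> u s \<in> Iw" using u_Iw pZp_mono[of s e b] be by simp

lemma n_K: "s \<in> pZp e \<Longrightarrow> n s \<in> Iw" using n_Iw pZp_mono[of s e "b + 1"] be by simp

text \<open>Averaging over \<open>u (p\<^sup>e Z_p)\<close> projects onto the functions supported on \<open>I\<close>: these are
  invariant, while on the other coset the average is one over \<open>n (p\<^sup>e Z_p)\<close> in \<open>W\<close>.\<close>

lemma average:
  assumes f: "f \<in> X"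
  shows "addavg e 1 (\<lambda>s. R (u s)) f = of_nat CARD('p) *\<^sub>C \<phi> (f (mat 1))"
proof (rule ext)
  fix x
  have in_e: "of_nat j * unif powi e \<in> (pZp e :: 'p padic set)" for j by (intro pZp_Zp_mult) auto
  have L: "addavg e 1 (\<lambda>s. R (u s)) f x = (\<Sum>j<CARD('p). R (u (of_nat j * unif powi e)) f x)"
    by (simp add: addavg_def sum_fun_app)
  show "addavg e 1 (\<lambda>s. R (u s)) f x = (of_nat CARD('p) *\<^sub>C \<phi> (f (mat 1))) x"
  proof (cases "x \<in> Iw")
    case True
    have "R (u (of_nat j * unif powi e)) f x = \<sigma> x (f (mat 1))" for j
    proof -
      let ?s = "of_nat j * unif powi e :: 'p padic"
      have "R (u ?s) f x = \<sigma> x (f (u ?s))"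
        using XD(3)[OF f True IK[OF u_K[OF in_e]]] IK[OF True] by (simp add: R_eq)
      also have "f (u ?s) = f (mat 1)"
        using X_Iw[OF f u_K[OF in_e]] u_triv[OF in_e XD(1)[OF f KG(2)]] by simp
      finally show ?thesis .
    qed
    then show ?thesis unfolding L using True
      by (simp add: scaleC_fun_def phi_eq sum_const_scaleC del: sum_constant)
  next
    case x: False
    show ?thesis
    proof (cases "x \<in> K")
      case True
      then obtain i z where iz: "i \<in> Iw" "z \<in> pZp b" "x = i ** (w0 ** u z)" using cover[OF True x]
        by blast
      let ?y = "w0 ** u z"
      have y: "?y \<in> K" using KG(3) w0 IK[OF u_Iw[OF iz(2)]] by blast
      have "R (u s) f x = \<sigma> i (\<sigma> (n s) (f ?y))" if s: "s \<in> pZp e" for s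
      proof -
        have "x ** u s = i ** (w0 ** (u z ** u s))" by (simp add: iz(3) matrix_mul_assoc)
        also have "u z ** u s = u s ** u z" by (simp only: u_add[symmetric] add.commute)
        also have "i ** (w0 ** (u s ** u z)) = i ** (n s ** ?y)"
          by (simp only: matrix_mul_assoc[of w0] w0_u[of s]) (simp only: matrix_mul_assoc)
        finally have "R (u s) f x = f (i ** (n s ** ?y))" using True by (simp add: R_eq)
        then show ?thesis using XD(3)[OF f iz(1)] XD(3)[OF f n_K[OF s] y] KG(3)[OF IK[OF n_K[OF s]] y] by simp
      qed
      then have "addavg e 1 (\<lambda>s. R (u s)) f x = (\<Sum>j<CARD('p). \<sigma> i (\<sigma> (n (of_nat j * unif powi e)) (f ?y)))"
        unfolding L using in_e by simp
      also have "\<dots> = \<sigma> i (addavg e 1 (\<lambda>s. \<sigma> (n s)) (f ?y))"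
        unfolding addavg_def power_one_right
        by (rule clinear_on_sum[OF S(1) S(2)[OF iz(1)], symmetric]) (use S(5)[OF n_K[OF in_e] XD(1)[OF f y]] in auto)
      also have "addavg e 1 (\<lambda>s. \<sigma> (n s)) (f ?y) = 0"
      proof (rule addavg_0)
        show "addact e W (\<lambda>s. \<sigma> (n s))" by (rule rep_addact[OF srep n_K n_add])
        show "\<sigma> (n s) v = v" if "s \<in> pZp (e + int 1)" "v \<in> W" for s v using n_triv that by simp
        show "f ?y \<in> W" by (rule XD(1)[OF f y])
        show "nofix (pZp e) W (\<lambda>s. \<sigma> (n s))" using n_nofix by (simp only: nofix_image)
      qed
      finally show ?thesis using x clinear_on_0[OF S(1) S(2)[OF iz(1)]] by (simp add: scaleC_fun_def phi_eq)
    next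
      case False
      then show ?thesis unfolding L using x by (simp add: R_eq scaleC_fun_def phi_eq)
    qed
  qed
qed

text \<open>Invariance under u(p^e) forces f = \<phi>(f(1)) by the averaging formula, and then f(1)
  is a vector of W fixed by S'.\<close>

lemma nofix_X:
  assumes "nofix S' W \<sigma>" "S' \<subseteq> Iw" shows "nofix (u ` pZp e \<union> S') X R"
  unfolding nofix_def
proof (intro ballI impI)
  fix f assume f: "f \<in> X" and fx: "\<forall>g\<in>u ` pZp e \<union> S'. R g f = f"
  have "addavg e 1 (\<lambda>s. R (u s)) f = of_nat (CARD('p) ^ 1) *\<^sub>C f" using fx
    by (intro addavg_of_fixed) blast
  then have "of_nat CARD('p) *\<^sub>C f = of_nat CARD('p) *\<^sub>C \<phi> (f (mat 1))" using average[OF f]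
    by simp
  then have f1: "f = \<phi> (f (mat 1))"
    using complex_vector.scale_left_imp_eq[of "of_nat CARD('p)"] p_pos[where 'p='p]
      by (metis of_nat_eq_0_iff less_numeral_extra(3))
  have "f (mat 1) = 0"
  proof (rule nofixD[OF assms(1) XD(1)[OF f KG(2)]])
    fix g assume g: "g \<in> S'"
    then have gI: "g \<in> Iw" using assms(2) by blast
    have "R g f (mat 1) = f (mat 1)" using fx g by auto
    then show "\<sigma> g (f (mat 1)) = f (mat 1)" using X_Iw[OF f gI] KG(2) by (simp add: R_eq)
  qed
  then show "f = 0" using f1 phi_zero by simp
qed

text \<open>Induction on the cosets that carry f: subtracting the translate of \<phi>(f t) by t^(-1)
  removes the coset I t.\<close>

lemma X_generated:
  assumes U: "stable_subspace (GLsub K) R U" and phi: "\<And>w. w \<in> W \<Longrightarrow> \<phi> w \<in> U"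
    and T: "finite T" "T \<subseteq> K"
  shows "f \<in> X \<Longrightarrow> (\<And>x. x \<in> K \<Longrightarrow> f x \<noteq> 0 \<Longrightarrow> \<exists>t\<in>T. \<exists>i\<in>Iw. x = i ** t) \<Longrightarrow> f \<in> U"
  using T
proof (induction T arbitrary: f rule: finite_induct)
  case empty
  then have "f x = 0" for x using XD(2)[OF empty(1), of x] by (cases "x \<in> K") auto
  then have "f = 0" by (intro ext) simp
  moreover have "0 \<in> U" using U complex_vector.subspace_0 unfolding stable_subspace_def by blast
  ultimately show ?case by (simp only:)
next
  case (insert t T)
  have Us: "complex_vector.subspace U"
    and Ust: "\<And>g v. g \<in> K \<Longrightarrow> v \<in> U \<Longrightarrow> R g v \<in> U"
    using U by (auto simp: stable_subspace_def)
  have t: "t \<in> K" "adj2 t \<in> K" using insert.prems KG(4) by auto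
  let ?g = "R (adj2 t) (\<phi> (f t))"
  have ft: "f t \<in> W" by (rule XD(1)[OF insert.prems(1) t(1)])
  have gU: "?g \<in> U" by (intro Ust t phi ft)
  have gX: "?g \<in> X" by (rule repV[OF X_rep t(2) phi_X[OF ft]])
  have "f - ?g \<in> U"
  proof (rule insert.IH)
    show "f - ?g \<in> X" by (rule complex_vector.subspace_diff[OF X_subspace insert.prems(1) gX])
    show "T \<subseteq> K" using insert.prems by simp
    fix x assume x: "x \<in> K" "(f - ?g) x \<noteq> 0"
    have gx: "?g x = \<phi> (f t) (x ** adj2 t)" using x(1) by (simp add: R_eq)
    have xt: "x = x ** adj2 t ** t" using K_adj(1)[OF t(1)] by (simp add: matrix_mul_assoc[symmetric])
    show "\<exists>t\<in>T. \<exists>i\<in>Iw. x = i ** t"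
    proof (cases "x ** adj2 t \<in> Iw")
      case True
      then have "f x = ?g x" using XD(3)[OF insert.prems(1) True t(1)] xt by (simp add: gx phi_eq)
      then show ?thesis using x(2) by simp
    next
      case False
      then have "f x \<noteq> 0" using x(2) by (simp add: gx phi_eq)
      then obtain t' i where t': "t' \<in> insert t T" "i \<in> Iw" "x = i ** t'"
        using insert.prems(2)[OF x(1)] by blast
      have "t' \<noteq> t"
      proof
        assume "t' = t"
        then have "x ** adj2 t = i" using t'(3) K_adj(2)[OF t(1)] by (simp add: matrix_mul_assoc[symmetric])
        then show False using False t'(2) by simp
      qed
      then show ?thesis using t' by blast
    qed
  qed
  then have "(f - ?g) + ?g \<in> U" using gU by (rule complex_vector.subspace_add[OF Us])
  then show ?case by simp
qed

text \<open>After translation and averaging, a nonzero stable U contains some nonzero \<phi>(w). The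
  vectors w with \<phi>(w) in U form a stable subspace of W, hence all of W, and the translates of
  \<phi>(W) span everything.\<close>

lemma X_irreducible: "irreducible_rep (GLsub K) X R"
  unfolding irreducible_rep_def
proof (intro conjI X_rep allI impI)
  obtain w where w: "w \<in> W" "w \<noteq> 0"
    using irr complex_vector.subspace_0[OF S(1)] by (auto simp: irreducible_rep_def)
  show "X \<noteq> {0}" using phi_X[OF w(1)] phi_nz[OF w] by blast
  fix U assume UX: "U \<subseteq> X" and U: "stable_subspace (GLsub K) R U"
  have Us: "complex_vector.subspace U"
    and Ust: "\<And>g v. g \<in> K \<Longrightarrow> v \<in> U \<Longrightarrow> R g v \<in> U"
    using U by (auto simp: stable_subspace_def)
  show "U = {0} \<or> U = X"
  proof (cases "U = {0}")
    case False
    then obtain f where f: "f \<in> U" "f \<noteq> 0" using complex_vector.subspace_0[OF Us] by blast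
    then obtain x0 where x0: "f x0 \<noteq> 0" by (auto simp: fun_eq_iff)
    have fX: "f \<in> X" using f UX by blast
    have xK: "x0 \<in> K" using XD(2)[OF fX] x0 by blast
    let ?f = "R x0 f"
    have f1: "?f \<in> U" "?f (mat 1) = f x0" using Ust[OF xK f(1)] KG(2) by (simp_all add: R_eq)
    have "addavg e 1 (\<lambda>s. R (u s)) ?f \<in> U"
      unfolding addavg_def
      by (intro complex_vector.subspace_sum[OF Us] Ust f1 IK u_K pZp_Zp_mult) auto
    then have "of_nat CARD('p) *\<^sub>C \<phi> (f x0) \<in> U" using average[of ?f] f1 UX by auto
    from complex_vector.subspace_scale[OF Us this, of "inverse (of_nat CARD('p))"]
    have p0: "\<phi> (f x0) \<in> U" using p_pos[where 'p='p] by (simp add: scaleC_scaleC scaleC_one)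
    define W' where "W' = {w \<in> W. \<phi> w \<in> U}"
    have "stable_subspace (GLsub Iw) \<sigma> W'"
      unfolding stable_subspace_def complex_vector.subspace_def W'_def
      using complex_vector.subspace_0[OF S(1)] complex_vector.subspace_add[OF S(1)] complex_vector.subspace_scale[OF S(1)]
        complex_vector.subspace_0[OF Us] complex_vector.subspace_add[OF Us] complex_vector.subspace_scale[OF Us]
        phi_zero phi_add phi_scale S(5) Ust[OF IK] R_phi
      by (auto simp flip: R_phi)
    moreover have "W' \<subseteq> W" by (auto simp: W'_def)
    moreover have "f x0 \<in> W'" using p0 XD(1)[OF fX xK] by (simp add: W'_def)
    ultimately have "W' = W" using irr x0 unfolding irreducible_rep_def by blast
    then have phi: "\<phi> w \<in> U" if "w \<in> W" for w using that by (auto simp: W'_def)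
    \<comment> \<open>Finitely many representatives suffice: z matters only modulo p^(b+1), since
      u(r) with r in p^(b+1) passes to the left of w0 as n(r), an element of I.\<close>
    let ?T = "insert (mat 1) ((\<lambda>j. w0 ** u (of_nat j * unif powi b)) ` {..<CARD('p)})"
    have uz: "u (of_nat j * unif powi b) \<in> Iw" for j by (intro u_Iw pZp_Zp_mult) auto
    have cov: "\<exists>t\<in>?T. \<exists>i\<in>Iw. x = i ** t" if x: "x \<in> K" for x
    proof (cases "x \<in> Iw")
      case True
      then show ?thesis by (intro bexI[of _ "mat 1"] bexI[of _ x]) auto
    next
      case False
      then obtain i z where iz: "i \<in> Iw" "z \<in> pZp b" "x = i ** (w0 ** u z)" using cover[OF x] by blast
      from iz(2) obtain m r
        where mr: "m < CARD('p) ^ 1" "r \<in> pZp (b + int 1)" "z = of_nat m * unif powi b + r"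
        by (rule pZp_decomp)
      have "w0 ** u z = n r ** (w0 ** u (of_nat m * unif powi b))"
        unfolding mr(3) add.commute[of _ r] u_add matrix_mul_assoc w0_u[of r] ..
      then have "x = (i ** n r) ** (w0 ** u (of_nat m * unif powi b))" using iz(3)
        by (simp add: matrix_mul_assoc)
      moreover have "i ** n r \<in> Iw" using iz(1) n_Iw[of r] mr(2) by (intro IG(3)) auto
      moreover have "w0 ** u (of_nat m * unif powi b) \<in> ?T" using mr(1) by simp
      ultimately show ?thesis by blast
    qed
    have "f \<in> U" if "f \<in> X" for f
      using cov by (intro X_generated[OF U phi _ _ that, of ?T]) (auto intro: KG(2,3) w0 IK uz)
    then show ?thesis using UX by blast
  qed simp
qed

text \<open>Translation by g acts on the value at x through x g x^(-1), which lies in the same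
  congruence group by normality.\<close>

lemma X_acts_trivially:
  assumes "\<And>g w. g \<in> J_grp \<delta> r \<Longrightarrow> w \<in> W \<Longrightarrow> g \<in> Iw \<and> \<sigma> g w = w"
  shows "acts_trivially (J_grp \<delta> r) X R"
  unfolding acts_trivially_def
proof (intro ballI ext)
  fix g x :: "'p mat2" and f assume g: "g \<in> J_grp \<delta> r" and f: "f \<in> X"
  show "R g f x = f x"
  proof (cases "x \<in> K")
    case True
    let ?j = "x ** g ** adj2 x"
    have j: "?j \<in> Iw" "\<sigma> ?j (f x) = f x"
      using assms[OF J_grp_normal[OF \<delta> True g] XD(1)[OF f True]] by auto
    have "x ** g = ?j ** x" using K_adj(1)[OF True] by (simp add: matrix_mul_assoc[symmetric])
    then show ?thesis using XD(3)[OF f j(1) True] j(2) True by (simp add: R_eq)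
  qed (use XD(2)[OF f] in \<open>simp add: R_eq\<close>)
qed

lemma X_not_acts_trivially:
  assumes "nofix S' W \<sigma>" "S' \<subseteq> Iw" "S' \<subseteq> J" shows "\<not> acts_trivially J X R"
proof
  assume t: "acts_trivially J X R"
  obtain w where w: "w \<in> W" "w \<noteq> 0"
    using irr complex_vector.subspace_0[OF S(1)] by (auto simp: irreducible_rep_def)
  have "w = 0"
  proof (rule nofixD[OF assms(1) w(1)])
    fix g assume g: "g \<in> S'"
    then have gI: "g \<in> Iw" using assms(2) by blast
    have "R g (\<phi> w) = \<phi> w" using t g assms(3) phi_X[OF w(1)] by (auto simp: acts_trivially_def)
    then have "\<phi> (\<sigma> g w) (mat 1) = \<phi> w (mat 1)" using R_phi[OF gI w(1)] by simp
    then show "\<sigma> g w = w" using phi_1 w(1) S(5)[OF gI w(1)] by simp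
  qed
  then show False using w by simp
qed

text \<open>The functional is evaluation at y followed by a linear form on W: by hypothesis y S'
  y^(-1) lies in I and acts trivially on W.\<close>

lemma X_Hom_to_nonzero:
  assumes y: "y \<in> K"
    and S': "\<And>g. g \<in> S' \<Longrightarrow> \<exists>i\<in>Iw. y ** g = i ** y \<and> (\<forall>w\<in>W. \<sigma> i w = w)"
  shows "\<not> Hom_to_triv_zero S' X R"
proof
  assume h: "Hom_to_triv_zero S' X R"
  obtain w where w: "w \<in> W" "w \<noteq> 0"
    using irr complex_vector.subspace_0[OF S(1)] by (auto simp: irreducible_rep_def)
  obtain \<psi> :: "'w \<Rightarrow> complex"
    where \<psi>: "\<And>x y. \<psi> (x + y) = \<psi> x + \<psi> y"
    "\<And>c x. \<psi> (c *\<^sub>C x) = c *\<^sub>C \<psi> x" "\<psi> w \<noteq> 0"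
    using ex_linear_functional[OF w(2)] by blast
  have "(\<lambda>f. \<psi> (f y)) \<in> Hom_rep S' X R (UNIV :: complex set) (\<lambda>_ z. z)"
    unfolding Hom_rep_def
  proof (intro CollectI conjI ballI)
    show "clinear_on X UNIV (\<lambda>f. \<psi> (f y))"
      by (simp add: clinear_on_def \<psi>(1,2) scaleC_fun_def)
    fix g f assume g: "g \<in> S'" and f: "f \<in> X"
    obtain i where "i \<in> Iw" "y ** g = i ** y" "\<forall>w\<in>W. \<sigma> i w = w" using S'[OF g] by blast
    then have "R g f y = f y" using XD(1,3)[OF f] y by (simp add: R_eq)
    then show "\<psi> (R g f y) = \<psi> (f y)" by simp
  qed
  moreover have "R (adj2 y) (\<phi> w) \<in> X" by (rule repV[OF X_rep KG(4)[OF y] phi_X[OF w(1)]])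
  moreover have "R (adj2 y) (\<phi> w) y = w" using y K_adj(2)[OF y] phi_1[OF w(1)] by (simp add: R_eq)
  ultimately have "\<psi> w = 0" using h unfolding Hom_to_triv_zero_def by fastforce
  then show False using \<psi>(3) by simp
qed

end

section \<open>The four cases\<close>

text \<open>The sign of s^1 on the Iwahori subgroup undoes the twist in \<eta>_l, so \<eta> itself
  remains.\<close>

lemma legendre_twist_cancel:
  "d \<in> Zp_units \<Longrightarrow> of_int (legendre_p d) *\<^sub>C twist_legendre \<eta> d *\<^sub>C v = \<eta> d *\<^sub>C (v :: 'v::complex_vector)"
  using legendre_p_cases[of d] by (auto simp: twist_legendre_def scaleC_scaleC)

text \<open>The bound r - 2m >= 1 keeps the conjugates of K_r inside the Iwahori subgroup, where
  \<open>splitting_Iw\<close> gives the sign.\<close>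

lemma (in genuine_rep) f_vec_eta_space_Iw:
  assumes v: "v \<in> X" and Iw: "Iw \<subseteq> (K :: 'p mat2 set)" and r: "1 \<le> int r - 2 * int m"
    and eq: "\<And>a b c d. mat2 a b c d \<in> Iw \<Longrightarrow> b \<in> pZp (2 * int m) \<Longrightarrow> c \<in> pZp (int r - 2 * int m) \<Longrightarrow>
      of_int (if \<delta> = 0 then 1 else legendre_p d) *\<^sub>C \<rho> (mat2 a b c d) v = \<eta> d *\<^sub>C v"
  shows "f_vec m K \<rho>t v \<in> eta_space \<pi> \<eta> r"
proof (rule f_vec_eta_space[OF refl refl v])
  fix a b c d :: "'p padic"
  let ?t = "unif ^ m :: 'p padic"
  let ?k = "mat2 a (?t\<^sup>2 * b) (c * (inverse ?t)\<^sup>2) d"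
  assume "mat2 a b c d \<in> Kr r"
  then have k: "a * d - b * c = 1" "a \<in> Zp" "b \<in> Zp" "c \<in> pZp (int r)" "d \<in> Zp"
    by (auto simp: Kr_mat2)
  have "?t\<^sup>2 \<in> pZp (2 * int m)"
    using pZp_mult[OF unif_power_pZp[of m] unif_power_pZp[of m]] by (simp add: power2_eq_square)
  then have 1: "?t\<^sup>2 * b \<in> pZp (2 * int m)" using k(3) by (rule pZp_mult_Zp)
  have "(inverse ?t)\<^sup>2 \<in> pZp (- 2 * int m)"
    using pZp_mult[OF powi_pZp[of "- int m"] powi_pZp[of "- int m"]]
      by (simp add: power2_eq_square power_int_minus)
  then have 2: "c * (inverse ?t)\<^sup>2 \<in> pZp (int r - 2 * int m)" using pZp_mult[OF k(4)] by fastforce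
  have "?t\<^sup>2 * b * (c * (inverse ?t)\<^sup>2) = (?t * inverse ?t)\<^sup>2 * (b * c)"
    unfolding power2_eq_square by (simp only: ac_simps)
  then have bc: "?t\<^sup>2 * b * (c * (inverse ?t)\<^sup>2) = b * c" by simp
  then have I: "?k \<in> Iw"
    unfolding Iw_mat2 bc using k 1 2 r by (auto intro: pZp_Zp[OF 1] pZp_mono[OF 2])
  show "?k \<in> K \<and> of_int (s ?k) *\<^sub>C \<rho> ?k v = \<eta> d *\<^sub>C v"
    using I Iw eq[OF I 1 2] unfolding splitting_Iw[OF odd \<delta> s I] by blast
qed

context
  fixes \<eta> :: "'p::prime_type padic \<Rightarrow> complex" and s0 s1 :: "'p mat2 \<Rightarrow> int"
    and l :: nat
    and V :: "'t::complex_vector set" and \<tau> :: "'p mat2 \<Rightarrow> 't \<Rightarrow> 't"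
    and W :: "'w::complex_vector set" and \<rho> \<sigma> :: "'p mat2 \<Rightarrow> 'w \<Rightarrow> 'w"
  assumes odd_p: "odd CARD('p)"
    and eta: "\<eta> = (\<lambda>_. 1) \<or> \<eta> = (\<lambda>u. of_int (legendre_p u))"
    and s0: "is_splitting 0 s0" and s1: "is_splitting 1 s1"
begin

lemma eta_quadratic: "quadratic_char \<eta>" "quadratic_char (twist_legendre \<eta>)" "\<eta> 1 = 1"
  using eta quadratic_char_1 quadratic_char_legendre[OF odd_p] quadratic_char_mult
  by (auto simp: twist_legendre_def)

text \<open>N_(l-1) lies in J^0_(l-1) and has no nonzero fixed vector, which excludes conductors
  below l. For \<delta> = 0 the defect tests the same group as strong cuspidality.\<close>

lemma unramified_conductor:
  assumes D: "unramified_datum l V \<tau>" and C: "irreducible_constituent (GLsub K0) V \<tau> W \<rho>"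
    and sc: "strongly_cuspidal 0 W \<rho>"
  shows "rep_conductor 0 W \<rho> = l" "defect 0 W \<rho> = 0"
    "Hom_from_triv_zero (Nbar_grp (int l - 1)) W \<rho>"
proof -
  obtain n where n: "l = Suc n" using unramified_level[OF D C] by (cases l) auto
  obtain w where w: "w \<in> W" "w \<noteq> 0"
    using unramified_rep[OF D C] complex_vector.subspace_0[OF repD(1)[OF unramified_rep(1)[OF D C]]] by blast
  show "rep_conductor 0 W \<rho> = l"
    unfolding n
  proof (rule rep_conductor_eqI)
    show "acts_trivially (J_grp 0 (Suc n)) W \<rho>"
      using unramified_trivial[OF D C] unfolding n acts_trivially_def by blast
    show "\<not> acts_trivially (J_grp 0 n) W \<rho>"
      using w
        by (intro not_acts_trivially[OF unramified_nofix_N[OF D C]]) (auto simp: N_grp_def xm_def J_grp_mat2 n)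
  qed simp
  then show "defect 0 W \<rho> = 0" using sc by (simp add: defect_def strongly_cuspidal_def)
  have "Nbar_grp (int l - 1) \<subseteq> (K0 :: 'p mat2 set)"
    unfolding K0_Kd using unramified_level[OF D C] by (intro Nbar_grp_Kd) auto
  then show "Hom_from_triv_zero (Nbar_grp (int l - 1)) W \<rho>"
    using Hom_from_triv_zero_iff[OF repD(1)[OF unramified_rep(1)[OF D C]], of "Nbar_grp (int l - 1)" \<rho>]
      repD(2)[OF unramified_rep(1)[OF D C]] unramified_nofix_Nbar[OF D C] by blast
qed

lemma unramified_weight:
  assumes D: "unramified_datum l V \<tau>" and C: "irreducible_constituent (GLsub K0) V \<tau> W \<rho>"
    and \<mu>: "quadratic_char \<mu>"
  shows "centrally_compatible W \<rho> \<mu> \<Longrightarrow> \<exists>w\<in>weight_space W \<rho> \<mu>. w \<noteq> 0"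
    and "w \<in> weight_space W \<rho> \<mu> \<Longrightarrow> mat2 a b c d \<in> Iw \<Longrightarrow> b \<in> pZp (int l) \<Longrightarrow> c \<in> pZp (int l) \<Longrightarrow> \<rho> (mat2 a b c d) w = \<mu> d *\<^sub>C w"
    and "w \<in> weight_space W \<rho> \<mu> \<Longrightarrow> x \<in> Nbar_grp (int l) \<Longrightarrow> \<rho> x w = w"
proof -
  note l = unramified_level[OF D C] and rep = unramified_rep[OF D C]
  have tr: "\<rho> (mat2 a b c d) w = w"
    if "mat2 a b c d \<in> Iw" "a - 1 \<in> pZp (int l)" "d - 1 \<in> pZp (int l)" "b \<in> pZp (int l)"
    "c \<in> pZp (int l)" "w \<in> W" for a b c d w
    using that by (intro unramified_trivial[OF D C]) (auto simp: J_grp_mat2 Iw_mat2)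
  show "\<exists>w\<in>weight_space W \<rho> \<mu>. w \<noteq> 0" if "centrally_compatible W \<rho> \<mu>"
    by (rule weight_vector_exists[OF odd_p rep Iw_K0 l _ unramified_nofix_N[OF D C] \<mu> that])
      (auto intro!: tr intro: pZp_mono)
  show "\<rho> (mat2 a b c d) w = \<mu> d *\<^sub>C w"
    if "w \<in> weight_space W \<rho> \<mu>" "mat2 a b c d \<in> Iw" "b \<in> pZp (int l)"
      "c \<in> pZp (int l)"
    by (rule weight_action[OF rep(1) _ Iw_K0 l tr order_refl \<mu> that]) (simp add: K0_Kd matgroup_Kd)
  show "\<rho> x w = w" if "w \<in> weight_space W \<rho> \<mu>" "x \<in> Nbar_grp (int l)"
    using that
      by (intro unramified_trivial[OF D C]) (auto simp: Nbar_grp_def ym_def J_grp_mat2 weight_space_def)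
qed

lemma unramified_even:
  assumes ev: "even l" and D: "unramified_datum l V \<tau>"
    and C: "irreducible_constituent (GLsub K0) V \<tau> W \<rho>"
    and sc: "strongly_cuspidal 0 W \<rho>" and cc: "centrally_compatible W \<rho> \<eta>"
  shows "let m = l div 2; \<rho>t = genuine_lift s0 \<rho>; \<pi> = c_Ind cover (full_preimage K0) W \<rho>t in
        rep_conductor 0 W \<rho> = l \<and> defect 0 W \<rho> = 0 \<and>
        (\<forall>w\<in>weight_space W \<rho> \<eta>.
           f_vec m K0 \<rho>t w \<in> eta_space \<pi> \<eta> (2 * l) \<and>
           (\<forall>n\<in>Nbar_grp (int l). \<rho> n w = w) \<and>
           (w \<noteq> 0 \<longrightarrow> is_newvector \<pi> \<eta> (f_vec m K0 \<rho>t w))) \<and>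
        Hom_from_triv_zero (Nbar_grp (int l - 1)) W \<rho> \<and>
        has_eta_conductor \<pi> \<eta> (2 * l)"
proof -
  note l = unramified_level[OF D C] and rep = unramified_rep(1)[OF D C]
  interpret G: genuine_rep 0 s0 W \<rho>
    using odd_p s0 rep by unfold_locales (simp_all add: K0_Kd)
  have m: "2 * int (l div 2) = int l" using ev by auto
  have mem: "f_vec (l div 2) (Kd 0) (genuine_lift s0 \<rho>) w \<in> eta_space G.\<pi> \<eta> (2 * l)"
    if w: "w \<in> weight_space W \<rho> \<eta>" for w
  proof (rule G.f_vec_eta_space_Iw)
    show "w \<in> W" using w by (simp add: weight_space_def)
    show "Iw \<subseteq> (Kd 0 :: 'p mat2 set)" using Iw_K0 by (simp add: K0_Kd)
    show "1 \<le> int (2 * l) - 2 * int (l div 2)" using m l by simp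
    show "of_int (if (0::nat) = 0 then 1 else legendre_p d) *\<^sub>C \<rho> (mat2 a b c d) w = \<eta> d *\<^sub>C w"
      if "mat2 a b c d \<in> Iw" "b \<in> pZp (2 * int (l div 2))"
        "c \<in> pZp (int (2 * l) - 2 * int (l div 2))" for a b c d
      using unramified_weight(2)[OF D C eta_quadratic(1) w that(1)] that(2,3) unfolding m
        by (simp add: scaleC_one)
  qed
  \<comment> \<open>Both thresholds are l - 1 and the level is 2l - 1, so every n satisfies 2n <= l
    - 1 or 2l - 1 - 2n <= l - 1.\<close>
  have van: "f = 0" if f: "f \<in> eta_space G.\<pi> \<eta> (2 * l - 1)" for f
    by (rule G.eta_space_vanish_unipotents[OF f eta_quadratic(3) unramified_nofix_N[OF D C] _ unramified_nofix_Nbar[OF D C]])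
      (use l in auto)
  have nz: "f_vec (l div 2) (Kd 0) (genuine_lift s0 \<rho>) w \<noteq> 0"
    if "w \<in> weight_space W \<rho> \<eta>" "w \<noteq> 0" for w
    using that by (intro G.f_vec_nz[OF refl refl]) (auto simp: weight_space_def)
  note N = G.newvector_level[of "weight_space W \<rho> \<eta>"
    "f_vec (l div 2) (Kd 0) (genuine_lift s0 \<rho>)" \<eta> "2 * l",
      OF mem nz unramified_weight(1)[OF D C eta_quadratic(1) cc] _ quadratic_char_conductor[OF eta_quadratic(1)] van]
  show ?thesis
    unfolding Let_def K0_Kd
    using l N unramified_conductor[OF D C sc] mem unramified_weight(3)[OF D C eta_quadratic(1)] by simp
qed

lemma unramified_odd:
  assumes od: "odd l" and D: "unramified_datum l V \<tau>"
    and C: "irreducible_constituent (GLsub K0) V \<tau> W \<rho>"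
    and sc: "strongly_cuspidal 0 W \<rho>" and cc: "centrally_compatible W \<rho> (twist_legendre \<eta>)"
  shows "let m = (l - 1) div 2; \<rho>\<alpha> = conj_alpha \<rho>; \<rho>t = genuine_lift s1 \<rho>\<alpha>;
           \<pi> = c_Ind cover (full_preimage K1) W \<rho>t in
        rep_conductor 0 W \<rho> = l \<and> defect 0 W \<rho> = 0 \<and>
        strongly_cuspidal 1 W \<rho>\<alpha> \<and> rep_conductor 1 W \<rho>\<alpha> = l \<and> defect 1 W \<rho>\<alpha> = 0 \<and>
        (\<forall>w\<in>weight_space W \<rho> (twist_legendre \<eta>).
           f_vec m K1 \<rho>t w \<in> eta_space \<pi> \<eta> (2 * l) \<and>
           (\<forall>n\<in>Nbar_grp (int l). \<rho> n w = w) \<and>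
           (w \<noteq> 0 \<longrightarrow> is_newvector \<pi> \<eta> (f_vec m K1 \<rho>t w))) \<and>
        Hom_from_triv_zero (Nbar_grp (int l - 1)) W \<rho> \<and>
        has_eta_conductor \<pi> \<eta> (2 * l)"
proof -
  note l = unramified_level[OF D C] and rep = unramified_rep(1)[OF D C]
  let ?\<rho>\<alpha> = "conj_alpha \<rho>" and ?\<mu> = "twist_legendre \<eta>"
  have rep1: "representation (GLsub (Kd 1)) W ?\<rho>\<alpha>" using conj_alpha_rep[OF rep]
    by (simp only: K1_Kd)
  interpret G: genuine_rep 1 s1 W ?\<rho>\<alpha>
    using odd_p s1 rep1 by unfold_locales simp_all
  have m: "2 * int ((l - 1) div 2) = int l - 1" using od by (auto elim!: oddE)
  have mem: "f_vec ((l - 1) div 2) (Kd 1) (genuine_lift s1 ?\<rho>\<alpha>) w \<in> eta_space G.\<pi> \<eta> (2 * l)" if w: "w \<in> weight_space W \<rho> ?\<mu>" for w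
  proof (rule G.f_vec_eta_space_Iw)
    show "w \<in> W" using w by (simp add: weight_space_def)
    show "Iw \<subseteq> (Kd 1 :: 'p mat2 set)" using Iw_K1 by (simp only: K1_Kd)
    show "1 \<le> int (2 * l) - 2 * int ((l - 1) div 2)" unfolding m using l by simp
    show "of_int (if (1::nat) = 0 then 1 else legendre_p d) *\<^sub>C ?\<rho>\<alpha> (mat2 a b c d) w = \<eta> d *\<^sub>C w"
      if k: "mat2 a b c d \<in> Iw" "b \<in> pZp (2 * int ((l - 1) div 2))"
        "c \<in> pZp (int (2 * l) - 2 * int ((l - 1) div 2))" for a b c d
    proof -
      \<comment> \<open>As 2m = l - 1, b lies in p^(l-1) and c in p^(l+1); conjugation by \<alpha>
        brings both to p^l.\<close>
      have bc: "unif * b \<in> pZp (int l)" "inverse unif * c \<in> pZp (int l)"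
        using k(2,3) unfolding m unif_pZp_iff inverse_unif_pZp by (simp_all add: algebra_simps)
      have e: "unif * b * (inverse unif * c) = b * c" by (simp add: field_simps)
      have "mat2 a (unif * b) (inverse unif * c) d \<in> Iw"
        using k(1) bc l pZp_Zp[OF bc(1)] pZp_mono[OF bc(2), of 1] unfolding Iw_mat2 e by simp
      then have "?\<rho>\<alpha> (mat2 a b c d) w = ?\<mu> d *\<^sub>C w"
        unfolding conj_alpha_eq conj_al_mat2 by (rule unramified_weight(2)[OF D C eta_quadratic(2) w _ bc])
      then show ?thesis using legendre_twist_cancel[OF Iw_diag_units(2)[OF k(1)]] by simp
    qed
  qed
  \<comment> \<open>The thresholds l - 1, l - 1 of \<rho> become l - 2 for upper and l for lower
    unipotents.\<close>
  have nN: "nofix (N_grp (int l - 2)) W ?\<rho>\<alpha>" and nB: "nofix (Nbar_grp (int l)) W ?\<rho>\<alpha>"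
    unfolding conj_alpha_nofix
      using conj_al_N[of "int l - 2", where 'a = 'p] conj_al_Nbar[of "int l - 1", where 'a = 'p]
      unramified_nofix_N[OF D C] unramified_nofix_Nbar[OF D C] by simp_all
  have dich: "2 * n \<le> int l - 2 \<or> int (2 * l - 1) - 2 * n \<le> int l" for n using l by auto
  have van: "f = 0" if f: "f \<in> eta_space G.\<pi> \<eta> (2 * l - 1)" for f
    by (rule G.eta_space_vanish_unipotents[OF f eta_quadratic(3) nN _ nB]) (use l dich in auto)
  have nz: "f_vec ((l - 1) div 2) (Kd 1) (genuine_lift s1 ?\<rho>\<alpha>) w \<noteq> 0"
    if "w \<in> weight_space W \<rho> ?\<mu>" "w \<noteq> 0" for w
    using that by (intro G.f_vec_nz[OF refl refl]) (auto simp: weight_space_def)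
  note N = G.newvector_level[of "weight_space W \<rho> ?\<mu>"
    "f_vec ((l - 1) div 2) (Kd 1) (genuine_lift s1 ?\<rho>\<alpha>)" \<eta> "2 * l",
      OF mem nz unramified_weight(1)[OF D C eta_quadratic(2) cc] _ quadratic_char_conductor[OF eta_quadratic(1)] van]
  note U = unramified_conductor[OF D C sc]
  have cond: "rep_conductor 1 W ?\<rho>\<alpha> = l" using U(1) by (simp only: conj_alpha_conductor)
  have N_K1: "N_grp (int l - 2) \<subseteq> (Kd 1 :: 'p mat2 set)" using l by (intro N_grp_Kd) auto
  \<comment> \<open>Stated for every S containing N_(l-2), because strong cuspidality tests N_(l-3)
    and the defect tests N_(l-2), each intersected with K^1.\<close>
  have Hom: "Hom_to_triv_zero S W ?\<rho>\<alpha>" if "N_grp (int l - 2) \<subseteq> S" for S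
  proof (rule Hom_to_triv_zeroI[OF rep1 _ xm_add _ nN[unfolded N_grp_def] that[unfolded N_grp_def]])
    show "xm s \<in> Kd 1" if "s \<in> pZp (int l - 2)" for s :: "'p padic" using that N_K1
      by (auto simp: N_grp_def)
    show "?\<rho>\<alpha> (xm s) v = v" if "s \<in> pZp (int l - 2 + int 1)" "v \<in> W" for s v
    proof -
      have "conj_al (xm s) \<in> J_grp 0 l" using that(1) by (simp add: xm_def J_grp_mat2 unif_pZp_iff)
      then show ?thesis unfolding conj_alpha_eq using that(2) by (rule unramified_trivial[OF D C])
    qed
  qed
  have "acts_trivially (J_grp 0 l) W \<rho>"
    unfolding acts_trivially_def using unramified_trivial[OF D C] by blast
  then have "acts_trivially (J_grp 1 l) W ?\<rho>\<alpha>" by (simp only: conj_alpha_acts_trivially)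
  moreover have "N_grp (int l - 2) \<subseteq> N_grp (int l - 2 * int 1 - 1) \<inter> (Kd 1 :: 'p mat2 set)"
    using N_K1 N_grp_antimono[of "int l - 3" "int l - 2"] by auto
  ultimately have sc1: "strongly_cuspidal 1 W ?\<rho>\<alpha>"
    unfolding strongly_cuspidal_def cond using rep1 Hom by blast
  have "N_grp (int l - 2) \<subseteq> N_grp (int l - int 1 - 1) \<inter> (Kd 1 :: 'p mat2 set)" using N_K1
    by auto
  then have d1: "defect 1 W ?\<rho>\<alpha> = 0" unfolding defect_def cond using Hom by simp
  show ?thesis
    unfolding Let_def K1_Kd
    using l N U cond sc1 d1 mem unramified_weight(3)[OF D C eta_quadratic(2)] by (auto simp del: One_nat_def)
qed

text \<open>In K^1 the second coset is I w(1/p) Nbar_1. Conjugation by w(1/p) sends y(s) to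
  x(-s/p^2), so the exponent l + 1 for u corresponds to N_(l-1).\<close>

lemma ramified_induction_K1:
  assumes D: "ramified_datum l V \<tau>" and C: "irreducible_constituent (GLsub Iw) V \<tau> W \<sigma>"
  shows "iwahori_induction 1 W \<sigma> (wm (inverse unif)) ym (\<lambda>s. xm (- (s * (inverse unif)\<^sup>2))) 1 (int l + 1)"
proof
  note l = ramified_level[OF D C]
  have sc: "- (s * (inverse unif)\<^sup>2) \<in> pZp (r - 2)" if "s \<in> pZp r" for s :: "'p padic" and r
    using pZp_mult[OF that pZp_mult[OF powi_pZp[of "-1"] powi_pZp[of "-1"]]]
      by (simp add: power2_eq_square power_int_minus)
  show "(1::nat) \<le> 1" ..
  show "Iw \<subseteq> (Kd 1 :: 'p mat2 set)" using Iw_K1 by (simp only: K1_Kd)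
  show "irreducible_rep (GLsub Iw) W \<sigma>" by (rule ramified_irreducible[OF D C])
  show "wm (inverse unif) \<in> (Kd 1 :: 'p mat2 set)"
    using powi_pZp[of "-1", where 'a = 'p] by (simp add: wm_def Kd_mat2 power_int_minus)
  show "ym (s + t) = ym s ** ym t" for s t :: "'p padic" by (rule ym_add)
  show "xm (- ((s + t) * (inverse unif)\<^sup>2)) = xm (- (s * (inverse unif)\<^sup>2)) ** xm (- (t * (inverse unif)\<^sup>2))" for s t :: "'p padic"
    by (simp add: xm_add[symmetric] algebra_simps)
  show "ym s \<in> Iw" if "s \<in> pZp 1" for s :: "'p padic" using that by (rule xm_in(2))
  show "xm (- (s * (inverse unif)\<^sup>2)) \<in> Iw" if "s \<in> pZp (1 + 1)" for s :: "'p padic"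
    using sc[OF that] by (intro xm_in(1)) simp
  show "wm (inverse unif) ** ym s = xm (- (s * (inverse unif)\<^sup>2)) ** wm (inverse unif)"
    for s :: "'p padic"
    by (simp add: wm_def ym_def xm_def power2_eq_square)
  show "1 + 1 \<le> int l + 1" using l by simp
  show "\<sigma> (ym s) w = w" if "s \<in> pZp (int l + 1)" "w \<in> W" for s w
    unfolding ym_def using that pZp_mono[OF that(1), of 1]
      by (intro ramified_trivial[OF D C]) (auto simp: Iw_mat2)
  show "\<sigma> (xm (- (s * (inverse unif)\<^sup>2))) w = w" if "s \<in> pZp (int l + 1 + 1)" "w \<in> W"
    for s w
    unfolding xm_def using that sc[OF that(1)] pZp_Zp[OF sc[OF that(1)]]
      by (intro ramified_trivial[OF D C]) (auto simp: Iw_mat2)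
  show "nofix ((\<lambda>s. xm (- (s * (inverse unif)\<^sup>2))) ` pZp (int l + 1)) W \<sigma>"
  proof (rule nofix_mono[OF ramified_nofix_N[OF D C]])
    show "N_grp (int l - 1) \<subseteq> (\<lambda>s. xm (- (s * (inverse unif)\<^sup>2))) ` (pZp (int l + 1) :: 'p padic set)"
    proof
      fix g :: "'p mat2" assume "g \<in> N_grp (int l - 1)"
      then obtain s where s: "g = xm s" "s \<in> pZp (int l - 1)" by (auto simp: N_grp_def)
      have "- (s * unif\<^sup>2) \<in> pZp (int l - 1 + 2)"
        using pZp_mult[OF s(2) unif_power_pZp[of 2]] by simp
      then have "- (s * unif\<^sup>2) \<in> pZp (int l + 1)" by (simp add: add.commute)
      moreover have "unif\<^sup>2 * (inverse unif)\<^sup>2 = (1 :: 'p padic)"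
        by (simp add: power_mult_distrib[symmetric])
      then have "xm s = xm (- (- (s * unif\<^sup>2) * (inverse unif)\<^sup>2))" by (simp add: mult.assoc)
      ultimately show "g \<in> (\<lambda>s. xm (- (s * (inverse unif)\<^sup>2))) ` pZp (int l + 1)"
        unfolding s(1) by (intro image_eqI[of _ _ "- (s * unif\<^sup>2)"])
    qed
  qed
  show "\<exists>i\<in>Iw. \<exists>z\<in>pZp 1. x = i ** (wm (inverse unif) ** ym z)"
    if x: "x \<in> Kd 1" "x \<notin> Iw" for x :: "'p mat2"
  proof -
    obtain a b c d where x': "x = mat2 a b c d" by (rule mat2_cases)
    have k: "a * d - b * c = 1" "a \<in> Zp" "b \<in> pZp (- 1)" "c \<in> pZp 1" "d \<in> Zp" using x(1)
      by (auto simp: x' Kd_mat2)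
    \<comment> \<open>Outside I the upper right entry has valuation exactly -1, so z = a/b lies in p
      Z_p; it is the value that matches the upper left entry.\<close>
    have "b \<notin> Zp" using x(2) k by (auto simp: x' Iw_mat2)
    then have ub: "unif * b \<in> Zp_units" "b \<noteq> 0"
      using k(3) unif_pZp_iff[of b 0] unif_pZp_iff[of b 1] by (auto simp: Zp_units_iff)
    have ib: "inverse (unif * b) \<in> Zp" by (intro Zp_units_Zp Zp_units_inverse ub)
    let ?z = "a * inverse b"
    have z: "?z \<in> pZp 1"
    proof -
      have "?z = unif * (a * inverse (unif * b))" by simp
      then show ?thesis using pZp_mult_Zp[OF unif_pZp Zp_mult[OF k(2) ib]] by (simp only:)
    qed
    let ?i = "mat2 (unif * b) 0 (unif * d) (inverse (unif * b))"
    have i: "?i \<in> Iw"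
      unfolding Iw_mat2
    proof (intro conjI)
      show "unif * b * inverse (unif * b) - 0 * (unif * d) = 1"
        using right_inverse[OF Zp_units_nz[OF ub(1)]] by (simp only: mult_zero_left diff_zero)
    qed (use ib k Zp_units_Zp[OF ub(1)] pZp_mult_Zp[OF unif_pZp k(5)] in auto)
    have "c = d * ?z - inverse b"
    proof -
      have "c = (b * c) * inverse b" using ub(2) by (simp add: field_simps)
      also have "b * c = a * d - 1" using k(1) by (simp add: algebra_simps)
      finally show ?thesis by (simp add: algebra_simps)
    qed
    then have "x = ?i ** (wm (inverse unif) ** ym ?z)"
      using ub by (simp add: x' wm_def ym_def) (simp add: field_simps)
    then show ?thesis using i z by blast
  qed
qed

text \<open>In K^0 the second coset is I w(1) N_0, and w(1) sends x(s) to y(-s). The exponent l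
  works because N_l acts trivially on W while Nbar_l fixes no nonzero vector.\<close>

lemma ramified_induction_K0:
  assumes D: "ramified_datum l V \<tau>" and C: "irreducible_constituent (GLsub Iw) V \<tau> W \<sigma>"
  shows "iwahori_induction 0 W \<sigma> (wm 1) xm (\<lambda>s. ym (- s)) 0 (int l)"
proof
  note l = ramified_level[OF D C]
  show "(0::nat) \<le> 1" by simp
  show "Iw \<subseteq> (Kd 0 :: 'p mat2 set)" using Iw_K0 by (simp only: K0_Kd)
  show "irreducible_rep (GLsub Iw) W \<sigma>" by (rule ramified_irreducible[OF D C])
  show "wm 1 \<in> (Kd 0 :: 'p mat2 set)" by (simp add: wm_def Kd_mat2 Zp_uminus)
  show "xm (s + t) = xm s ** xm t" for s t :: "'p padic" by (rule xm_add)
  show "ym (- (s + t)) = ym (- s) ** ym (- t)" for s t :: "'p padic" by (simp add: ym_add[symmetric])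
  show "xm s \<in> Iw" if "s \<in> pZp 0" for s :: "'p padic" using that by (intro xm_in(1)) simp
  show "ym (- s) \<in> Iw" if "s \<in> pZp (0 + 1)" for s :: "'p padic" using that by (intro xm_in(2)) simp
  show "wm 1 ** xm s = ym (- s) ** wm 1" for s :: "'p padic" by (simp add: wm_def ym_def xm_def)
  show "0 + 1 \<le> int l" using l by simp
  show "\<sigma> (xm s) w = w" if "s \<in> pZp (int l)" "w \<in> W" for s w
    unfolding xm_def using that pZp_Zp[OF that(1)] by (intro ramified_trivial[OF D C]) (auto simp: Iw_mat2)
  show "\<sigma> (ym (- s)) w = w" if "s \<in> pZp (int l + 1)" "w \<in> W" for s w
    unfolding ym_def using that pZp_mono[OF that(1), of 1]
      by (intro ramified_trivial[OF D C]) (auto simp: Iw_mat2)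
  show "nofix ((\<lambda>s. ym (- s)) ` pZp (int l)) W \<sigma>"
  proof (rule nofix_mono[OF ramified_nofix_Nbar[OF D C]])
    show "Nbar_grp (int l) \<subseteq> (\<lambda>s. ym (- s)) ` (pZp (int l) :: 'p padic set)"
    proof
      fix g :: "'p mat2" assume "g \<in> Nbar_grp (int l)"
      then obtain s where s: "g = ym s" "s \<in> pZp (int l)" by (auto simp: Nbar_grp_def)
      then show "g \<in> (\<lambda>s. ym (- s)) ` pZp (int l)" by (intro image_eqI[of _ _ "- s"]) auto
    qed
  qed
  show "\<exists>i\<in>Iw. \<exists>z\<in>pZp 0. x = i ** (wm 1 ** xm z)"
    if x: "x \<in> Kd 0" "x \<notin> Iw" for x :: "'p mat2"
  proof -
    obtain a b c d where x': "x = mat2 a b c d" by (rule mat2_cases)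
    have k: "a * d - b * c = 1" "a \<in> Zp" "b \<in> Zp" "c \<in> Zp" "d \<in> Zp" using x(1)
      by (auto simp: x' Kd_mat2)
    have uc: "c \<in> Zp_units" using x(2) k by (auto simp: x' Iw_mat2 Zp_units_iff)
    have ic: "inverse c \<in> Zp" "c \<noteq> 0"
      using Zp_units_Zp[OF Zp_units_inverse[OF uc]] Zp_units_nz[OF uc] .
    let ?z = "d * inverse c" and ?i = "mat2 (- inverse c) (- a) 0 (- c)"
    have i: "?i \<in> Iw" using ic k by (auto simp: Iw_mat2)
    have "b = a * ?z - inverse c"
    proof -
      have "b * c = a * d - 1" using k(1) by (simp add: algebra_simps)
      then have "(b * c) * inverse c = (a * d - 1) * inverse c" by simp
      then show ?thesis using ic(2) by (simp add: algebra_simps)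
    qed
    then have "x = ?i ** (wm 1 ** xm ?z)" using ic(2) by (simp add: x' wm_def xm_def)
    moreover have "?z \<in> pZp 0" using k ic by auto
    ultimately show ?thesis using i by blast
  qed
qed

lemma ramified_weight:
  assumes D: "ramified_datum l V \<tau>" and C: "irreducible_constituent (GLsub Iw) V \<tau> W \<sigma>"
    and \<mu>: "quadratic_char \<mu>"
  shows "centrally_compatible W \<sigma> \<mu> \<Longrightarrow> \<exists>w\<in>weight_space W \<sigma> \<mu>. w \<noteq> 0"
    and "w \<in> weight_space W \<sigma> \<mu> \<Longrightarrow> mat2 a b c d \<in> Iw \<Longrightarrow> b \<in> pZp (int l) \<Longrightarrow> c \<in> pZp (int l + 1) \<Longrightarrow> \<sigma> (mat2 a b c d) w = \<mu> d *\<^sub>C w"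
proof -
  note l = ramified_level[OF D C] and irr = ramified_irreducible[OF D C]
  have rep: "representation (GLsub Iw) W \<sigma>" "W \<noteq> {0}" using irr
    by (auto simp: irreducible_rep_def)
  show "\<exists>w\<in>weight_space W \<sigma> \<mu>. w \<noteq> 0" if "centrally_compatible W \<sigma> \<mu>"
    by (rule weight_vector_exists[OF odd_p rep order_refl l ramified_trivial[OF D C] ramified_nofix_N[OF D C] \<mu> that])
  show "\<sigma> (mat2 a b c d) w = \<mu> d *\<^sub>C w"
    if "w \<in> weight_space W \<sigma> \<mu>" "mat2 a b c d \<in> Iw" "b \<in> pZp (int l)"
      "c \<in> pZp (int l + 1)"
    by (rule weight_action[OF rep(1) matgroup_Iw order_refl l ramified_trivial[OF D C] _ \<mu> that]) simp_all
qed

lemma ramified_even: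
  assumes ev: "even l" and D: "ramified_datum l V \<tau>"
    and C: "irreducible_constituent (GLsub Iw) V \<tau> W \<sigma>"
    and cc: "centrally_compatible W \<sigma> (twist_legendre \<eta>)"
  shows "let m = l div 2; X = Ind (GLsub K1) Iw W \<sigma>; R = right_transl (GLsub K1);
           Rt = genuine_lift s1 R; \<pi> = c_Ind cover (full_preimage K1) X Rt in
        irreducible_rep (GLsub K1) X R \<and> strongly_cuspidal 1 X R \<and>
        rep_conductor 1 X R = l + 1 \<and> defect 1 X R = 1 \<and>
        (\<forall>w\<in>weight_space W \<sigma> (twist_legendre \<eta>).
           phi_vec \<sigma> w \<in> X \<and>
           (\<forall>n\<in>N_grp (int l). R n (phi_vec \<sigma> w) = phi_vec \<sigma> w) \<and>
           (\<forall>n\<in>Nbar_grp (int l + 1). R n (phi_vec \<sigma> w) = phi_vec \<sigma> w) \<and>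
           (\<forall>u\<in>Zp_units. R (hm u) (phi_vec \<sigma> w) = twist_legendre \<eta> u *\<^sub>C phi_vec \<sigma> w) \<and>
           f_vec m K1 Rt (phi_vec \<sigma> w) \<in> eta_space \<pi> \<eta> (2 * l + 1) \<and>
           (w \<noteq> 0 \<longrightarrow> is_newvector \<pi> \<eta> (f_vec m K1 Rt (phi_vec \<sigma> w)))) \<and>
        Hom_from_triv_zero (Nbar_grp (int l)) X R \<and>
        has_eta_conductor \<pi> \<eta> (2 * l + 1)"
proof -
  note l1 = ramified_level[OF D C]
  have l: "2 \<le> l" using l1 ev by (cases "l = 1") auto
  let ?\<mu> = "twist_legendre \<eta>" and ?w0 = "wm (inverse unif) :: 'p mat2"
  interpret I: iwahori_induction 1 W \<sigma> ?w0 ym "\<lambda>s. xm (- (s * (inverse unif)\<^sup>2))" 1 "int l + 1"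
    by (rule ramified_induction_K1[OF D C])
  interpret G: genuine_rep 1 s1 I.X I.R
    using odd_p s1 I.X_rep by unfold_locales simp_all
  have wW: "w \<in> W" if "w \<in> weight_space W \<sigma> ?\<mu>" for w using that
    by (simp add: weight_space_def)
  have m: "2 * int (l div 2) = int l" using ev by auto
  have mem: "f_vec (l div 2) (Kd 1) (genuine_lift s1 I.R) (phi_vec \<sigma> w) \<in> eta_space G.\<pi> \<eta> (2 * l + 1)"
    if w: "w \<in> weight_space W \<sigma> ?\<mu>" for w
  proof (rule G.f_vec_eta_space_Iw[OF I.phi_X[OF wW[OF w]] I.Iw_K])
    show "1 \<le> int (2 * l + 1) - 2 * int (l div 2)" using m l by simp
    show "of_int (if (1::nat) = 0 then 1 else legendre_p d) *\<^sub>C I.R (mat2 a b c d) (phi_vec \<sigma> w) = \<eta> d *\<^sub>C phi_vec \<sigma> w"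
      if k: "mat2 a b c d \<in> Iw" "b \<in> pZp (2 * int (l div 2))"
        "c \<in> pZp (int (2 * l + 1) - 2 * int (l div 2))" for a b c d
    proof -
      have "\<sigma> (mat2 a b c d) w = ?\<mu> d *\<^sub>C w"
        using k unfolding m by (intro ramified_weight(2)[OF D C eta_quadratic(2) w]) simp_all
      then have "I.R (mat2 a b c d) (phi_vec \<sigma> w) = ?\<mu> d *\<^sub>C phi_vec \<sigma> w"
        using I.R_phi[OF k(1) wW[OF w]] I.phi_scale[OF wW[OF w]] by simp
      then show ?thesis using legendre_twist_cancel[OF Iw_diag_units(2)[OF k(1)]] by simp
    qed
  qed
  have ym_Iw: "Nbar_grp (int l) \<subseteq> (Iw :: 'p mat2 set)" using l
    by (auto simp: Nbar_grp_def intro!: xm_in(2) elim: pZp_mono)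
  \<comment> \<open>u(p^(l+1)) is Nbar_(l+1), contained in Nbar_l, so Nbar_l alone both confines f
    to I and rules out its value at 1.\<close>
  have nB: "nofix (Nbar_grp (int l)) I.X I.R"
    by (rule nofix_mono[OF I.nofix_X[OF ramified_nofix_Nbar[OF D C] ym_Iw]])
      (use Nbar_grp_antimono[of "int l" "int l + 1", where 'b = 'p] in \<open>simp add: Nbar_grp_def\<close>)
  have N_K: "N_grp (int l - 2) \<subseteq> (Kd 1 :: 'p mat2 set)"
    and Nbar_K: "Nbar_grp (int l) \<subseteq> (Kd 1 :: 'p mat2 set)"
    using l by (intro N_grp_Kd Nbar_grp_Kd; simp)+
  \<comment> \<open>Conjugation by \<open>?w0\<close> turns y(s) into x(-s/p^2), hence Nbar_l into
    N_(l-2).\<close>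
  have nN: "nofix (N_grp (int l - 2)) I.X I.R"
  proof (rule nofix_conj[OF I.X_rep nB Nbar_K N_K I.w0 I.KG(4)[OF I.w0]])
    show "adj2 ?w0 ** ?w0 = mat 1" by (rule I.K_adj(1)[OF I.w0])
    fix g :: "'p mat2" assume "g \<in> Nbar_grp (int l)"
    then obtain s where s: "g = ym s" "s \<in> pZp (int l)" by (auto simp: Nbar_grp_def)
    have "- (s * (inverse unif)\<^sup>2) \<in> pZp (int l - 2)"
      using pZp_mult[OF s(2) pZp_mult[OF powi_pZp[of "-1"] powi_pZp[of "-1"]]]
        by (simp add: power2_eq_square power_int_minus)
    moreover have "ym s ** ?w0 = ?w0 ** xm (- (s * (inverse unif)\<^sup>2))"
      by (simp add: wm_def xm_def ym_def power2_eq_square)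
    ultimately show "\<exists>s'\<in>N_grp (int l - 2). g ** ?w0 = ?w0 ** s'" unfolding N_grp_def s(1)
      by blast
  qed
  \<comment> \<open>Only 2n = l - 1 could fail, and this is impossible for even l.\<close>
  have dich: "2 * n \<le> int l - 2 \<or> int (2 * l + 1 - 1) - 2 * n \<le> int l" for n
    using ev by (auto elim!: evenE)
  have van: "f = 0" if f: "f \<in> eta_space G.\<pi> \<eta> (2 * l + 1 - 1)" for f
    by (rule G.eta_space_vanish_unipotents[OF f eta_quadratic(3) nN _ nB]) (use l dich in auto)
  have nz: "f_vec (l div 2) (Kd 1) (genuine_lift s1 I.R) (phi_vec \<sigma> w) \<noteq> 0"
    if "w \<in> weight_space W \<sigma> ?\<mu>" "w \<noteq> 0" for w
    using that wW by (intro G.f_vec_nz[OF refl refl] I.phi_X I.phi_nz) auto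
  note N = G.newvector_level[of "weight_space W \<sigma> ?\<mu>"
    "\<lambda>w. f_vec (l div 2) (Kd 1) (genuine_lift s1 I.R) (phi_vec \<sigma> w)" \<eta> "2 * l + 1",
      OF mem nz ramified_weight(1)[OF D C eta_quadratic(2) cc] _ quadratic_char_conductor[OF eta_quadratic(1)] van]
  have triv: "acts_trivially (J_grp 1 (Suc l)) I.X I.R"
  proof (rule I.X_acts_trivially)
    fix g :: "'p mat2" and w assume g: "g \<in> J_grp 1 (Suc l)" and w: "w \<in> W"
    obtain a b c d where g': "g = mat2 a b c d" by (rule mat2_cases)
    have k: "a * d - b * c = 1" "a - 1 \<in> pZp (int l + 1)" "d - 1 \<in> pZp (int l + 1)"
      "b \<in> pZp (int l)" "c \<in> pZp (int l + 2)"
      using g by (simp_all add: g' J_grp_mat2 add.commute)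
    have "a \<in> Zp" "d \<in> Zp" using Zp_add[OF pZp_Zp[OF k(2)] Zp_1] Zp_add[OF pZp_Zp[OF k(3)] Zp_1]
      by simp_all
    then have gI: "mat2 a b c d \<in> Iw" using k pZp_Zp[OF k(4)] pZp_mono[OF k(5), of 1]
      by (simp add: Iw_mat2)
    have "\<sigma> (mat2 a b c d) w = w"
      by (rule ramified_trivial[OF D C gI _ _ k(4) _ w]) (auto intro: pZp_mono[OF k(2)] pZp_mono[OF k(3)] pZp_mono[OF k(5)])
    then show "g \<in> Iw \<and> \<sigma> g w = w" using gI by (simp add: g')
  qed
  \<comment> \<open>J^1_l contains N_(l-1), because its upper entries range over p^(l-1); this rules
    out conductor l.\<close>
  have cond: "rep_conductor 1 I.X I.R = Suc l"
  proof (rule rep_conductor_eqI[OF _ triv])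
    show "\<not> acts_trivially (J_grp 1 l) I.X I.R"
      by (rule I.X_not_acts_trivially[OF ramified_nofix_N[OF D C]])
        (use l in \<open>auto simp: N_grp_def xm_def J_grp_mat2 Iw_mat2 dest: pZp_Zp\<close>)
  qed simp
  have "N_grp (int l - 2) \<subseteq> N_grp (int (Suc l) - 2 * int 1 - 1) \<inter> (Kd 1 :: 'p mat2 set)"
    using N_K by auto
  then have "Hom_to_triv_zero (N_grp (int (Suc l) - 2 * int 1 - 1) \<inter> Kd 1) I.X I.R"
    unfolding N_grp_def[of "int l - 2"]
  proof (rule Hom_to_triv_zeroI[OF I.X_rep _ xm_add _ nN[unfolded N_grp_def], rotated 2])
    show "xm s \<in> Kd 1" if "s \<in> pZp (int l - 2)" for s :: "'p padic" using that N_K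
      by (auto simp: N_grp_def)
    show "I.R (xm s) v = v" if "s \<in> pZp (int l - 2 + int 2)" "v \<in> I.X" for s v
    proof -
      have "xm s \<in> J_grp 1 (Suc l)" using that(1) by (simp add: xm_def J_grp_mat2)
      then show ?thesis using triv that(2) unfolding acts_trivially_def by blast
    qed
  qed
  then have sc: "strongly_cuspidal 1 I.X I.R" unfolding strongly_cuspidal_def cond using I.X_rep triv by blast
  \<comment> \<open>Evaluation at w0 is invariant under N_(l-1): w0 x(s) = y(-p^2 s) w0, and -p^2 s
    lies in p^(l+1), where lower unipotents act trivially on W.\<close>
  have "\<not> Hom_to_triv_zero (N_grp (int (Suc l) - int 1 - 1) \<inter> Kd 1) I.X I.R"
  proof (rule I.X_Hom_to_nonzero[OF I.w0])
    fix g :: "'p mat2" assume "g \<in> N_grp (int (Suc l) - int 1 - 1) \<inter> Kd 1"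
    then obtain s where s: "g = xm s" "s \<in> pZp (int l - 1)" by (auto simp: N_grp_def)
    have y: "- (s * unif\<^sup>2) \<in> pZp (int l + 1)" using pZp_mult[OF s(2) unif_power_pZp[of 2]]
      by (simp add: add.commute)
    have "?w0 ** xm s = ym (- (s * unif\<^sup>2)) ** ?w0" by (simp add: wm_def xm_def ym_def power2_eq_square)
    moreover have "\<forall>w\<in>W. \<sigma> (ym (- (s * unif\<^sup>2))) w = w" using I.u_triv[OF y] by blast
    ultimately show "\<exists>i\<in>Iw. ?w0 ** g = i ** ?w0 \<and> (\<forall>w\<in>W. \<sigma> i w = w)"
      using I.u_K[OF y] s(1) by blast
  qed
  then have df: "defect 1 I.X I.R = 1" unfolding defect_def cond by (simp only: if_True not_False_eq_True)
  have Hf: "Hom_from_triv_zero (Nbar_grp (int l)) I.X I.R"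
    using Hom_from_triv_zero_iff[OF I.X_subspace, of "Nbar_grp (int l)" I.R] repD(2)[OF I.X_rep] Nbar_K nB
      by blast
  have phi: "phi_vec \<sigma> w \<in> I.X"
    "\<forall>n\<in>N_grp (int l). I.R n (phi_vec \<sigma> w) = phi_vec \<sigma> w"
    "\<forall>n\<in>Nbar_grp (int l + 1). I.R n (phi_vec \<sigma> w) = phi_vec \<sigma> w"
    "\<forall>u\<in>Zp_units. I.R (hm u) (phi_vec \<sigma> w) = ?\<mu> u *\<^sub>C phi_vec \<sigma> w"
      if w: "w \<in> weight_space W \<sigma> ?\<mu>" for w
  proof -
    note wW = wW[OF w]
    show "phi_vec \<sigma> w \<in> I.X" by (rule I.phi_X[OF wW])
    show "\<forall>n\<in>N_grp (int l). I.R n (phi_vec \<sigma> w) = phi_vec \<sigma> w"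
    proof
      fix n :: "'p mat2" assume "n \<in> N_grp (int l)"
      then obtain s where s: "n = mat2 1 s 0 1" "s \<in> pZp (int l)" by (auto simp: N_grp_def xm_def)
      have nI: "n \<in> Iw" using pZp_Zp[OF s(2)] by (simp add: s(1) Iw_mat2)
      have "\<sigma> n w = w" unfolding s(1) using nI s wW by (intro ramified_trivial[OF D C]) simp_all
      then show "I.R n (phi_vec \<sigma> w) = phi_vec \<sigma> w" using I.R_phi[OF nI wW] by simp
    qed
    show "\<forall>n\<in>Nbar_grp (int l + 1). I.R n (phi_vec \<sigma> w) = phi_vec \<sigma> w"
      unfolding Nbar_grp_def using I.R_phi[OF I.u_K wW] I.u_triv[OF _ wW] by simp
    show "\<forall>u\<in>Zp_units. I.R (hm u) (phi_vec \<sigma> w) = ?\<mu> u *\<^sub>C phi_vec \<sigma> w"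
    proof
      fix u :: "'p padic" assume u: "u \<in> Zp_units"
      have "hm u \<in> Iw" using u by (auto simp: hm_def Iw_mat2 Zp_units_nz Zp_units_Zp Zp_units_inverse)
      moreover have "\<sigma> (hm u) w = ?\<mu> u *\<^sub>C w" using w u by (simp add: weight_space_def)
      ultimately show "I.R (hm u) (phi_vec \<sigma> w) = ?\<mu> u *\<^sub>C phi_vec \<sigma> w"
        using I.R_phi[OF _ wW] I.phi_scale[OF wW] by simp
    qed
  qed
  show ?thesis
    unfolding Let_def K1_Kd Suc_eq_plus1[symmetric]
    using I.X_irreducible sc cond df phi mem[unfolded Suc_eq_plus1[symmetric]] N[unfolded Suc_eq_plus1[symmetric]] Hf
    by (intro conjI ballI impI) (simp_all del: One_nat_def)
qed

lemma ramified_odd: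
  assumes od: "odd l" and D: "ramified_datum l V \<tau>"
    and C: "irreducible_constituent (GLsub Iw) V \<tau> W \<sigma>"
    and cc: "centrally_compatible W \<sigma> (twist_legendre \<eta>)"
  shows "let m = (l - 1) div 2; X = Ind (GLsub K0) Iw W \<sigma>;
           R\<alpha> = conj_alpha (right_transl (GLsub K0));
           Rt = genuine_lift s1 R\<alpha>; \<pi> = c_Ind cover (full_preimage K1) X Rt in
        irreducible_rep (GLsub K1) X R\<alpha> \<and> strongly_cuspidal 1 X R\<alpha> \<and>
        rep_conductor 1 X R\<alpha> = l + 1 \<and> defect 1 X R\<alpha> = 1 \<and>
        (\<forall>w\<in>weight_space W \<sigma> (twist_legendre \<eta>).
           phi_vec \<sigma> w \<in> X \<and>
           f_vec m K1 Rt (phi_vec \<sigma> w) \<in> eta_space \<pi> \<eta> (2 * l + 1) \<and>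
           (w \<noteq> 0 \<longrightarrow> is_newvector \<pi> \<eta> (f_vec m K1 Rt (phi_vec \<sigma> w)))) \<and>
        has_eta_conductor \<pi> \<eta> (2 * l + 1)"
proof -
  note l = ramified_level[OF D C]
  let ?\<mu> = "twist_legendre \<eta>"
  interpret I: iwahori_induction 0 W \<sigma> "wm 1" xm "\<lambda>s. ym (- s)" 0 "int l"
    by (rule ramified_induction_K0[OF D C])
  let ?R = "conj_alpha I.R"
  have rep1: "representation (GLsub (Kd 1)) I.X ?R"
    using conj_alpha_rep[OF I.X_rep[folded K0_Kd]] by (simp only: K1_Kd K0_Kd)
  interpret G: genuine_rep 1 s1 I.X ?R
    using odd_p s1 rep1 by unfold_locales simp_all
  have wW: "w \<in> W" if "w \<in> weight_space W \<sigma> ?\<mu>" for w using that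
    by (simp add: weight_space_def)
  have m: "2 * int ((l - 1) div 2) = int l - 1" using od by (auto elim!: oddE)
  have IwK1: "Iw \<subseteq> (Kd 1 :: 'p mat2 set)" using Iw_K1 by (simp only: K1_Kd)
  have mem: "f_vec ((l - 1) div 2) (Kd 1) (genuine_lift s1 ?R) (phi_vec \<sigma> w) \<in> eta_space G.\<pi> \<eta> (2 * l + 1)"
    if w: "w \<in> weight_space W \<sigma> ?\<mu>" for w
  proof (rule G.f_vec_eta_space_Iw[OF I.phi_X[OF wW[OF w]] IwK1])
    show "1 \<le> int (2 * l + 1) - 2 * int ((l - 1) div 2)" unfolding m using l by simp
    show "of_int (if (1::nat) = 0 then 1 else legendre_p d) *\<^sub>C ?R (mat2 a b c d) (phi_vec \<sigma> w) = \<eta> d *\<^sub>C phi_vec \<sigma> w"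
      if k: "mat2 a b c d \<in> Iw" "b \<in> pZp (2 * int ((l - 1) div 2))"
        "c \<in> pZp (int (2 * l + 1) - 2 * int ((l - 1) div 2))" for a b c d
    proof -
      \<comment> \<open>Here b lies in p^(l-1) and c in p^(l+2); conjugation by \<alpha> yields p^l
        and p^(l+1), the trivial range of \<sigma>.\<close>
      have bc: "unif * b \<in> pZp (int l)" "inverse unif * c \<in> pZp (int l + 1)"
        using k(2,3) unfolding m unif_pZp_iff inverse_unif_pZp by (simp_all add: algebra_simps)
      have e: "unif * b * (inverse unif * c) = b * c" by (simp add: field_simps)
      have kI: "mat2 a (unif * b) (inverse unif * c) d \<in> Iw"
        using k(1) bc l pZp_Zp[OF bc(1)] pZp_mono[OF bc(2), of 1] unfolding Iw_mat2 e by simp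
      have "\<sigma> (mat2 a (unif * b) (inverse unif * c) d) w = ?\<mu> d *\<^sub>C w"
        by (rule ramified_weight(2)[OF D C eta_quadratic(2) w kI bc])
      then have "?R (mat2 a b c d) (phi_vec \<sigma> w) = ?\<mu> d *\<^sub>C phi_vec \<sigma> w"
        unfolding conj_alpha_eq conj_al_mat2 using I.R_phi[OF kI wW[OF w]] I.phi_scale[OF wW[OF w]] by simp
      then show ?thesis using legendre_twist_cancel[OF Iw_diag_units(2)[OF k(1)]] by simp
    qed
  qed
  have N_Kd: "N_grp (int l - 1) \<subseteq> (Kd 0 :: 'p mat2 set)"
    and Nbar_Kd: "Nbar_grp (int l - 1) \<subseteq> (Kd 0 :: 'p mat2 set)"
    using l by (intro N_grp_Kd Nbar_grp_Kd; simp)+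
  have N_Iw: "N_grp (int l - 1) \<subseteq> (Iw :: 'p mat2 set)" using l
    by (auto simp: N_grp_def intro!: xm_in(1) elim: pZp_Zp)
  have Nbar_Iw: "Nbar_grp (int l) \<subseteq> (Iw :: 'p mat2 set)" using l
    by (auto simp: Nbar_grp_def intro!: xm_in(2) elim: pZp_mono)
  have n1: "nofix (N_grp (int l - 1)) I.X I.R"
    by (rule nofix_mono[OF I.nofix_X[OF ramified_nofix_N[OF D C] N_Iw]])
      (use N_grp_antimono[of "int l - 1" "int l", where 'a = 'p] in \<open>simp add: N_grp_def\<close>)
  have n2: "nofix (Nbar_grp (int l - 1)) I.X I.R"
  proof (rule nofix_conj[OF I.X_rep n1 N_Kd Nbar_Kd I.w0 I.KG(4)[OF I.w0]])
    show "adj2 (wm 1) ** wm 1 = (mat 1 :: 'p mat2)" by (rule I.K_adj(1)[OF I.w0])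
    fix g :: "'p mat2" assume "g \<in> N_grp (int l - 1)"
    then obtain s where s: "g = xm s" "s \<in> pZp (int l - 1)" by (auto simp: N_grp_def)
    have "xm s ** wm 1 = wm 1 ** ym (- s)" by (simp add: wm_def xm_def ym_def)
    then show "\<exists>s'\<in>Nbar_grp (int l - 1). g ** wm 1 = wm 1 ** s'"
      using pZp_uminus[OF s(2)] unfolding Nbar_grp_def s(1) by blast
  qed
  \<comment> \<open>N_l and Nbar_l each fix nonzero vectors of the induced representation, but no
    common one. Under \<alpha> this concerns the pair N_(l-1), Nbar_(l+1).\<close>
  have n3: "nofix (N_grp (int l) \<union> Nbar_grp (int l)) I.X I.R"
    using I.nofix_X[OF ramified_nofix_Nbar[OF D C] Nbar_Iw] by (simp add: N_grp_def)
  have N_K1: "N_grp (int l - 2) \<subseteq> (Kd 1 :: 'p mat2 set)"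
    "N_grp (int l - 1) \<subseteq> (Kd 1 :: 'p mat2 set)"
    and Nbar_K1: "Nbar_grp (int l) \<subseteq> (Kd 1 :: 'p mat2 set)"
      "Nbar_grp (int l + 1) \<subseteq> (Kd 1 :: 'p mat2 set)"
    using l by (intro N_grp_Kd Nbar_grp_Kd; simp)+
  have a1: "nofix (N_grp (int l - 2)) I.X ?R" and a2: "nofix (Nbar_grp (int l)) I.X ?R"
    and a3: "nofix (N_grp (int l - 1) \<union> Nbar_grp (int l + 1)) I.X ?R"
    unfolding conj_alpha_nofix image_Un
      using conj_al_N[of "int l - 2", where 'a = 'p] conj_al_N[of "int l - 1", where 'a = 'p]
      conj_al_Nbar[of "int l - 1", where 'a = 'p] conj_al_Nbar[of "int l", where 'a = 'p] n1 n2 n3 by simp_all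
  have aN: "nofix (N_grp a \<inter> Kd 1) I.X ?R" if "a \<le> int l - 2" for a
    by (rule nofix_mono[OF a1]) (use N_grp_antimono[OF that] N_K1(1) in blast)
  have aB: "nofix (Nbar_grp b \<inter> Kd 1) I.X ?R" if "b \<le> int l" for b
    by (rule nofix_mono[OF a2]) (use Nbar_grp_antimono[OF that] Nbar_K1(1) in blast)
  have van: "f = 0" if f: "f \<in> eta_space G.\<pi> \<eta> (2 * l + 1 - 1)" for f
  proof (rule G.eta_space_vanish[OF f eta_quadratic(3)])
    fix n :: int
    \<comment> \<open>For odd l the value 2n = l - 1 does occur; there r - 2n = l + 1, and the joint
      statement \<open>a3\<close> applies.\<close>
    have "2 * n \<le> int l - 2 \<or> 2 * n = int l - 1 \<or> int (2 * l + 1 - 1) - 2 * n \<le> int l"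
      using od by (auto elim!: oddE)
    then show "nofix ((N_grp (2 * n) \<union> Nbar_grp (int (2 * l + 1 - 1) - 2 * n)) \<inter> Kd 1) I.X ?R"
    proof (elim disjE)
      assume n: "2 * n = int l - 1"
      have "int (2 * l + 1 - 1) - 2 * n = int l + 1" using n by simp
      then show ?thesis unfolding n using a3 N_K1(2) Nbar_K1(2) by (auto elim: nofix_mono)
    qed (auto intro: nofix_mono[OF aN[of "2 * n"]] nofix_mono[OF aB[of "int (2 * l + 1 - 1) - 2 * n"]])
    show "nofix (Nbar_grp (int (2 * l + 1 - 1) - 2 * n) \<inter> Kd 1) I.X ?R \<or> nofix (Nbar_grp (2 * n + 2 * int 1 - 2) \<inter> Kd 1) I.X ?R"
      using aB[of "int (2 * l + 1 - 1) - 2 * n"] aB[of "2 * n + 2 * int 1 - 2"] by linarith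
  qed
  have nz: "f_vec ((l - 1) div 2) (Kd 1) (genuine_lift s1 ?R) (phi_vec \<sigma> w) \<noteq> 0"
    if "w \<in> weight_space W \<sigma> ?\<mu>" "w \<noteq> 0" for w
    using that wW by (intro G.f_vec_nz[OF refl refl] I.phi_X I.phi_nz) auto
  note N = G.newvector_level[of "weight_space W \<sigma> ?\<mu>"
    "\<lambda>w. f_vec ((l - 1) div 2) (Kd 1) (genuine_lift s1 ?R) (phi_vec \<sigma> w)" \<eta> "2 * l + 1",
      OF mem nz ramified_weight(1)[OF D C eta_quadratic(2) cc] _ quadratic_char_conductor[OF eta_quadratic(1)] van]
  have triv: "acts_trivially (J_grp 0 (Suc l)) I.X I.R"
  proof (rule I.X_acts_trivially)
    fix g :: "'p mat2" and w assume g: "g \<in> J_grp 0 (Suc l)" and w: "w \<in> W"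
    obtain a b c d where g': "g = mat2 a b c d" by (rule mat2_cases)
    have k: "a * d - b * c = 1" "a - 1 \<in> pZp (int l + 1)" "d - 1 \<in> pZp (int l + 1)"
      "b \<in> pZp (int l + 1)" "c \<in> pZp (int l + 1)"
      using g by (simp_all add: g' J_grp_mat2 add.commute)
    have "a \<in> Zp" "d \<in> Zp" using Zp_add[OF pZp_Zp[OF k(2)] Zp_1] Zp_add[OF pZp_Zp[OF k(3)] Zp_1]
      by simp_all
    then have gI: "mat2 a b c d \<in> Iw" using k pZp_Zp[OF k(4)] pZp_mono[OF k(5), of 1]
      by (simp add: Iw_mat2)
    have "\<sigma> (mat2 a b c d) w = w"
      by (rule ramified_trivial[OF D C gI _ _ _ k(5) w]) (auto intro: pZp_mono[OF k(2)] pZp_mono[OF k(3)] pZp_mono[OF k(4)])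
    then show "g \<in> Iw \<and> \<sigma> g w = w" using gI by (simp add: g')
  qed
  \<comment> \<open>Nbar_l lies in J^0_l and fixes no nonzero vector of W, which rules out conductor
    l.\<close>
  have cond: "rep_conductor 1 I.X ?R = Suc l"
    unfolding conj_alpha_conductor
  proof (rule rep_conductor_eqI[OF _ triv])
    show "\<not> acts_trivially (J_grp 0 l) I.X I.R"
      by (rule I.X_not_acts_trivially[OF ramified_nofix_Nbar[OF D C] Nbar_Iw]) (auto simp: Nbar_grp_def ym_def J_grp_mat2)
  qed simp
  have triv1: "acts_trivially (J_grp 1 (Suc l)) I.X ?R" using triv by (simp only: conj_alpha_acts_trivially)
  have "N_grp (int l - 2) \<subseteq> N_grp (int (Suc l) - 2 * int 1 - 1) \<inter> (Kd 1 :: 'p mat2 set)"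
    using N_K1 by auto
  then have "Hom_to_triv_zero (N_grp (int (Suc l) - 2 * int 1 - 1) \<inter> Kd 1) I.X ?R"
    unfolding N_grp_def[of "int l - 2"]
  proof (rule Hom_to_triv_zeroI[OF rep1 _ xm_add _ a1[unfolded N_grp_def], rotated 2])
    show "xm s \<in> Kd 1" if "s \<in> pZp (int l - 2)" for s :: "'p padic" using that N_K1(1)
      by (auto simp: N_grp_def)
    show "?R (xm s) v = v" if "s \<in> pZp (int l - 2 + int 2)" "v \<in> I.X" for s v
    proof -
      have "xm s \<in> J_grp 1 (Suc l)" using that(1) by (simp add: xm_def J_grp_mat2)
      then show ?thesis using triv1 that(2) unfolding acts_trivially_def by blast
    qed
  qed
  then have sc: "strongly_cuspidal 1 I.X ?R" unfolding strongly_cuspidal_def cond using rep1 triv1 by blast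
  \<comment> \<open>Under \<alpha> the group N_(l-1) of the defect becomes N_l, which acts trivially
    on W, so evaluation at 1 is invariant.\<close>
  have "\<not> Hom_to_triv_zero (conj_al ` (N_grp (int (Suc l) - int 1 - 1) \<inter> Kd 1)) I.X I.R"
  proof (rule I.X_Hom_to_nonzero[OF I.KG(2)])
    fix g :: "'p mat2" assume "g \<in> conj_al ` (N_grp (int (Suc l) - int 1 - 1) \<inter> Kd 1)"
    then have "g \<in> N_grp (int l)" using conj_al_N[of "int l - 1", where 'a = 'p] by auto
    then obtain s where s: "g = xm s" "s \<in> pZp (int l)" by (auto simp: N_grp_def)
    show "\<exists>i\<in>Iw. mat 1 ** g = i ** mat 1 \<and> (\<forall>w\<in>W. \<sigma> i w = w)"
      using I.u_K[OF s(2)] I.u_triv[OF s(2)] s(1) by (intro bexI[of _ g]) simp_all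
  qed
  then have df: "defect 1 I.X ?R = 1" unfolding defect_def cond conj_alpha_Hom_to
    by (simp only: if_True not_False_eq_True)
  have irr: "irreducible_rep (GLsub (Kd 1)) I.X ?R"
    using conj_alpha_irreducible[OF I.X_irreducible[folded K0_Kd]] by (simp only: K1_Kd K0_Kd)
  show ?thesis
    unfolding Let_def K1_Kd K0_Kd Suc_eq_plus1[symmetric]
    using irr sc cond df I.phi_X[OF wW] mem[unfolded Suc_eq_plus1[symmetric]] N[unfolded Suc_eq_plus1[symmetric]]
    by (intro conjI ballI impI) (simp_all del: One_nat_def)
qed

end

theorem proposition4p13:
  fixes \<eta> :: "'p::prime_type padic \<Rightarrow> complex"
    and l :: nat
    and s0 s1 :: "'p mat2 \<Rightarrow> int"
    and V :: "'t::complex_vector set" and \<tau> :: "'p mat2 \<Rightarrow> 't \<Rightarrow> 't"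
    and W :: "'w::complex_vector set" and \<rho> \<sigma> :: "'p mat2 \<Rightarrow> 'w \<Rightarrow> 'w"
  assumes odd_p: "odd CARD('p)"
    and eta: "\<eta> = (\<lambda>_. 1) \<or> \<eta> = (\<lambda>u. of_int (legendre_p u))"
    and level: "l \<ge> 1"
    and s0: "is_splitting 0 s0"
    and s1: "is_splitting 1 s1"
  shows
    "\<comment> \<open>(i)\<close>
     (even l \<and> unramified_datum l V \<tau> \<and> irreducible_constituent (GLsub K0) V \<tau> W \<rho> \<and>
      strongly_cuspidal 0 W \<rho> \<and> centrally_compatible W \<rho> \<eta> \<longrightarrow>
      (let m = l div 2; \<rho>t = genuine_lift s0 \<rho>; \<pi> = c_Ind cover (full_preimage K0) W \<rho>t in
        rep_conductor 0 W \<rho> = l \<and> defect 0 W \<rho> = 0 \<and>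
        (\<forall>w\<in>weight_space W \<rho> \<eta>.
           f_vec m K0 \<rho>t w \<in> eta_space \<pi> \<eta> (2 * l) \<and>
           (\<forall>n\<in>Nbar_grp (int l). \<rho> n w = w) \<and>
           (w \<noteq> 0 \<longrightarrow> is_newvector \<pi> \<eta> (f_vec m K0 \<rho>t w))) \<and>
        Hom_from_triv_zero (Nbar_grp (int l - 1)) W \<rho> \<and>
        has_eta_conductor \<pi> \<eta> (2 * l)))
     \<and>
     \<comment> \<open>(ii)\<close>
     (odd l \<and> unramified_datum l V \<tau> \<and> irreducible_constituent (GLsub K0) V \<tau> W \<rho> \<and>
      strongly_cuspidal 0 W \<rho> \<and> centrally_compatible W \<rho> (twist_legendre \<eta>) \<longrightarrow>
      (let m = (l - 1) div 2; \<rho>\<alpha> = conj_alpha \<rho>; \<rho>t = genuine_lift s1 \<rho>\<alpha>;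
           \<pi> = c_Ind cover (full_preimage K1) W \<rho>t in
        rep_conductor 0 W \<rho> = l \<and> defect 0 W \<rho> = 0 \<and>
        strongly_cuspidal 1 W \<rho>\<alpha> \<and> rep_conductor 1 W \<rho>\<alpha> = l \<and> defect 1 W \<rho>\<alpha> = 0 \<and>
        (\<forall>w\<in>weight_space W \<rho> (twist_legendre \<eta>).
           f_vec m K1 \<rho>t w \<in> eta_space \<pi> \<eta> (2 * l) \<and>
           (\<forall>n\<in>Nbar_grp (int l). \<rho> n w = w) \<and>
           (w \<noteq> 0 \<longrightarrow> is_newvector \<pi> \<eta> (f_vec m K1 \<rho>t w))) \<and>
        Hom_from_triv_zero (Nbar_grp (int l - 1)) W \<rho> \<and>
        has_eta_conductor \<pi> \<eta> (2 * l)))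
     \<and>
     \<comment> \<open>(iii)\<close>
     (even l \<and> ramified_datum l V \<tau> \<and> irreducible_constituent (GLsub Iw) V \<tau> W \<sigma> \<and>
      centrally_compatible W \<sigma> (twist_legendre \<eta>) \<longrightarrow>
      (let m = l div 2; X = Ind (GLsub K1) Iw W \<sigma>; R = right_transl (GLsub K1);
           Rt = genuine_lift s1 R; \<pi> = c_Ind cover (full_preimage K1) X Rt in
        irreducible_rep (GLsub K1) X R \<and> strongly_cuspidal 1 X R \<and>
        rep_conductor 1 X R = l + 1 \<and> defect 1 X R = 1 \<and>
        (\<forall>w\<in>weight_space W \<sigma> (twist_legendre \<eta>).
           phi_vec \<sigma> w \<in> X \<and>
           (\<forall>n\<in>N_grp (int l). R n (phi_vec \<sigma> w) = phi_vec \<sigma> w) \<and>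
           (\<forall>n\<in>Nbar_grp (int l + 1). R n (phi_vec \<sigma> w) = phi_vec \<sigma> w) \<and>
           (\<forall>u\<in>Zp_units. R (hm u) (phi_vec \<sigma> w) = twist_legendre \<eta> u *\<^sub>C phi_vec \<sigma> w) \<and>
           f_vec m K1 Rt (phi_vec \<sigma> w) \<in> eta_space \<pi> \<eta> (2 * l + 1) \<and>
           (w \<noteq> 0 \<longrightarrow> is_newvector \<pi> \<eta> (f_vec m K1 Rt (phi_vec \<sigma> w)))) \<and>
        Hom_from_triv_zero (Nbar_grp (int l)) X R \<and>
        has_eta_conductor \<pi> \<eta> (2 * l + 1)))
     \<and>
     \<comment> \<open>(iv)\<close>
     (odd l \<and> ramified_datum l V \<tau> \<and> irreducible_constituent (GLsub Iw) V \<tau> W \<sigma> \<and>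
      centrally_compatible W \<sigma> (twist_legendre \<eta>) \<longrightarrow>
      (let m = (l - 1) div 2; X = Ind (GLsub K0) Iw W \<sigma>;
           R\<alpha> = conj_alpha (right_transl (GLsub K0));
           Rt = genuine_lift s1 R\<alpha>; \<pi> = c_Ind cover (full_preimage K1) X Rt in
        irreducible_rep (GLsub K1) X R\<alpha> \<and> strongly_cuspidal 1 X R\<alpha> \<and>
        rep_conductor 1 X R\<alpha> = l + 1 \<and> defect 1 X R\<alpha> = 1 \<and>
        (\<forall>w\<in>weight_space W \<sigma> (twist_legendre \<eta>).
           phi_vec \<sigma> w \<in> X \<and>
           f_vec m K1 Rt (phi_vec \<sigma> w) \<in> eta_space \<pi> \<eta> (2 * l + 1) \<and>
           (w \<noteq> 0 \<longrightarrow> is_newvector \<pi> \<eta> (f_vec m K1 Rt (phi_vec \<sigma> w)))) \<and>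
        has_eta_conductor \<pi> \<eta> (2 * l + 1)))"
  by (intro conjI impI; elim conjE)
    (rule unramified_even[OF odd_p eta s0 s1] unramified_odd[OF odd_p eta s0 s1]
      ramified_even[OF odd_p eta s0 s1] ramified_odd[OF odd_p eta s0 s1]; assumption)+

end
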